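(* Let $n,k,s$ be integers with $0\le k\le n$ and $s\ge 1$, and let $\mathbf{d}=(d_1,\dots,d_s)$ be integers with all $d_i\ge 2$ and $\mathbf{d}\ne(2)$. Let $[\Lambda']\in \operatorname{Gr}(k,n)$ be generic, and let $[\mathbf{f}]\in\mathbb{P}\,\Gamma_{n+1}(\mathbf{d})$ be generic such that $\Lambda'\subseteq V(\mathbf{f})$. Then $F_k(V(\mathbf{f}))=[\Lambda']$ if and only if $\delta(n,\mathbf{d},k)<0$.
   Context: Work over $\mathbb{C}$. $\operatorname{Gr}(k,n)$ is the Grassmannian of $k$-dimensional projective linear subspaces ($k$-planes) $\Lambda\subseteq\mathbb{P}^n$; $[\Lambda]$ is the point corresponding to $\Lambda$. $\Gamma_{n+1}(d)$ is the vector space of homogeneous polynomials of degree $d$ in $n+1$ variables, and $\Gamma_{n+1}(\mathbf{d})=\prod_{i=1}^s\Gamma_{n+1}(d_i)$. For $\mathbf{f}=(f^{(1)},\dots,f^{(s)})\in\Gamma_{n+1}(\mathbf{d})$, $V(\mathbf{f})\subseteq\mathbb{P}^n$ is the common zero locus, and $F_k(V(\mathbf{f}))\subseteq\operatorname{Gr}(k,n)$ is the Fano scheme parametrizing $k$-planes contained in $V(\mathbf{f})$. "Scheme" may be read as "variety", so $F_k(V(\mathbf{f}))=[\Lambda']$ means that $\Lambda'$ is the only $k$-plane contained in $V(\mathbf{f})$. Set $\binom{\mathbf{d}+k}{k}=\sum_{i=1}^s\binom{d_i+k}{k}$ and $\delta(n,\mathbf{d},k)=(k+1)(n-k)-\binom{\mathbf{d}+k}{k}$.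 Genericity: for $\Lambda'$ in some dense Zariski-open subset of $\operatorname{Gr}(k,n)$, the conclusion holds for all $[\mathbf{f}]$ in some dense Zariski-open subset of the projective space $\mathbb{P}\,S_{\Lambda'}(\mathbf{d})$, where $S_{\Lambda'}(\mathbf{d})\subseteq\Gamma_{n+1}(\mathbf{d})$ is the linear subspace of tuples $\mathbf{f}$ with $\Lambda'\subseteq V(\mathbf{f})$. *)

theory Defs
  imports
    "HOL-Analysis.Analysis"
    "HOL-Library.Poly_Mapping"
    "HOL-Combinatorics.Permutations"
begin

section \<open>Polynomials\<close>

text \<open>
  A polynomial over the complex numbers with variables indexed by \<^typ>\<open>'x\<close> is a finitely
  supported map from exponent vectors to coefficients; the ring operations are those of
  \<^theory>\<open>HOL-Library.Poly_Mapping\<close>.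
\<close>

type_synonym 'x monomial = "'x \<Rightarrow>\<^sub>0 nat"
type_synonym 'x mpoly = "'x monomial \<Rightarrow>\<^sub>0 complex"

definition mono_eval :: "'x monomial \<Rightarrow> ('x \<Rightarrow> complex) \<Rightarrow> complex" where
  "mono_eval m x = (\<Prod>i\<in>Poly_Mapping.keys m. x i ^ Poly_Mapping.lookup m i)"

definition poly_eval :: "'x mpoly \<Rightarrow> ('x \<Rightarrow> complex) \<Rightarrow> complex" where
  "poly_eval p x = (\<Sum>m\<in>Poly_Mapping.keys p. Poly_Mapping.lookup p m * mono_eval m x)"

definition total_degree :: "'x monomial \<Rightarrow> nat" where
  "total_degree m = (\<Sum>i\<in>Poly_Mapping.keys m. Poly_Mapping.lookup m i)"

text \<open>The zero polynomial is homogeneous of every degree.\<close>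

definition homogeneous :: "nat \<Rightarrow> 'x mpoly \<Rightarrow> bool" where
  "homogeneous e p \<longleftrightarrow> (\<forall>m\<in>Poly_Mapping.keys p. total_degree m = e)"

lemma mono_eval_superset:
  assumes "finite A" "Poly_Mapping.keys m \<subseteq> A"
  shows "mono_eval m x = (\<Prod>i\<in>A. x i ^ Poly_Mapping.lookup m i)"
  unfolding mono_eval_def by (rule prod.mono_neutral_left) (use assms in \<open>auto simp: in_keys_iff\<close>)

lemma total_degree_superset:
  assumes "finite A" "Poly_Mapping.keys m \<subseteq> A"
  shows "total_degree m = (\<Sum>i\<in>A. Poly_Mapping.lookup m i)"
  unfolding total_degree_def by (rule sum.mono_neutral_left) (use assms in \<open>auto simp: in_keys_iff\<close>)

lemma poly_eval_superset:
  assumes "finite A" "Poly_Mapping.keys p \<subseteq> A"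
  shows "poly_eval p x = (\<Sum>m\<in>A. Poly_Mapping.lookup p m * mono_eval m x)"
  unfolding poly_eval_def by (rule sum.mono_neutral_left) (use assms in \<open>auto simp: in_keys_iff\<close>)

lemma mono_eval_add: "mono_eval (m + m') x = mono_eval m x * mono_eval m' x"
proof -
  let ?A = "Poly_Mapping.keys m \<union> Poly_Mapping.keys m'"
  have "Poly_Mapping.keys (m + m') \<subseteq> ?A" by (rule keys_add)
  then show ?thesis
    by (simp add: mono_eval_superset[of ?A] lookup_add power_add prod.distrib)
qed

lemma total_degree_add: "total_degree (m + m') = total_degree m + total_degree m'"
proof -
  let ?A = "Poly_Mapping.keys m \<union> Poly_Mapping.keys m'"
  have "Poly_Mapping.keys (m + m') \<subseteq> ?A" by (rule keys_add)
  then show ?thesis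
    by (simp add: total_degree_superset[of ?A] lookup_add sum.distrib)
qed

lemma poly_eval_add: "poly_eval (p + q) x = poly_eval p x + poly_eval q x"
proof -
  let ?A = "Poly_Mapping.keys p \<union> Poly_Mapping.keys q"
  have "Poly_Mapping.keys (p + q) \<subseteq> ?A" by (rule keys_add)
  then show ?thesis
    by (simp add: poly_eval_superset[of ?A] lookup_add sum.distrib algebra_simps)
qed

lemma poly_eval_zero [simp]: "poly_eval 0 x = 0"
  by (simp add: poly_eval_def)

lemma poly_eval_one [simp]: "poly_eval 1 x = 1"
  by (simp add: poly_eval_def mono_eval_def)

lemma poly_eval_single: "poly_eval (Poly_Mapping.single m c) x = c * mono_eval m x"
  by (simp add: poly_eval_def)

lemma poly_mapping_add_single_induct [case_names zero add]:
  assumes "P 0" and "\<And>p m c. P p \<Longrightarrow> P (p + Poly_Mapping.single m c)"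
  shows "P p"
proof (induction p rule: update_induct)
  case const
  show ?case by (rule assms(1))
next
  case (update f a b)
  have "Poly_Mapping.update a b f = f + Poly_Mapping.single a b"
    using update(1) by (intro poly_mapping_eqI) (auto simp: lookup_update lookup_add lookup_single in_keys_iff)
  then show ?case using assms(2) update by simp
qed

lemma poly_eval_mult: "poly_eval (p * q) x = poly_eval p x * poly_eval q x"
proof (induction p rule: poly_mapping_add_single_induct)
  case zero
  show ?case by simp
next
  case (add p m c)
  have "poly_eval (Poly_Mapping.single m c * q) x = c * mono_eval m x * poly_eval q x"
    by (induction q rule: poly_mapping_add_single_induct)
       (simp_all add: distrib_left poly_eval_add mult_single poly_eval_single mono_eval_add algebra_simps)
  with add show ?case by (simp add: distrib_right poly_eval_add poly_eval_single)
qed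

lemma homogeneous_mult:
  assumes "homogeneous a p" "homogeneous b q"
  shows "homogeneous (a + b) (p * q)"
  using assms keys_mult[of p q] unfolding homogeneous_def by (force simp: total_degree_add)

lemma homogeneous_one [simp]: "homogeneous 0 1"
  by (simp add: homogeneous_def total_degree_def)

lemma poly_eval_scale:
  assumes "homogeneous e p"
  shows "poly_eval p (\<lambda>i. c * x i) = c ^ e * poly_eval p x"
proof -
  have "mono_eval m (\<lambda>i. c * x i) = c ^ e * mono_eval m x" if "m \<in> Poly_Mapping.keys p" for m
    using assms that
    by (auto simp: mono_eval_def homogeneous_def total_degree_def power_mult_distrib prod.distrib power_sum)
  then show ?thesis
    by (simp add: poly_eval_def sum_distrib_left algebra_simps)
qed


section \<open>Projective spaces and their Zariski topology\<close>

definition line_of :: "('x \<Rightarrow> complex) \<Rightarrow> ('x \<Rightarrow> complex) set" where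
  "line_of x = {\<lambda>i. c * x i | c. True}"

definition projectivization :: "('x \<Rightarrow> complex) set \<Rightarrow> ('x \<Rightarrow> complex) set set" where
  "projectivization L = {line_of x | x. x \<in> L \<and> (\<exists>i. x i \<noteq> 0)}"

definition vanishes_at :: "'x mpoly \<Rightarrow> ('x \<Rightarrow> complex) set \<Rightarrow> bool" where
  "vanishes_at p l \<longleftrightarrow> (\<forall>x\<in>l. (\<exists>i. x i \<noteq> 0) \<longrightarrow> poly_eval p x = 0)"

definition zariski_closed :: "('x \<Rightarrow> complex) set \<Rightarrow> ('x \<Rightarrow> complex) set set \<Rightarrow> bool" where
  "zariski_closed L Z \<longleftrightarrow>
     (\<exists>F. (\<forall>p\<in>F. \<exists>e. homogeneous e p) \<and>
          Z = {l \<in> projectivization L. \<forall>p\<in>F. vanishes_at p l})"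

text \<open>
  The polynomials may involve all coordinates of the ambient space of \<^term>\<open>L\<close>. For a
  finite-dimensional linear subspace \<^term>\<open>L\<close> this is the usual Zariski topology on the
  projective space of \<^term>\<open>L\<close>, since every linear form on \<^term>\<open>L\<close> is the restriction of a
  linear combination of coordinates.
\<close>

definition zariski :: "('x \<Rightarrow> complex) set \<Rightarrow> ('x \<Rightarrow> complex) set topology" where
  "zariski L =
     topology (\<lambda>U. U \<subseteq> projectivization L \<and> zariski_closed L (projectivization L - U))"

lemma vanishes_at_line_of:
  assumes "homogeneous e p" "\<exists>i. x i \<noteq> 0"
  shows "vanishes_at p (line_of x) \<longleftrightarrow> poly_eval p x = 0"
proof
  assume "vanishes_at p (line_of x)"
  moreover have "x \<in> line_of x" unfolding line_of_def by (auto intro!: exI[of _ 1])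
  ultimately show "poly_eval p x = 0" using assms(2) by (auto simp: vanishes_at_def)
next
  assume "poly_eval p x = 0"
  then have "poly_eval p (\<lambda>i. c * x i) = 0" for c
    using poly_eval_scale[OF assms(1), of c x] by simp
  then show "vanishes_at p (line_of x)"
    unfolding vanishes_at_def line_of_def by blast
qed

lemma vanishes_at_mult:
  assumes "homogeneous a p" "homogeneous b q" "l \<in> projectivization L"
  shows "vanishes_at (p * q) l \<longleftrightarrow> vanishes_at p l \<or> vanishes_at q l"
proof -
  obtain x where x: "l = line_of x" "\<exists>i. x i \<noteq> 0"
    using assms(3) unfolding projectivization_def by blast
  show ?thesis
    unfolding x(1) vanishes_at_line_of[OF homogeneous_mult[OF assms(1,2)] x(2)]
      vanishes_at_line_of[OF assms(1) x(2)] vanishes_at_line_of[OF assms(2) x(2)]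
    by (simp add: poly_eval_mult)
qed

lemma zariski_closed_Un:
  assumes "zariski_closed L Y" "zariski_closed L Z"
  shows "zariski_closed L (Y \<union> Z)"
proof -
  obtain F where F: "\<forall>p\<in>F. \<exists>e. homogeneous e p"
    "Y = {l \<in> projectivization L. \<forall>p\<in>F. vanishes_at p l}"
    using assms(1) unfolding zariski_closed_def by (elim exE conjE)
  obtain G where G: "\<forall>p\<in>G. \<exists>e. homogeneous e p"
    "Z = {l \<in> projectivization L. \<forall>p\<in>G. vanishes_at p l}"
    using assms(2) unfolding zariski_closed_def by (elim exE conjE)
  define H where "H = {p * q | p q. p \<in> F \<and> q \<in> G}"
  have "\<forall>p\<in>H. \<exists>e. homogeneous e p"
    using F(1) G(1) homogeneous_mult unfolding H_def by blast
  moreover have "vanishes_at (p * q) l \<longleftrightarrow> vanishes_at p l \<or> vanishes_at q l"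
    if pq: "p \<in> F" "q \<in> G" and l: "l \<in> projectivization L" for p q l
  proof -
    obtain a b where "homogeneous a p" "homogeneous b q" using F(1) G(1) pq by blast
    then show ?thesis using vanishes_at_mult l by blast
  qed
  then have "Y \<union> Z = {l \<in> projectivization L. \<forall>p\<in>H. vanishes_at p l}"
    unfolding F(2) G(2) H_def by blast
  ultimately show ?thesis unfolding zariski_closed_def by (intro exI[of _ H] conjI)
qed

lemma zariski_closed_Inter:
  assumes "\<And>Z. Z \<in> \<Z> \<Longrightarrow> zariski_closed L Z"
  shows "zariski_closed L {l \<in> projectivization L. \<forall>Z\<in>\<Z>. l \<in> Z}"
proof -
  define Q where "Q Z G \<longleftrightarrow> (\<forall>p\<in>G. \<exists>e. homogeneous e p) \<and>
      Z = {l \<in> projectivization L. \<forall>p\<in>G. vanishes_at p l}" for Z and G :: "'a mpoly set"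
  have "\<exists>G. Q Z G" if "Z \<in> \<Z>" for Z
    using assms[OF that] unfolding zariski_closed_def Q_def .
  then obtain F where Q: "\<And>Z. Z \<in> \<Z> \<Longrightarrow> Q Z (F Z)" by metis
  have F: "\<forall>p\<in>F Z. \<exists>e. homogeneous e p"
      "\<And>l. l \<in> Z \<longleftrightarrow> l \<in> projectivization L \<and> (\<forall>p\<in>F Z. vanishes_at p l)"
    if "Z \<in> \<Z>" for Z
    using Q[OF that] unfolding Q_def by blast+
  have "{l \<in> projectivization L. \<forall>Z\<in>\<Z>. l \<in> Z} =
      {l \<in> projectivization L. \<forall>p\<in>(\<Union>Z\<in>\<Z>. F Z). vanishes_at p l}"
    using F(2) by auto
  moreover have "\<forall>p\<in>(\<Union>Z\<in>\<Z>. F Z). \<exists>e. homogeneous e p" using F(1) by blast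
  ultimately show ?thesis unfolding zariski_closed_def by (intro exI[of _ "\<Union>Z\<in>\<Z>. F Z"] conjI)
qed

lemma istopology_zariski:
  "istopology (\<lambda>U. U \<subseteq> projectivization L \<and> zariski_closed L (projectivization L - U))"
  unfolding istopology_def
proof (intro conjI allI impI)
  fix U V
  assume U: "U \<subseteq> projectivization L \<and> zariski_closed L (projectivization L - U)"
    and V: "V \<subseteq> projectivization L \<and> zariski_closed L (projectivization L - V)"
  then show "U \<inter> V \<subseteq> projectivization L" by blast
  show "zariski_closed L (projectivization L - U \<inter> V)"
    using zariski_closed_Un U V by (metis Diff_Int)
next
  fix \<U>
  assume *: "\<forall>U\<in>\<U>. U \<subseteq> projectivization L \<and> zariski_closed L (projectivization L - U)"
  then show "\<Union>\<U> \<subseteq> projectivization L" by blast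
  have "projectivization L - \<Union>\<U> =
      {l \<in> projectivization L. \<forall>Z\<in>(\<lambda>U. projectivization L - U) ` \<U>. l \<in> Z}"
    by auto
  moreover have "zariski_closed L \<dots>"
    by (rule zariski_closed_Inter) (use * in auto)
  ultimately show "zariski_closed L (projectivization L - \<Union>\<U>)" by simp
qed

lemma openin_zariski:
  "openin (zariski L) U \<longleftrightarrow>
     U \<subseteq> projectivization L \<and> zariski_closed L (projectivization L - U)"
  unfolding zariski_def by (simp add: topology_inverse' istopology_zariski)

lemma topspace_zariski [simp]: "topspace (zariski L) = projectivization L"
proof -
  have "zariski_closed L (projectivization L - projectivization L)"
  proof -
    have "\<not> vanishes_at 1 l" if l: "l \<in> projectivization L" for l
    proof -
      obtain x where x: "l = line_of x" "\<exists>i. x i \<noteq> 0"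
        using l unfolding projectivization_def by blast
      show ?thesis unfolding x(1) vanishes_at_line_of[OF homogeneous_one x(2)] by simp
    qed
    moreover have "\<exists>e. homogeneous e (1 :: 'a mpoly)" using homogeneous_one by blast
    ultimately show ?thesis unfolding zariski_closed_def by (intro exI[of _ "{1}"]) auto
  qed
  then have "openin (zariski L) (projectivization L)" by (simp add: openin_zariski)
  then show ?thesis
    by (metis openin_subset openin_topspace openin_zariski subset_antisym)
qed

definition generically :: "'a topology \<Rightarrow> ('a \<Rightarrow> bool) \<Rightarrow> bool" where
  "generically X P \<longleftrightarrow>
     (\<exists>U. openin X U \<and> X closure_of U = topspace X \<and> (\<forall>x\<in>U. P x))"


section \<open>Linear subspaces of projective space and the Grassmannian\<close>

text \<open>
  Projective \<^term>\<open>n\<close>-space is modelled on \<^typ>\<open>complex ^ 'n\<close>, where \<^typ>\<open>'n\<close> has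
  \<^term>\<open>n + 1\<close> elements. A projective \<^term>\<open>k\<close>-plane is given by the linear subspace of
  dimension \<^term>\<open>k + 1\<close> over it; \<^term>\<open>points_of W\<close> is its set of points.
\<close>

definition planes :: "nat \<Rightarrow> (complex ^ 'n::finite) set set" where
  "planes k = {W. vec.subspace W \<and> vec.dim W = k + 1}"

definition points_of :: "(complex ^ 'n::finite) set \<Rightarrow> (complex ^ 'n) set set" where
  "points_of W = {l \<in> planes 0. l \<subseteq> W}"

text \<open>
  Coordinates of \<open>b 0 \<and> \<dots> \<and> b k\<close>, as an alternating tensor. The list of indices is not
  required to be increasing, so each minor occurs repeatedly up to sign, along with zero
  entries at lists with repetitions; this leaves the Zariski topology unchanged and avoids
  a choice of order on the index type.
\<close>

definition wedge :: "nat \<Rightarrow> (nat \<Rightarrow> complex ^ 'n::finite) \<Rightarrow> 'n list \<Rightarrow> complex" where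
  "wedge k b I =
     (if length I = k + 1
      then \<Sum>p | p permutes {..k}. of_int (sign p) * (\<Prod>j\<le>k. b (p j) $ (I ! j))
      else 0)"

text \<open>
  The Pluecker point of \<^term>\<open>W\<close> is the top exterior power of \<^term>\<open>W\<close>, a line: if
  \<^term>\<open>W\<close> has dimension \<^term>\<open>k + 1\<close>, the elements below are exactly the scalar multiples
  of the wedge of any basis of \<^term>\<open>W\<close>.
\<close>

definition pluecker :: "nat \<Rightarrow> (complex ^ 'n::finite) set \<Rightarrow> ('n list \<Rightarrow> complex) set" where
  "pluecker k W = {wedge k b | b. \<forall>j\<le>k. b j \<in> W}"

definition tensors :: "nat \<Rightarrow> ('n::finite list \<Rightarrow> complex) set" where
  "tensors k = {t. \<forall>I. length I \<noteq> k + 1 \<longrightarrow> t I = 0}"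

definition grassmannian :: "nat \<Rightarrow> (complex ^ 'n::finite) set topology" where
  "grassmannian k = pullback_topology (planes k) (pluecker k) (zariski (tensors k))"


section \<open>Fano schemes\<close>

definition forms :: "nat list \<Rightarrow> 'n::finite mpoly list set" where
  "forms d = {f. length f = length d \<and> (\<forall>i<length d. homogeneous (d ! i) (f ! i))}"

definition zero_locus :: "'n::finite mpoly list \<Rightarrow> (complex ^ 'n) set set" where
  "zero_locus f =
     {l \<in> planes 0. \<forall>g\<in>set f. \<forall>x\<in>l. x \<noteq> 0 \<longrightarrow> poly_eval g (\<lambda>i. x $ i) = 0}"

text \<open>The Fano scheme is taken as a variety, that is, as its set of points.\<close>

definition fano :: "nat \<Rightarrow> 'n::finite mpoly list \<Rightarrow> (complex ^ 'n) set set" where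
  "fano k f = {W \<in> planes k. points_of W \<subseteq> zero_locus f}"

definition forms_vanishing_on ::
    "nat list \<Rightarrow> (complex ^ 'n::finite) set \<Rightarrow> 'n mpoly list set" where
  "forms_vanishing_on d W = {f \<in> forms d. points_of W \<subseteq> zero_locus f}"

definition coeff_vector :: "'n::finite mpoly list \<Rightarrow> nat \<times> 'n monomial \<Rightarrow> complex" where
  "coeff_vector f = (\<lambda>(i, m). if i < length f then Poly_Mapping.lookup (f ! i) m else 0)"

definition delta :: "nat \<Rightarrow> nat list \<Rightarrow> nat \<Rightarrow> int" where
  "delta n d k =
     (int k + 1) * (int n - int k) - (\<Sum>e\<leftarrow>d. int ((e + k) choose k))"

end

theory Submission
  imports Defs "HOL-Computational_Algebra.Fundamental_Theorem_Algebra"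
begin

text \<open>
  Let \<open>c = k + 1\<close>, \<open>N = n - k\<close>, and let \<open>D r\<close> be the number of coefficients of a tuple of forms of
  degrees \<open>d\<close> in \<open>r\<close> variables, so that \<open>\<delta> = c N - D c\<close>. The open set of planes in the proof is the
  whole Grassmannian: a shear moves any plane \<open>\<Lambda>'\<close> to the coordinate plane of a set \<open>K\<close> of \<open>c\<close>
  coordinates, and the tuples that vanish there are those without monomials in the variables
  \<open>K\<close> alone. It remains to find a nonzero polynomial in the other coefficients at whose
  nonzeros the equivalence holds.

  If \<open>\<delta> < 0\<close>, parameters are counted. Another plane \<open>\<Lambda>\<close> is, in reduced echelon form, the graph
  of a matrix \<open>T\<close> over a coordinate plane \<open>I \<noteq> K\<close>, where \<open>T (i, r) = 0\<close> for \<open>i \<in> K\<close>, \<open>r \<notin> K\<close>. A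
  tuple that vanishes on \<open>\<Lambda>\<close> and on \<open>\<Lambda>'\<close> is the image under the shear by \<open>T\<close> of one without
  monomials in the variables \<open>I\<close> or in the variables \<open>K\<close>. These data have fewer parameters than
  the tuples on \<open>\<Lambda>'\<close> have coefficients (\<open>plane_parameters_lt\<close>), so the tuples obtained satisfy a
  nontrivial polynomial relation (\<open>algebraic_dependence\<close>). There are finitely many sets \<open>I\<close>.

  If \<open>\<delta> \<ge> 0\<close>, then \<open>N \<ge> c\<close> and \<open>I\<close> can be taken disjoint from \<open>K\<close>. The map that takes \<open>T\<close> and a tuple
  vanishing on both coordinate planes to the sheared tuple has a surjective linear part at
  \<open>\<Sum>j. x_j g_j\<close>, provided that the products \<open>x_i g_j\<close> with \<open>i \<in> I\<close>, \<open>j \<notin> I\<close> span all tuples in the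
  variables \<open>I\<close>. For generic \<open>g\<close> they do, by a second parameter count
  (\<open>generic_multiplication_spans\<close>): a functional \<open>\<alpha>\<close> that annihilates the products has a rank
  \<open>r\<close>, the dimension of the span of the functionals \<open>\<alpha>(x_i \<cdot>)\<close>; it depends on
  \<open>r (c - r) + D r\<close> parameters, one of which is a scalar factor, and imposes \<open>N r\<close> conditions
  on \<open>g\<close>. Hence the components of the map are algebraically independent, and as many of its
  variables as there are components suffice to reach every point outside a hypersurface
  (\<open>algebraically_independent_generically_surjective\<close>). A generic tuple on \<open>\<Lambda>'\<close> therefore
  vanishes on a graph over \<open>I\<close> as well.

  Both counts rest on the same inequality. The function \<open>r N - r (c - r) - D r\<close> of \<open>r\<close> vanishes
  at 0, equals \<open>\<delta>\<close> at \<open>c\<close>, and is concave because \<open>D\<close> has second differences at least 2 when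
  \<open>d \<noteq> [2]\<close>; so it lies above its chord (\<open>excess_chord\<close>).
\<close>

section \<open>Polynomial functions\<close>

text \<open>
  Polynomials with variables in \<open>V\<close> are handled as functions, so that substitution is
  composition of functions and a relation holds when a function vanishes.
\<close>

inductive polyfun :: "'x set \<Rightarrow> (('x \<Rightarrow> complex) \<Rightarrow> complex) \<Rightarrow> bool" for V where
  const: "polyfun V (\<lambda>_. c)"
| var: "v \<in> V \<Longrightarrow> polyfun V (\<lambda>z. z v)"
| add: "polyfun V f \<Longrightarrow> polyfun V g \<Longrightarrow> polyfun V (\<lambda>z. f z + g z)"
| mult: "polyfun V f \<Longrightarrow> polyfun V g \<Longrightarrow> polyfun V (\<lambda>z. f z * g z)"

lemma polyfun_minus: "polyfun V f \<Longrightarrow> polyfun V (\<lambda>z. - f z)"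
  using polyfun.mult[OF polyfun.const[of V "-1"], of f] by simp

lemma polyfun_diff: "polyfun V f \<Longrightarrow> polyfun V g \<Longrightarrow> polyfun V (\<lambda>z. f z - g z)"
  using polyfun.add[OF _ polyfun_minus, of V f g] by simp

lemma polyfun_sum: "(\<And>a. a \<in> A \<Longrightarrow> polyfun V (f a)) \<Longrightarrow> polyfun V (\<lambda>z. \<Sum>a\<in>A. f a z)"
  by (induction A rule: infinite_finite_induct) (auto intro: polyfun.intros)

lemma polyfun_prod: "(\<And>a. a \<in> A \<Longrightarrow> polyfun V (f a)) \<Longrightarrow> polyfun V (\<lambda>z. \<Prod>a\<in>A. f a z)"
  by (induction A rule: infinite_finite_induct) (auto intro: polyfun.intros)

lemma polyfun_power: "polyfun V f \<Longrightarrow> polyfun V (\<lambda>z. f z ^ m)"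
  by (induction m) (auto intro: polyfun.intros)

lemma polyfun_compose:
  assumes "polyfun V f" "\<And>v. v \<in> V \<Longrightarrow> polyfun W (h v)"
  shows "polyfun W (\<lambda>z. f (\<lambda>v. h v z))"
  using assms by (induction rule: polyfun.induct) (auto intro: polyfun.intros)

lemma polyfun_mono: "polyfun V f \<Longrightarrow> V \<subseteq> W \<Longrightarrow> polyfun W f"
  by (induction rule: polyfun.induct) (auto intro: polyfun.intros)

lemma polyfun_cong:
  assumes "polyfun V f" "\<And>v. v \<in> V \<Longrightarrow> z v = z' v"
  shows "f z = f z'"
  using assms by (induction rule: polyfun.induct) auto

lemma polyfun_univariate:
  assumes "polyfun V f"
  shows "\<exists>q. \<forall>t. f (\<lambda>v. poly (h v) t) = poly q t"
  using assms
proof (induction rule: polyfun.induct)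
  case (const c)
  show ?case by (rule exI[of _ "[:c:]"]) simp
next
  case (var v)
  show ?case by (rule exI[of _ "h v"]) simp
next
  case (add f g)
  then obtain p q where "\<forall>t. f (\<lambda>v. poly (h v) t) = poly p t" "\<forall>t. g (\<lambda>v. poly (h v) t) = poly q t"
    by blast
  then show ?case by (intro exI[of _ "p + q"]) simp
next
  case (mult f g)
  then obtain p q where "\<forall>t. f (\<lambda>v. poly (h v) t) = poly p t" "\<forall>t. g (\<lambda>v. poly (h v) t) = poly q t"
    by blast
  then show ?case by (intro exI[of _ "p * q"]) simp
qed

text \<open>
  Along the line through \<open>u\<close> and \<open>v\<close> both functions are nonzero polynomials in one variable,
  so finitely many points are excluded. This is the irreducibility of linear subspaces.
\<close>

lemma polyfun_nonzero_on_line: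
  assumes "polyfun V f" "polyfun V' g" "f u \<noteq> 0" "g v \<noteq> 0"
  obtains t where "f (\<lambda>i. (1 - t) * u i + t * v i) \<noteq> 0" "g (\<lambda>i. (1 - t) * u i + t * v i) \<noteq> 0"
proof -
  let ?h = "\<lambda>i. [:u i, v i - u i:]"
  have h: "poly (?h i) t = (1 - t) * u i + t * v i" for i t by (simp add: algebra_simps)
  obtain p where p: "\<forall>t. f (\<lambda>i. poly (?h i) t) = poly p t" using polyfun_univariate[OF assms(1), of ?h] by blast
  obtain q where q: "\<forall>t. g (\<lambda>i. poly (?h i) t) = poly q t" using polyfun_univariate[OF assms(2), of ?h] by blast
  have "poly p 0 \<noteq> 0" "poly q 1 \<noteq> 0" using p[rule_format, of 0] q[rule_format, of 1] assms(3,4) by simp_all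
  then have "p * q \<noteq> 0" by auto
  then have "finite {t. poly (p * q) t = 0}" by (rule poly_roots_finite)
  then obtain t where "poly (p * q) t \<noteq> 0" using ex_new_if_finite[OF infinite_UNIV_char_0] by blast
  then show ?thesis using that[of t] p q unfolding h by auto
qed

corollary polyfun_mult_nonzero:
  assumes "polyfun V f" "polyfun V' g" "\<exists>z. f z \<noteq> 0" "\<exists>z. g z \<noteq> 0"
  shows "\<exists>z. f z * g z \<noteq> 0"
proof -
  obtain u v where "f u \<noteq> 0" "g v \<noteq> 0" using assms by blast
  then obtain t where "f (\<lambda>i. (1 - t) * u i + t * v i) \<noteq> 0" "g (\<lambda>i. (1 - t) * u i + t * v i) \<noteq> 0"
    by (rule polyfun_nonzero_on_line[OF assms(1,2)])
  then show ?thesis by (intro exI[of _ "\<lambda>i. (1 - t) * u i + t * v i"]) simp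
qed

lemma polyfun_prod_nonzero:
  assumes "finite A" "\<And>a. a \<in> A \<Longrightarrow> polyfun V (f a)" "\<And>a. a \<in> A \<Longrightarrow> \<exists>z. f a z \<noteq> 0"
  shows "\<exists>z. (\<Prod>a\<in>A. f a z) \<noteq> 0"
  using assms
proof (induction A rule: finite_induct)
  case (insert a A)
  have "\<exists>z. f a z * (\<Prod>a\<in>A. f a z) \<noteq> 0"
    by (rule polyfun_mult_nonzero[of V _ V]) (use insert in \<open>auto intro!: polyfun_prod\<close>)
  then show ?case using insert by simp
qed simp

lemma mono_eval_zero [simp]: "mono_eval 0 z = 1"
  by (simp add: mono_eval_def)

lemma mono_eval_single [simp]: "mono_eval (Poly_Mapping.single v j) z = z v ^ j"
  by (cases "j = 0") (simp_all add: mono_eval_def)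

lemma polyfun_mono_eval: "Poly_Mapping.keys m \<subseteq> V \<Longrightarrow> polyfun V (mono_eval m)"
proof -
  assume *: "Poly_Mapping.keys m \<subseteq> V"
  have "polyfun V (\<lambda>z. \<Prod>i\<in>Poly_Mapping.keys m. z i ^ Poly_Mapping.lookup m i)"
    using * by (intro polyfun_prod polyfun_power polyfun.var) auto
  then show ?thesis unfolding mono_eval_def[abs_def] .
qed

lemma polyfun_poly_eval: "polyfun UNIV (poly_eval p)"
proof -
  have "polyfun UNIV (\<lambda>z. \<Sum>m\<in>Poly_Mapping.keys p. Poly_Mapping.lookup p m * mono_eval m z)"
    by (intro polyfun_sum polyfun.mult polyfun.const polyfun_mono_eval) auto
  then show ?thesis unfolding poly_eval_def[abs_def] .
qed

lemma polyfun_obtain_mpoly: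
  assumes "polyfun V f"
  obtains p where "f = poly_eval p" "\<And>m. m \<in> Poly_Mapping.keys p \<Longrightarrow> Poly_Mapping.keys m \<subseteq> V"
proof -
  have "\<exists>p. f = poly_eval p \<and> (\<forall>m\<in>Poly_Mapping.keys p. Poly_Mapping.keys m \<subseteq> V)"
    using assms
  proof (induction rule: polyfun.induct)
    case (const c)
    show ?case
      by (rule exI[of _ "Poly_Mapping.single 0 c"]) (auto simp: fun_eq_iff poly_eval_single)
  next
    case (var v)
    then show ?case
      by (intro exI[of _ "Poly_Mapping.single (Poly_Mapping.single v 1) 1"])
         (auto simp: fun_eq_iff poly_eval_single)
  next
    case (add f g)
    then obtain p q where "f = poly_eval p" "\<forall>m\<in>Poly_Mapping.keys p. Poly_Mapping.keys m \<subseteq> V"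
      "g = poly_eval q" "\<forall>m\<in>Poly_Mapping.keys q. Poly_Mapping.keys m \<subseteq> V" by blast
    moreover from this have "\<forall>m\<in>Poly_Mapping.keys (p + q). Poly_Mapping.keys m \<subseteq> V"
      using keys_add[of p q] by blast
    ultimately show ?case by (intro exI[of _ "p + q"]) (simp add: fun_eq_iff poly_eval_add)
  next
    case (mult f g)
    then obtain p q where *: "f = poly_eval p" "\<forall>m\<in>Poly_Mapping.keys p. Poly_Mapping.keys m \<subseteq> V"
      "g = poly_eval q" "\<forall>m\<in>Poly_Mapping.keys q. Poly_Mapping.keys m \<subseteq> V" by blast
    have "Poly_Mapping.keys m \<subseteq> V" if m: "m \<in> Poly_Mapping.keys (p * q)" for m
    proof -
      obtain a b where "m = a + b" "a \<in> Poly_Mapping.keys p" "b \<in> Poly_Mapping.keys q"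
        using subsetD[OF keys_mult m] by blast
      then show ?thesis using keys_add[of a b] * by blast
    qed
    then show ?case
      using * by (intro exI[of _ "p * q"]) (auto simp: fun_eq_iff poly_eval_mult)
  qed
  then show ?thesis using that by blast
qed


section \<open>Linear independence of monomials\<close>

definition exponent_box :: "'x set \<Rightarrow> nat \<Rightarrow> 'x monomial set" where
  "exponent_box V D = {m. Poly_Mapping.keys m \<subseteq> V \<and> (\<forall>v. Poly_Mapping.lookup m v \<le> D)}"

lemma exponent_box_empty: "exponent_box {} D = {0}"
  by (auto simp: exponent_box_def)

lemma bij_betw_exponent_box_insert:
  assumes "v \<notin> V"
  shows "bij_betw (\<lambda>(j, m). m + Poly_Mapping.single v j) ({..D} \<times> exponent_box V D) (exponent_box (insert v V) D)"
proof (rule bij_betw_byWitness[where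
      f' = "\<lambda>m. (Poly_Mapping.lookup m v, m - Poly_Mapping.single v (Poly_Mapping.lookup m v))"])
  have nv: "Poly_Mapping.lookup m v = 0" if "m \<in> exponent_box V D" for m
    using that assms by (auto simp: exponent_box_def in_keys_iff)
  show "\<forall>a\<in>{..D} \<times> exponent_box V D.
      (Poly_Mapping.lookup (case a of (j, m) \<Rightarrow> m + Poly_Mapping.single v j) v,
       (case a of (j, m) \<Rightarrow> m + Poly_Mapping.single v j) -
       Poly_Mapping.single v (Poly_Mapping.lookup (case a of (j, m) \<Rightarrow> m + Poly_Mapping.single v j) v)) = a"
    using nv by (auto simp: lookup_add lookup_single)
  show "\<forall>m\<in>exponent_box (insert v V) D.
      (case (Poly_Mapping.lookup m v, m - Poly_Mapping.single v (Poly_Mapping.lookup m v)) of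
        (j, m) \<Rightarrow> m + Poly_Mapping.single v j) = m"
    by (auto intro!: poly_mapping_eqI simp: lookup_add lookup_minus lookup_single when_def)
  show "(\<lambda>(j, m). m + Poly_Mapping.single v j) ` ({..D} \<times> exponent_box V D) \<subseteq> exponent_box (insert v V) D"
  proof (rule image_subsetI)
    fix x assume "x \<in> {..D} \<times> exponent_box V D"
    then obtain j m where x: "x = (j, m)" "j \<le> D" "m \<in> exponent_box V D" by auto
    then show "(case x of (j, m) \<Rightarrow> m + Poly_Mapping.single v j) \<in> exponent_box (insert v V) D"
      using nv[OF x(3)] keys_add[of m "Poly_Mapping.single v j"]
      by (auto simp: exponent_box_def lookup_add lookup_single when_def split: if_splits)
  qed
  show "(\<lambda>m. (Poly_Mapping.lookup m v, m - Poly_Mapping.single v (Poly_Mapping.lookup m v))) `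
      exponent_box (insert v V) D \<subseteq> {..D} \<times> exponent_box V D"
    by (auto simp: exponent_box_def in_keys_iff lookup_minus lookup_single when_def subset_iff split: if_splits
        intro: order_trans[OF diff_le_self]) (metis)
qed

lemma finite_exponent_box: "finite V \<Longrightarrow> finite (exponent_box V D)"
proof (induction V rule: finite_induct)
  case (insert v V)
  then show ?case using bij_betw_finite[OF bij_betw_exponent_box_insert[of v V D]] by simp
qed (simp add: exponent_box_empty)

lemma card_exponent_box: "finite V \<Longrightarrow> card (exponent_box V D) = (D + 1) ^ card V"
proof (induction V rule: finite_induct)
  case (insert v V)
  then show ?case using bij_betw_same_card[OF bij_betw_exponent_box_insert[of v V D]]
    by (simp add: card_cartesian_product)
qed (simp add: exponent_box_empty)

lemma exponent_box_monomials_independent: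
  assumes "finite V" "\<And>z. (\<Sum>m\<in>exponent_box V D. c m * mono_eval m z) = 0" "m \<in> exponent_box V D"
  shows "c m = 0"
  using assms
proof (induction V arbitrary: c m rule: finite_induct)
  case empty
  then show ?case by (simp add: exponent_box_empty)
next
  case (insert v V)
  let ?s = "Poly_Mapping.single v"
  have eq: "(\<Sum>m\<in>exponent_box (insert v V) D. c m * mono_eval m z) =
      (\<Sum>j\<le>D. (\<Sum>m\<in>exponent_box V D. c (m + ?s j) * mono_eval m z) * z v ^ j)" for z
  proof -
    have "(\<Sum>m\<in>exponent_box (insert v V) D. c m * mono_eval m z) =
        (\<Sum>(j, m)\<in>{..D} \<times> exponent_box V D. c (m + ?s j) * mono_eval (m + ?s j) z)"
      using sum.reindex_bij_betw[OF bij_betw_exponent_box_insert[OF insert(2)], of "\<lambda>m. c m * mono_eval m z" D]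
      by (simp add: case_prod_unfold)
    also have "\<dots> = (\<Sum>j\<le>D. \<Sum>m\<in>exponent_box V D. c (m + ?s j) * mono_eval (m + ?s j) z)"
      by (simp add: sum.cartesian_product)
    finally show ?thesis by (simp add: mono_eval_add sum_distrib_right mult.assoc)
  qed
  have slice: "(\<Sum>m\<in>exponent_box V D. c (m + ?s j) * mono_eval m z) = 0" if j: "j \<le> D" for j z
  proof -
    have inv: "mono_eval m (z(v := t)) = mono_eval m z" if "m \<in> exponent_box V D" for m t
      by (rule polyfun_cong[OF polyfun_mono_eval[of m V]]) (use that insert(2) in \<open>auto simp: exponent_box_def\<close>)
    have "(\<Sum>j\<le>D. (\<Sum>m\<in>exponent_box V D. c (m + ?s j) * mono_eval m z) * t ^ j) = 0" for t
      using insert.prems(1)[of "z(v := t)"] unfolding eq by (simp add: inv)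
    from zero_polynom_imp_zero_coeffs[where c = "\<lambda>j. \<Sum>m\<in>exponent_box V D. c (m + ?s j) * mono_eval m z", OF this j]
    show ?thesis .
  qed
  have "m \<in> (\<lambda>(j, m). m + ?s j) ` ({..D} \<times> exponent_box V D)"
    using bij_betw_imp_surj_on[OF bij_betw_exponent_box_insert[OF insert(2), of D]] insert.prems(2) by simp
  then obtain j m' where *: "m = m' + ?s j" "j \<le> D" "m' \<in> exponent_box V D" by auto
  have "\<And>z. (\<Sum>m\<in>exponent_box V D. (\<lambda>m. c (m + ?s j)) m * mono_eval m z) = 0" using slice[OF *(2)] by simp
  from insert.IH[OF this *(3)] have "c (m' + ?s j) = 0" .
  then show ?case using *(1) by simp
qed

lemma finite_subset_exponent_box:
  assumes "finite M" "\<And>m. m \<in> M \<Longrightarrow> Poly_Mapping.keys m \<subseteq> V"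
  obtains D where "M \<subseteq> exponent_box V D"
proof -
  define D where "D = Max (insert 0 (\<Union>m\<in>M. Poly_Mapping.lookup m ` Poly_Mapping.keys m))"
  have "Poly_Mapping.lookup m v \<le> D" if "m \<in> M" for m v
    using that assms(1) unfolding D_def
    by (cases "v \<in> Poly_Mapping.keys m") (auto simp: in_keys_iff intro!: Max_ge)
  then show ?thesis using that[of D] assms(2) by (auto simp: exponent_box_def)
qed

lemma monomials_independent:
  assumes "finite M" "\<And>z. (\<Sum>m\<in>M. c m * mono_eval m z) = 0" "m \<in> M"
  shows "c m = 0"
proof -
  define V where "V = (\<Union>m\<in>M. Poly_Mapping.keys m)"
  have V: "finite V" using assms(1) by (simp add: V_def)
  obtain D where sub: "M \<subseteq> exponent_box V D"
    using finite_subset_exponent_box[OF assms(1), of V] by (auto simp: V_def)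
  have "(if m \<in> M then c m else 0) = 0"
  proof (rule exponent_box_monomials_independent[OF V _ subsetD[OF sub assms(3)]])
    fix z
    have "(\<Sum>m\<in>exponent_box V D. (if m \<in> M then c m else 0) * mono_eval m z) = (\<Sum>m\<in>M. c m * mono_eval m z)"
      using sub by (intro sum.mono_neutral_cong_right) (auto simp: finite_exponent_box V)
    then show "(\<Sum>m\<in>exponent_box V D. (if m \<in> M then c m else 0) * mono_eval m z) = 0" using assms(2) by simp
  qed
  then show ?thesis using assms(3) by simp
qed

section \<open>Finite systems of linear equations\<close>

lemma homogeneous_system_solution:
  fixes c :: "'a \<Rightarrow> 'b \<Rightarrow> complex"
  assumes "finite B" "finite A" "card B < card A"
  shows "\<exists>v. (\<exists>a\<in>A. v a \<noteq> 0) \<and> (\<forall>b\<in>B. (\<Sum>a\<in>A. v a * c a b) = 0)"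
  using assms
proof (induction B arbitrary: A c rule: finite_induct)
  case empty
  then have "A \<noteq> {}" by auto
  then show ?case by (intro exI[of _ "\<lambda>_. 1"]) auto
next
  case (insert b B)
  show ?case
  proof (cases "\<forall>a\<in>A. c a b = 0")
    case True
    have "card B < card A" using insert by simp
    then show ?thesis using insert.IH[of A c] insert.prems True by auto
  next
    case False
    then obtain a0 where a0: "a0 \<in> A" "c a0 b \<noteq> 0" by blast
    define c' where "c' a b' = c a b' - c a b / c a0 b * c a0 b'" for a b'
    have "card B < card (A - {a0})" using insert a0 by simp
    then obtain v where v: "\<exists>a\<in>A - {a0}. v a \<noteq> 0"
        "\<forall>b\<in>B. (\<Sum>a\<in>A - {a0}. v a * c' a b) = 0"
      using insert.IH[of "A - {a0}" c'] insert.prems by auto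
    define S where "S = (\<Sum>a\<in>A - {a0}. v a * c a b)"
    define w where "w = v(a0 := - S / c a0 b)"
    have w: "(\<Sum>a\<in>A. w a * c a b') = - S / c a0 b * c a0 b' + (\<Sum>a\<in>A - {a0}. v a * c a b')" for b'
    proof -
      have "(\<Sum>a\<in>A. w a * c a b') = w a0 * c a0 b' + (\<Sum>a\<in>A - {a0}. w a * c a b')"
        using insert.prems a0 by (simp add: sum.remove)
      moreover have "(\<Sum>a\<in>A - {a0}. w a * c a b') = (\<Sum>a\<in>A - {a0}. v a * c a b')"
        by (rule sum.cong) (auto simp: w_def)
      ultimately show ?thesis by (simp add: w_def)
    qed
    have v2: "(\<Sum>a\<in>A - {a0}. v a * c' a b') =
        (\<Sum>a\<in>A - {a0}. v a * c a b') - S / c a0 b * c a0 b'" for b'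
      by (simp add: c'_def S_def algebra_simps sum_subtractf sum_distrib_left sum_divide_distrib)
    have "(\<Sum>a\<in>A. w a * c a b') = 0" if "b' \<in> insert b B" for b'
    proof (cases "b' = b")
      case True
      then show ?thesis using a0 by (simp add: w S_def)
    next
      case False
      then have "b' \<in> B" using that by simp
      then have "(\<Sum>a\<in>A - {a0}. v a * c a b') - S / c a0 b * c a0 b' = 0" using v(2) v2[of b'] by simp
      then show ?thesis by (simp add: w)
    qed
    moreover have "\<exists>a\<in>A. w a \<noteq> 0" using v(1) by (auto simp: w_def)
    ultimately show ?thesis by blast
  qed
qed

text \<open>
  Reduced echelon form: a set \<open>B\<close> of coordinates of least weight on which the elements of \<open>W\<close>
  are determined by their values carries a dual basis of \<open>W\<close>. Minimality under removal of a
  coordinate gives the dual basis, minimality under exchange of two coordinates gives the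
  zeros in it.
\<close>

lemma echelon_basis:
  fixes W :: "('e \<Rightarrow> complex) set" and wt :: "'e \<Rightarrow> nat"
  assumes "finite E"
    and lin: "\<And>a b v w. v \<in> W \<Longrightarrow> w \<in> W \<Longrightarrow> (\<lambda>e. a * v e + b * w e) \<in> W"
    and zero: "(\<lambda>_. 0) \<in> W"
  obtains B u where "B \<subseteq> E" "\<And>b. b \<in> B \<Longrightarrow> u b \<in> W"
    "\<And>b b'. b \<in> B \<Longrightarrow> b' \<in> B \<Longrightarrow> u b b' = (if b' = b then 1 else 0)"
    "\<And>w e. w \<in> W \<Longrightarrow> e \<in> E \<Longrightarrow> w e = (\<Sum>b\<in>B. w b * u b e)"
    "\<And>b e. b \<in> B \<Longrightarrow> e \<in> E - B \<Longrightarrow> wt e < wt b \<Longrightarrow> u b e = 0"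
proof -
  define det where "det B \<longleftrightarrow> B \<subseteq> E \<and> (\<forall>w\<in>W. (\<forall>b\<in>B. w b = 0) \<longrightarrow> (\<forall>e\<in>E. w e = 0))" for B
  define size where "size B = (\<Sum>b\<in>B. Suc (wt b))" for B
  have detE: "det E" by (auto simp: det_def)
  define B where "B = arg_min size det"
  have B: "det B" and Bmin: "\<And>B'. det B' \<Longrightarrow> size B \<le> size B'"
    using arg_min_nat_lemma[of det E size, OF detE] unfolding B_def by auto
  have BE: "B \<subseteq> E" using B by (simp add: det_def)
  then have finB: "finite B" using assms(1) finite_subset by blast
  have "\<exists>u\<in>W. (\<forall>b'\<in>B. u b' = (if b' = b then 1 else 0))" if b: "b \<in> B" for b
  proof -
    have "size B = Suc (wt b) + size (B - {b})" unfolding size_def using finB b by (simp add: sum.remove)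
    then have "\<not> det (B - {b})" using Bmin[of "B - {b}"] by auto
    then obtain w e where w: "w \<in> W" "\<forall>b'\<in>B - {b}. w b' = 0" "e \<in> E" "w e \<noteq> 0"
      using BE unfolding det_def by blast
    have "w b \<noteq> 0" using B w unfolding det_def by blast
    moreover have "(\<lambda>e. (1 / w b) * w e + 0 * w e) \<in> W" by (rule lin[OF w(1) w(1)])
    moreover have "(1 / w b) * w b' + 0 * w b' = (if b' = b then 1 else 0)" if "b' \<in> B" for b'
      using \<open>w b \<noteq> 0\<close> w(2) that by (cases "b' = b") auto
    ultimately show ?thesis by (intro bexI[of _ "\<lambda>e. (1 / w b) * w e + 0 * w e"] ballI)
  qed
  then obtain u where u: "\<And>b. b \<in> B \<Longrightarrow> u b \<in> W"
    "\<And>b b'. b \<in> B \<Longrightarrow> b' \<in> B \<Longrightarrow> u b b' = (if b' = b then 1 else 0)"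
    by metis
  have detD: "w e = 0" if "w \<in> W" "\<And>b. b \<in> B \<Longrightarrow> w b = 0" "e \<in> E" for w e
    using B that unfolding det_def by blast
  have comb: "(\<lambda>e. \<Sum>b\<in>A. c b * u b e) \<in> W" if "finite A" "A \<subseteq> B" for A and c
    using that
  proof (induction A rule: finite_induct)
    case (insert b A)
    then show ?case using lin[of "u b" "\<lambda>e. \<Sum>b\<in>A. c b * u b e" "c b" 1] u(1)[of b] by simp
  qed (simp add: zero)
  have expand: "w e = (\<Sum>b\<in>B. w b * u b e)" if w: "w \<in> W" and e: "e \<in> E" for w e
  proof -
    let ?w = "\<lambda>e. 1 * w e + (-1) * (\<Sum>b\<in>B. w b * u b e)"
    have "?w \<in> W" by (rule lin[OF w comb[OF finB order_refl]])
    moreover have "?w b' = 0" if b': "b' \<in> B" for b'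
    proof -
      have "(\<Sum>b\<in>B. w b * u b b') = (\<Sum>b\<in>B. if b = b' then w b else 0)"
        by (rule sum.cong) (auto simp: u(2) b')
      then show ?thesis using finB b' by simp
    qed
    ultimately have "?w e = 0" using detD[of ?w e] e by blast
    then show ?thesis by simp
  qed
  have exchange: "u b e = 0" if b: "b \<in> B" and e: "e \<in> E - B" and wt: "wt e < wt b" for b e
  proof (rule ccontr)
    assume nz: "u b e \<noteq> 0"
    let ?B = "insert e (B - {b})"
    have "w e' = 0" if w: "w \<in> W" "\<forall>b'\<in>?B. w b' = 0" and e': "e' \<in> E" for w e'
    proof -
      have eq: "w x = w b * u b x" if "x \<in> E" for x
      proof -
        have "(\<Sum>b'\<in>B - {b}. w b' * u b' x) = 0" by (rule sum.neutral) (use w in auto)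
        then show ?thesis using expand[OF w(1) that] finB b by (simp add: sum.remove)
      qed
      have "w b = 0" using eq[of e] nz w(2) e by auto
      then show ?thesis using eq[OF e'] by simp
    qed
    then have "det ?B" using BE e unfolding det_def by blast
    moreover have "size B = Suc (wt b) + size (B - {b})" unfolding size_def using finB b by (simp add: sum.remove)
    moreover have "size ?B = Suc (wt e) + size (B - {b})" unfolding size_def using finB e by simp
    ultimately show False using Bmin[of ?B] wt by simp
  qed
  show ?thesis using that[OF BE u expand exchange] by blast
qed

text \<open>
  By the echelon form of its row space, the pivots \<open>B\<close> of the matrix \<open>w\<close> index a basis of the column
  space.
\<close>

lemma pivot_columns:
  fixes w :: "'x \<Rightarrow> 'e \<Rightarrow> complex"
  assumes "finite D" "finite E"
  obtains B u where "B \<subseteq> E"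
    "\<And>x e. x \<in> D \<Longrightarrow> e \<in> E \<Longrightarrow> w x e = (\<Sum>b\<in>B. w x b * u b e)"
    "\<And>t. \<forall>b\<in>B. (\<Sum>x\<in>D. t x * w x b) = 0 \<Longrightarrow> \<forall>e\<in>E. (\<Sum>x\<in>D. t x * w x e) = 0"
    "\<And>c. \<forall>x\<in>D. (\<Sum>b\<in>B. c b * w x b) = 0 \<Longrightarrow> \<forall>b\<in>B. c b = 0"
proof -
  define W where "W = range (\<lambda>t e. \<Sum>x\<in>D. t x * w x e)"
  have W: "(\<lambda>e. \<Sum>x\<in>D. t x * w x e) \<in> W" for t unfolding W_def by (rule rangeI)
  have lin: "(\<lambda>e. a * f e + b * g e) \<in> W" if fg: "f \<in> W" "g \<in> W" for a b f g
  proof -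
    obtain s t where "f = (\<lambda>e. \<Sum>x\<in>D. s x * w x e)" "g = (\<lambda>e. \<Sum>x\<in>D. t x * w x e)"
      using fg unfolding W_def by blast
    then have "(\<lambda>e. a * f e + b * g e) = (\<lambda>e. \<Sum>x\<in>D. (a * s x + b * t x) * w x e)"
      by (simp add: fun_eq_iff sum_distrib_left sum.distrib[symmetric] algebra_simps)
    then show ?thesis using W by simp
  qed
  have zero: "(\<lambda>_. 0) \<in> W" using W[of "\<lambda>_. 0"] by simp
  obtain B u where B: "B \<subseteq> E" "\<And>b. b \<in> B \<Longrightarrow> u b \<in> W"
    "\<And>b b'. b \<in> B \<Longrightarrow> b' \<in> B \<Longrightarrow> u b b' = (if b' = b then 1 else 0)"
    "\<And>f e. f \<in> W \<Longrightarrow> e \<in> E \<Longrightarrow> f e = (\<Sum>b\<in>B. f b * u b e)"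
    by (rule echelon_basis[OF assms(2) lin zero, of "\<lambda>_. 0"]) (assumption | rule that)+
  have finB: "finite B" using B(1) assms(2) finite_subset by blast
  show ?thesis
  proof (rule that[of B u, OF B(1)])
    fix x e assume x: "x \<in> D" and e: "e \<in> E"
    have "w x = (\<lambda>e. \<Sum>x'\<in>D. (if x' = x then 1 else 0) * w x' e)"
      using assms(1) x by (simp add: fun_eq_iff if_distrib[of "\<lambda>a. a * _"] cong: if_cong)
    then have "w x \<in> W" using W[of "\<lambda>x'. if x' = x then 1 else 0"] by simp
    then show "w x e = (\<Sum>b\<in>B. w x b * u b e)" using e by (rule B(4))
  next
    fix t assume "\<forall>b\<in>B. (\<Sum>x\<in>D. t x * w x b) = 0"
    then show "\<forall>e\<in>E. (\<Sum>x\<in>D. t x * w x e) = 0" using B(4)[OF W[of t]] by simp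
  next
    fix c assume c: "\<forall>x\<in>D. (\<Sum>b\<in>B. c b * w x b) = 0"
    show "\<forall>b\<in>B. c b = 0"
    proof
      fix b assume b: "b \<in> B"
      obtain s where s: "u b = (\<lambda>e. \<Sum>x\<in>D. s x * w x e)" using B(2)[OF b] unfolding W_def by blast
      have "(\<Sum>b'\<in>B. c b' * u b b') = (\<Sum>b'\<in>B. if b' = b then c b' else 0)"
        by (intro sum.cong) (auto simp: B(3) b)
      then have "c b = (\<Sum>b'\<in>B. c b' * u b b')" using finB b by simp
      also have "\<dots> = (\<Sum>x\<in>D. \<Sum>b'\<in>B. s x * (c b' * w x b'))"
        unfolding s by (subst sum.swap) (simp add: sum_distrib_left mult.left_commute)
      also have "\<dots> = (\<Sum>x\<in>D. s x * (\<Sum>b'\<in>B. c b' * w x b'))" by (simp add: sum_distrib_left)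
      finally show "c b = 0" using c by simp
    qed
  qed
qed

text \<open>
  Every member \<open>(q, p)\<close> is a left inverse with common denominator \<open>q\<close>, polynomial in the entries of
  the matrix, and for every injective matrix some member has a nonzero denominator.
\<close>

definition left_inverse_family :: "'j set \<Rightarrow> 'b set
    \<Rightarrow> ((('j \<times> 'b \<Rightarrow> complex) \<Rightarrow> complex) \<times> ('b \<Rightarrow> 'j \<Rightarrow> ('j \<times> 'b \<Rightarrow> complex) \<Rightarrow> complex)) set \<Rightarrow> bool" where
  "left_inverse_family J B F \<longleftrightarrow> finite F \<and>
     (\<forall>(q, p)\<in>F. polyfun (J \<times> B) q \<and> (\<forall>b\<in>B. \<forall>j\<in>J. polyfun (J \<times> B) (p b j)) \<and>
        (\<forall>M z. \<forall>b\<in>B. q M * z b = (\<Sum>j\<in>J. p b j M * (\<Sum>b'\<in>B. M (j, b') * z b')))) \<and>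
     (\<forall>M. (\<forall>z. (\<forall>j\<in>J. (\<Sum>b\<in>B. M (j, b) * z b) = 0) \<longrightarrow> (\<forall>b\<in>B. z b = 0)) \<longrightarrow>
        (\<exists>(q, p)\<in>F. q M \<noteq> 0))"

text \<open>
  Gaussian elimination without division. The family does not depend on the matrix, but which
  member has a nonzero denominator does, according to the choice of pivots.
\<close>

lemma polynomial_left_inverses:
  assumes "finite B" "finite J"
  shows "\<exists>F. left_inverse_family J B F"
  using assms
proof (induction B arbitrary: J rule: finite_induct)
  case empty
  show ?case
    unfolding left_inverse_family_def
    by (rule exI[of _ "{(\<lambda>_. 1, \<lambda>_ _ _. 0)}"]) (auto intro: polyfun.const)
next
  case (insert b0 B)
  let ?B = "insert b0 B"
  have "\<forall>j0\<in>J. \<exists>F. left_inverse_family (J - {j0}) B F" using insert.IH insert.prems by simp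
  then obtain \<F> where \<F>: "\<And>j0. j0 \<in> J \<Longrightarrow> left_inverse_family (J - {j0}) B (\<F> j0)" by metis
  \<comment> \<open>the matrix left after clearing column \<open>b0\<close> with the pivot in row \<open>j0\<close>\<close>
  define red :: "'b \<Rightarrow> ('b \<times> 'a \<Rightarrow> complex) \<Rightarrow> ('b \<times> 'a \<Rightarrow> complex)"
    where "red j0 M = (\<lambda>(j, b). M (j0, b0) * M (j, b) - M (j, b0) * M (j0, b))" for j0 M
  \<comment> \<open>\<open>R\<close> expresses the cleared right-hand sides by the original ones; \<open>lift\<close> adds the unknown
    \<open>b0\<close>, which row \<open>j0\<close> determines from the others\<close>
  define R where "R j0 p' b = (\<lambda>j M. if j = j0 then - (\<Sum>j\<in>J - {j0}. p' b j (red j0 M) * M (j, b0))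
      else p' b j (red j0 M) * M (j0, b0))"
    for j0 and p' :: "'a \<Rightarrow> 'b \<Rightarrow> ('b \<times> 'a \<Rightarrow> complex) \<Rightarrow> complex" and b
  define lift where "lift j0 = (\<lambda>(q' :: ('b \<times> 'a \<Rightarrow> complex) \<Rightarrow> complex, p').
      (\<lambda>M. M (j0, b0) * q' (red j0 M),
       \<lambda>b j M. if b = b0 then (if j = j0 then q' (red j0 M) else 0) - (\<Sum>b\<in>B. M (j0, b) * R j0 p' b j M)
         else M (j0, b0) * R j0 p' b j M))" for j0
  have redpoly: "polyfun (J \<times> ?B) (\<lambda>M. f (red j0 M))"
    if "j0 \<in> J" "polyfun ((J - {j0}) \<times> B) f" for j0 f
  proof -
    have "polyfun (J \<times> ?B) (\<lambda>M. f (\<lambda>x. (\<lambda>x M. red j0 M x) x M))"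
      using that(2)
      by (rule polyfun_compose)
         (use that(1) in \<open>auto simp: red_def intro!: polyfun_diff polyfun.mult polyfun.var\<close>)
    then show ?thesis by simp
  qed
  have lifted: "polyfun (J \<times> ?B) (fst (lift j0 qp)) \<and>
      (\<forall>b\<in>?B. \<forall>j\<in>J. polyfun (J \<times> ?B) (snd (lift j0 qp) b j)) \<and>
      (\<forall>M z. \<forall>b\<in>?B. fst (lift j0 qp) M * z b =
        (\<Sum>j\<in>J. snd (lift j0 qp) b j M * (\<Sum>b'\<in>?B. M (j, b') * z b')))"
    if j0: "j0 \<in> J" and qp: "qp \<in> \<F> j0" for j0 qp
  proof -
    obtain q' p' where qp': "qp = (q', p')" by (cases qp)
    have G: "polyfun ((J - {j0}) \<times> B) q'"
      "\<And>b j. b \<in> B \<Longrightarrow> j \<in> J - {j0} \<Longrightarrow> polyfun ((J - {j0}) \<times> B) (p' b j)"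
      "\<And>M z b. b \<in> B \<Longrightarrow> q' M * z b = (\<Sum>j\<in>J - {j0}. p' b j M * (\<Sum>b'\<in>B. M (j, b') * z b'))"
      using \<F>[OF j0] qp unfolding left_inverse_family_def qp' by blast+
    have Rpoly: "polyfun (J \<times> ?B) (R j0 p' b j)" if "b \<in> B" "j \<in> J" for b j
      unfolding R_def using that j0
      by (cases "j = j0")
         (auto intro!: polyfun_minus polyfun_sum polyfun.mult redpoly G(2) polyfun.var)
    have 1: "polyfun (J \<times> ?B) (fst (lift j0 qp))"
      unfolding lift_def qp' using j0 by (auto intro!: polyfun.mult polyfun.var redpoly G(1))
    have 2: "polyfun (J \<times> ?B) (snd (lift j0 qp) b j)" if "b \<in> ?B" "j \<in> J" for b j
      unfolding lift_def qp' using that j0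
      by (cases "b = b0"; cases "j = j0")
         (auto intro!: polyfun.mult polyfun_diff polyfun_minus polyfun_sum polyfun.var redpoly G(1) Rpoly polyfun.const)
    have 3: "fst (lift j0 qp) M * z b =
        (\<Sum>j\<in>J. snd (lift j0 qp) b j M * (\<Sum>b'\<in>?B. M (j, b') * z b'))" if b: "b \<in> ?B" for M z b
    proof -
      define w where "w j = (\<Sum>b'\<in>?B. M (j, b') * z b')" for j
      have w: "w j = M (j, b0) * z b0 + (\<Sum>b'\<in>B. M (j, b') * z b')" for j
        unfolding w_def using insert.hyps by simp
      have elim: "(\<Sum>b'\<in>B. red j0 M (j, b') * z b') = M (j0, b0) * w j - M (j, b0) * w j0" for j
        unfolding w red_def by (simp add: algebra_simps sum_subtractf sum_distrib_left)
      have row: "q' (red j0 M) * z b = (\<Sum>j\<in>J. R j0 p' b j M * w j)" if "b \<in> B" for b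
      proof -
        have "q' (red j0 M) * z b =
            (\<Sum>j\<in>J - {j0}. p' b j (red j0 M) * (M (j0, b0) * w j - M (j, b0) * w j0))"
          using G(3)[OF that, of "red j0 M" z] unfolding elim .
        also have "\<dots> = (\<Sum>j\<in>J - {j0}. R j0 p' b j M * w j) + R j0 p' b j0 M * w j0"
          by (simp add: R_def algebra_simps sum_subtractf sum_distrib_left)
        also have "\<dots> = (\<Sum>j\<in>J. R j0 p' b j M * w j)"
          using insert.prems j0 by (simp add: sum.remove)
        finally show ?thesis .
      qed
      show ?thesis
      proof (cases "b = b0")
        case False
        then have "fst (lift j0 qp) M * z b = M (j0, b0) * (q' (red j0 M) * z b)"
          by (simp add: lift_def qp')
        also have "\<dots> = (\<Sum>j\<in>J. M (j0, b0) * R j0 p' b j M * w j)"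
          using row[of b] b False by (simp add: sum_distrib_left mult.assoc)
        finally show ?thesis using False by (simp add: lift_def qp' w_def)
      next
        case True
        have "(\<Sum>b\<in>B. M (j0, b) * (q' (red j0 M) * z b)) =
            (\<Sum>j\<in>J. (\<Sum>b\<in>B. M (j0, b) * R j0 p' b j M) * w j)"
        proof -
          have "(\<Sum>b\<in>B. M (j0, b) * (q' (red j0 M) * z b)) = (\<Sum>b\<in>B. \<Sum>j\<in>J. M (j0, b) * R j0 p' b j M * w j)"
            by (intro sum.cong refl) (simp add: row sum_distrib_left mult.assoc)
          also have "\<dots> = (\<Sum>j\<in>J. \<Sum>b\<in>B. M (j0, b) * R j0 p' b j M * w j)" by (rule sum.swap)
          finally show ?thesis by (simp add: sum_distrib_right)
        qed
        moreover have "M (j0, b0) * q' (red j0 M) * z b0 =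
            q' (red j0 M) * w j0 - (\<Sum>b\<in>B. M (j0, b) * (q' (red j0 M) * z b))"
          unfolding w by (simp add: algebra_simps sum_distrib_left)
        moreover have "(\<Sum>j\<in>J. (if j = j0 then q' (red j0 M) else 0) * w j) = q' (red j0 M) * w j0"
        proof -
          have "(\<Sum>j\<in>J. (if j = j0 then q' (red j0 M) else 0) * w j) =
              (\<Sum>j\<in>J. if j = j0 then q' (red j0 M) * w j0 else 0)"
            by (intro sum.cong) auto
          then show ?thesis using insert.prems j0 by simp
        qed
        ultimately have "M (j0, b0) * q' (red j0 M) * z b0 =
            (\<Sum>j\<in>J. ((if j = j0 then q' (red j0 M) else 0) - (\<Sum>b\<in>B. M (j0, b) * R j0 p' b j M)) * w j)"
          by (simp add: left_diff_distrib sum_subtractf)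
        then show ?thesis using True by (simp add: lift_def qp' w_def)
      qed
    qed
    show ?thesis using 1 2 3 by blast
  qed
  have "finite (\<Union>j0\<in>J. lift j0 ` \<F> j0)"
    using insert.prems \<F> by (auto simp: left_inverse_family_def)
  moreover have "\<exists>qp\<in>(\<Union>j0\<in>J. lift j0 ` \<F> j0). fst qp M \<noteq> 0"
    if inj: "\<forall>z. (\<forall>j\<in>J. (\<Sum>b\<in>?B. M (j, b) * z b) = 0) \<longrightarrow> (\<forall>b\<in>?B. z b = 0)" for M
  proof -
    obtain j0 where j0: "j0 \<in> J" "M (j0, b0) \<noteq> 0"
    proof (rule ccontr)
      assume "\<not> thesis"
      then have z: "\<forall>j\<in>J. M (j, b0) = 0" using that by blast
      have "(\<Sum>b\<in>?B. M (j, b) * (if b = b0 then 1 else 0)) = 0" if "j \<in> J" for j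
        by (rule sum.neutral) (use z that in auto)
      then show False using inj[rule_format, of "\<lambda>b. if b = b0 then 1 else 0" b0] by simp
    qed
    have "\<forall>b\<in>B. z b = 0" if z: "\<forall>j\<in>J - {j0}. (\<Sum>b\<in>B. red j0 M (j, b) * z b) = 0" for z
    proof -
      define S where "S = (\<Sum>b\<in>B. M (j0, b) * z b)"
      define z' where "z' = z(b0 := - S / M (j0, b0))"
      have z': "(\<Sum>b\<in>?B. M (j, b) * z' b) = - M (j, b0) * S / M (j0, b0) + (\<Sum>b\<in>B. M (j, b) * z b)" for j
      proof -
        have "(\<Sum>b\<in>B. M (j, b) * z' b) = (\<Sum>b\<in>B. M (j, b) * z b)"
          using insert.hyps by (intro sum.cong) (auto simp: z'_def)
        then show ?thesis using insert.hyps by (simp add: z'_def)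
      qed
      have "(\<Sum>b\<in>?B. M (j, b) * z' b) = 0" if "j \<in> J" for j
      proof (cases "j = j0")
        case True
        then show ?thesis using j0 by (simp add: z' S_def)
      next
        case False
        then have "(\<Sum>b\<in>B. red j0 M (j, b) * z b) = 0" using z that by blast
        moreover have "(\<Sum>b\<in>B. red j0 M (j, b) * z b) =
            M (j0, b0) * (\<Sum>b\<in>B. M (j, b) * z b) - M (j, b0) * S"
          by (simp add: red_def S_def algebra_simps sum_subtractf sum_distrib_left)
        ultimately show ?thesis unfolding z' using j0(2) by (simp add: field_simps)
      qed
      then have "\<forall>b\<in>?B. z' b = 0" using inj by blast
      then have "z' b = 0" if "b \<in> B" for b using that by blast
      moreover have "z' b = z b" if "b \<in> B" for b using that insert.hyps(2) by (auto simp: z'_def)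
      ultimately show ?thesis by metis
    qed
    moreover have "\<forall>M. (\<forall>z. (\<forall>j\<in>J - {j0}. (\<Sum>b\<in>B. M (j, b) * z b) = 0) \<longrightarrow> (\<forall>b\<in>B. z b = 0)) \<longrightarrow>
        (\<exists>(q, p)\<in>\<F> j0. q M \<noteq> 0)"
      using \<F>[OF j0(1)] unfolding left_inverse_family_def by (elim conjE)
    ultimately have "\<exists>(q, p)\<in>\<F> j0. q (red j0 M) \<noteq> 0" by blast
    then obtain qp where qp: "qp \<in> \<F> j0" "fst qp (red j0 M) \<noteq> 0" by auto
    then have "fst (lift j0 qp) M \<noteq> 0" using j0 by (simp add: lift_def case_prod_beta)
    then show ?thesis using qp j0 by blast
  qed
  ultimately show ?case using lifted unfolding left_inverse_family_def
    by (intro exI[of _ "\<Union>j0\<in>J. lift j0 ` \<F> j0"]) (simp add: case_prod_beta)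
qed

section \<open>Algebraic dependence\<close>

definition exponents_bounded :: "'x set \<Rightarrow> nat \<Rightarrow> 'x mpoly \<Rightarrow> bool" where
  "exponents_bounded V D p \<longleftrightarrow> Poly_Mapping.keys p \<subseteq> exponent_box V D"

lemma exponents_bounded_one: "exponents_bounded V 0 1"
  by (auto simp: exponents_bounded_def exponent_box_def)

lemma exponents_bounded_mult:
  assumes "exponents_bounded V a p" "exponents_bounded V b q"
  shows "exponents_bounded V (a + b) (p * q)"
  unfolding exponents_bounded_def
proof
  fix m assume "m \<in> Poly_Mapping.keys (p * q)"
  then obtain s t where m: "m = s + t" and st: "s \<in> Poly_Mapping.keys p" "t \<in> Poly_Mapping.keys q"
    using keys_mult[of p q] by blast
  have "s \<in> exponent_box V a" "t \<in> exponent_box V b"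
    using st assms unfolding exponents_bounded_def by blast+
  then show "m \<in> exponent_box V (a + b)"
    using keys_add[of s t] unfolding m exponent_box_def by (auto simp: lookup_add intro: add_mono)
qed

lemma exponents_bounded_power:
  "exponents_bounded V a p \<Longrightarrow> exponents_bounded V (a * j) (p ^ j)"
  by (induction j) (auto intro: exponents_bounded_one dest: exponents_bounded_mult)

lemma exponents_bounded_prod:
  assumes "\<And>a. a \<in> A \<Longrightarrow> exponents_bounded V (D a) (p a)"
  shows "exponents_bounded V (\<Sum>a\<in>A. D a) (\<Prod>a\<in>A. p a)"
  using assms
  by (induction A rule: infinite_finite_induct) (auto intro: exponents_bounded_one exponents_bounded_mult)

lemma exponents_bounded_mono: "exponents_bounded V a p \<Longrightarrow> a \<le> b \<Longrightarrow> exponents_bounded V b p"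
  unfolding exponents_bounded_def exponent_box_def subset_iff mem_Collect_eq
  by (meson order_trans)

lemma poly_eval_power: "poly_eval (p ^ j) x = poly_eval p x ^ j"
  by (induction j) (simp_all add: poly_eval_mult)

lemma poly_eval_prod: "poly_eval (\<Prod>a\<in>A. p a) x = (\<Prod>a\<in>A. poly_eval (p a) x)"
  by (induction A rule: infinite_finite_induct) (simp_all add: poly_eval_mult)

lemma polyfun_obtain_bounded:
  assumes "polyfun V f"
  obtains p D where "f = poly_eval p" "exponents_bounded V D p"
proof -
  obtain p where p: "f = poly_eval p" "\<And>m. m \<in> Poly_Mapping.keys p \<Longrightarrow> Poly_Mapping.keys m \<subseteq> V"
    using polyfun_obtain_mpoly[OF assms] by blast
  obtain D where "Poly_Mapping.keys p \<subseteq> exponent_box V D"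
    using finite_subset_exponent_box[OF finite_keys p(2)] by blast
  then have "exponents_bounded V D p" by (simp add: exponents_bounded_def)
  then show ?thesis using that p(1) by blast
qed

text \<open>
  A rational parametrisation \<open>p / q\<close> by fewer parameters than coordinates is not dense. There
  are about \<open>D\<close> to the power \<open>card Y\<close> monomials with exponents up to \<open>D\<close> in the coordinates;
  after clearing denominators they pull back to polynomials with exponents of order \<open>D\<close> in
  the parameters, a space of dimension about \<open>D\<close> to the power \<open>card X\<close>. For large \<open>D\<close> a
  nontrivial combination of the monomials pulls back to zero.
\<close>

lemma algebraic_dependence:
  fixes p :: "'y \<Rightarrow> ('x \<Rightarrow> complex) \<Rightarrow> complex"
  assumes "finite X" "finite Y" "card X < card Y"
    and "\<And>y. y \<in> Y \<Longrightarrow> polyfun X (p y)" "polyfun X q"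
  obtains P where "polyfun Y P" "\<exists>v. P v \<noteq> 0"
    "\<And>x v. q x \<noteq> 0 \<Longrightarrow> (\<And>y. y \<in> Y \<Longrightarrow> q x * v y = p y x) \<Longrightarrow> P v = 0"
proof -
  have "\<forall>y\<in>Y. \<exists>r D. p y = poly_eval r \<and> exponents_bounded X D r"
    using polyfun_obtain_bounded[OF assms(4)] by blast
  then obtain r Dr where r: "\<And>y. y \<in> Y \<Longrightarrow> p y = poly_eval (r y)"
    "\<And>y. y \<in> Y \<Longrightarrow> exponents_bounded X (Dr y) (r y)" by metis
  obtain s Ds where s: "q = poly_eval s" "exponents_bounded X Ds s"
    using polyfun_obtain_bounded[OF assms(5)] by blast
  define e where "e = Ds + (\<Sum>y\<in>Y. Dr y)"
  have er: "exponents_bounded X e (r y)" if "y \<in> Y" for y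
  proof (rule exponents_bounded_mono[OF r(2)[OF that]])
    have "Dr y \<le> (\<Sum>y\<in>Y. Dr y)" using that assms(2) by (intro member_le_sum) auto
    then show "Dr y \<le> e" by (simp add: e_def)
  qed
  have es: "exponents_bounded X e s" by (rule exponents_bounded_mono[OF s(2)]) (simp add: e_def)
  \<comment> \<open>Multiplied by the power \<open>T\<close> of \<open>q\<close>, monomials with exponents up to \<open>D\<close> pull back to polynomials
    with exponents up to \<open>e * T < C * (D + 1)\<close>; the choice of \<open>D\<close> absorbs the factor
    \<open>C ^ card X\<close> into one more power of \<open>D + 1\<close>.\<close>
  define C where "C = e * card Y + 1"
  define D where "D = C ^ card X"
  define deg where "deg a = (\<Sum>y\<in>Y. Poly_Mapping.lookup a y)" for a :: "'y monomial"
  define T where "T = D * card Y"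
  define mon where "mon a = s ^ (T - deg a) * (\<Prod>y\<in>Y. r y ^ Poly_Mapping.lookup a y)" for a
  have degT: "deg a \<le> T" if "a \<in> exponent_box Y D" for a
  proof -
    have "deg a \<le> (\<Sum>y\<in>Y. D)" unfolding deg_def using that by (intro sum_mono) (simp add: exponent_box_def)
    then show ?thesis by (simp add: T_def mult.commute)
  qed
  have mon_keys: "Poly_Mapping.keys (mon a) \<subseteq> exponent_box X (e * T)" if "a \<in> exponent_box Y D" for a
  proof -
    have "exponents_bounded X (e * (T - deg a) + (\<Sum>y\<in>Y. e * Poly_Mapping.lookup a y)) (mon a)"
      unfolding mon_def
      by (intro exponents_bounded_mult exponents_bounded_power exponents_bounded_prod er es)
    moreover have "e * (T - deg a) + (\<Sum>y\<in>Y. e * Poly_Mapping.lookup a y) = e * T"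
      using degT[OF that] unfolding sum_distrib_left[symmetric] deg_def[symmetric] distrib_left[symmetric]
      by simp
    ultimately show ?thesis by (simp add: exponents_bounded_def)
  qed
  have "card (exponent_box X (e * T)) < card (exponent_box Y D)"
  proof -
    have "e * T + 1 \<le> C * (D + 1)" by (simp add: C_def T_def algebra_simps)
    then have "(e * T + 1) ^ card X \<le> (C * (D + 1)) ^ card X" by (rule power_mono) simp
    also have "\<dots> = D * (D + 1) ^ card X" by (simp only: power_mult_distrib D_def)
    also have "\<dots> < (D + 1) ^ Suc (card X)" by simp
    also have "\<dots> \<le> (D + 1) ^ card Y" using assms(3) by (intro power_increasing) auto
    finally show ?thesis using assms(1,2) by (simp add: card_exponent_box)
  qed
  then obtain v where v: "\<exists>a\<in>exponent_box Y D. v a \<noteq> 0"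
    "\<forall>b\<in>exponent_box X (e * T). (\<Sum>a\<in>exponent_box Y D. v a * Poly_Mapping.lookup (mon a) b) = 0"
    using homogeneous_system_solution[of "exponent_box X (e * T)" "exponent_box Y D"
        "\<lambda>a b. Poly_Mapping.lookup (mon a) b"] assms(1,2) by (auto simp: finite_exponent_box)
  define P where "P z = (\<Sum>a\<in>exponent_box Y D. v a * mono_eval a z)" for z
  have "polyfun Y P" unfolding P_def
    by (intro polyfun_sum polyfun.mult polyfun.const polyfun_mono_eval) (simp add: exponent_box_def)
  moreover have "\<exists>z. P z \<noteq> 0"
    using monomials_independent[of "exponent_box Y D" v] v(1) assms(2) unfolding P_def
    by (auto simp: finite_exponent_box)
  moreover have "P z = 0" if qx: "q x \<noteq> 0" and zx: "\<And>y. y \<in> Y \<Longrightarrow> q x * z y = p y x" for x z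
  proof -
    have scaled: "q x ^ T * mono_eval a z = poly_eval (mon a) x" if a: "a \<in> exponent_box Y D" for a
    proof -
      have "mono_eval a z = (\<Prod>y\<in>Y. z y ^ Poly_Mapping.lookup a y)"
        by (rule mono_eval_superset) (use a assms(2) in \<open>auto simp: exponent_box_def\<close>)
      moreover have "q x ^ T = q x ^ (T - deg a) * (\<Prod>y\<in>Y. q x ^ Poly_Mapping.lookup a y)"
        using degT[OF a] by (simp add: power_sum[symmetric] deg_def[symmetric] power_add[symmetric])
      ultimately have "q x ^ T * mono_eval a z =
          q x ^ (T - deg a) * (\<Prod>y\<in>Y. (q x * z y) ^ Poly_Mapping.lookup a y)"
        by (simp add: prod.distrib power_mult_distrib)
      also have "(\<Prod>y\<in>Y. (q x * z y) ^ Poly_Mapping.lookup a y) =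
          (\<Prod>y\<in>Y. poly_eval (r y) x ^ Poly_Mapping.lookup a y)"
        using zx r(1) by (intro prod.cong) auto
      finally show ?thesis by (simp add: mon_def poly_eval_mult poly_eval_power poly_eval_prod s(1))
    qed
    have "q x ^ T * P z = (\<Sum>a\<in>exponent_box Y D. v a * poly_eval (mon a) x)"
      unfolding P_def sum_distrib_left by (rule sum.cong) (simp_all add: scaled[symmetric] mult_ac)
    also have "\<dots> = (\<Sum>a\<in>exponent_box Y D. \<Sum>b\<in>exponent_box X (e * T).
        v a * Poly_Mapping.lookup (mon a) b * mono_eval b x)"
      using mon_keys assms(1)
      by (intro sum.cong refl)
         (simp add: poly_eval_superset[of "exponent_box X (e * T)"] finite_exponent_box sum_distrib_left mult.assoc)
    also have "\<dots> = (\<Sum>b\<in>exponent_box X (e * T).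
        (\<Sum>a\<in>exponent_box Y D. v a * Poly_Mapping.lookup (mon a) b) * mono_eval b x)"
      by (subst sum.swap) (simp add: sum_distrib_right)
    also have "\<dots> = 0" using v(2) by simp
    finally show ?thesis using qx by simp
  qed
  ultimately show ?thesis using that by blast
qed


section \<open>Polynomial maps onto a dense open set\<close>

text \<open>This turns a polynomial relation into an equation for the single coordinate \<open>w\<close>.\<close>

lemma polyfun_insert_expand:
  assumes "polyfun (insert w V) f"
  shows "\<exists>u m. (\<forall>t\<le>m. polyfun V (u t)) \<and> (\<forall>z. f z = (\<Sum>t\<le>m. u t z * z w ^ t))"
  using assms
proof (induction rule: polyfun.induct)
  case (const c)
  show ?case by (rule exI[of _ "\<lambda>_ _. c"], rule exI[of _ "0::nat"]) (auto intro: polyfun.const)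
next
  case (var v)
  show ?case
  proof (cases "v = w")
    case True
    show ?thesis
      by (rule exI[of _ "\<lambda>t _. if t = 1 then 1 else 0"], rule exI[of _ "1::nat"])
         (auto intro: polyfun.const simp: True)
  next
    case False
    then show ?thesis using var
      by (intro exI[of _ "\<lambda>_ z. z v"] exI[of _ "0::nat"]) (auto intro: polyfun.var)
  qed
next
  case (add f g)
  then obtain u m u' m' where u: "\<forall>t\<le>m. polyfun V (u t)" "\<forall>z. f z = (\<Sum>t\<le>m. u t z * z w ^ t)"
    "\<forall>t\<le>m'. polyfun V (u' t)" "\<forall>z. g z = (\<Sum>t\<le>m'. u' t z * z w ^ t)" by blast
  define a where "a t = (if t \<le> m then u t else (\<lambda>_. 0))" for t
  define a' where "a' t = (if t \<le> m' then u' t else (\<lambda>_. 0))" for t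
  have pad: "f z = (\<Sum>t\<le>m + m'. a t z * z w ^ t)" "g z = (\<Sum>t\<le>m + m'. a' t z * z w ^ t)" for z
    unfolding u(2)[rule_format] u(4)[rule_format] a_def a'_def
    by (rule sum.mono_neutral_cong_left; auto)+
  have "\<forall>t\<le>m + m'. polyfun V (\<lambda>z. a t z + a' t z)"
    using u(1,3) by (auto simp: a_def a'_def intro!: polyfun.add polyfun.const)
  moreover have "\<forall>z. f z + g z = (\<Sum>t\<le>m + m'. (a t z + a' t z) * z w ^ t)"
    by (simp add: pad sum.distrib distrib_right)
  ultimately show ?case by (intro exI[of _ "\<lambda>t z. a t z + a' t z"] exI[of _ "m + m'"]) blast
next
  case (mult f g)
  then obtain u m u' m' where u: "\<forall>t\<le>m. polyfun V (u t)" "\<forall>z. f z = (\<Sum>t\<le>m. u t z * z w ^ t)"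
    "\<forall>t\<le>m'. polyfun V (u' t)" "\<forall>z. g z = (\<Sum>t\<le>m'. u' t z * z w ^ t)" by blast
  define S where "S t = {(i, j) \<in> {..m} \<times> {..m'}. i + j = t}" for t :: nat
  define a where "a t z = (\<Sum>(i, j)\<in>S t. u i z * u' j z)" for t z
  have "polyfun V (a t)" for t
    unfolding a_def case_prod_beta using u(1,3) by (intro polyfun_sum polyfun.mult) (auto simp: S_def)
  moreover have "f z * g z = (\<Sum>t\<le>m + m'. a t z * z w ^ t)" for z
  proof -
    have "f z * g z = (\<Sum>(i, j)\<in>{..m} \<times> {..m'}. u i z * u' j z * z w ^ (i + j))"
      unfolding u(2)[rule_format] u(4)[rule_format]
      by (simp add: sum_product sum.cartesian_product power_add mult.assoc mult.left_commute)
    also have "\<dots> = (\<Sum>t\<le>m + m'. \<Sum>(i, j)\<in>{x \<in> {..m} \<times> {..m'}. (\<lambda>(i, j). i + j) x = t}.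
        u i z * u' j z * z w ^ (i + j))"
      by (rule sum.group[symmetric]) auto
    also have "\<dots> = (\<Sum>t\<le>m + m'. a t z * z w ^ t)"
      unfolding a_def sum_distrib_right S_def by (intro sum.cong refl) auto
    finally show ?thesis .
  qed
  ultimately show ?case by blast
qed

text \<open>
  The proof extends points one variable at a time. A point \<open>\<rho>\<close> of the Zariski closure of the
  projected graph of \<open>\<phi>\<close>, that is, a point at which all relations between \<open>\<phi>\<close> and the
  variables treated so far vanish, is given the next coordinate as a root of the relation
  of least degree for that variable. Division with remainder by this relation shows that the
  new point satisfies all relations, provided that the leading coefficient does not vanish
  at \<open>\<rho>\<close>; and the leading coefficient is algebraic over the coordinates of the target, so
  this is ensured by an open condition on the target.
\<close>

lemma algebraically_independent_generically_surjective:
  fixes \<phi> :: "'y \<Rightarrow> ('x \<Rightarrow> complex) \<Rightarrow> complex"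
  assumes finX: "finite X" and finY: "finite Y" and card: "card X = card Y"
    and \<phi>: "\<And>y. y \<in> Y \<Longrightarrow> polyfun X (\<phi> y)"
    and indep: "\<And>F v. polyfun Y F \<Longrightarrow> (\<And>x. F (\<lambda>y. \<phi> y x) = 0) \<Longrightarrow> F v = 0"
  obtains P where "polyfun Y P" "\<exists>v. P v \<noteq> 0" "\<And>v. P v \<noteq> 0 \<Longrightarrow> \<exists>x. \<forall>y\<in>Y. \<phi> y x = v y"
proof -
  define graph where "graph x = case_sum (\<lambda>y. \<phi> y x) x" for x
  define null where "null F \<longleftrightarrow> (\<forall>x. F (graph x) = 0)" for F :: "('y + 'x \<Rightarrow> complex) \<Rightarrow> complex"
  define good where "good V \<rho> \<longleftrightarrow> (\<forall>F. polyfun V F \<longrightarrow> null F \<longrightarrow> F \<rho> = 0)" for V \<rho>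
  have graphpoly: "polyfun X (\<lambda>x. F (graph x))" if "polyfun (Inl ` Y \<union> Inr ` X) F" for F
  proof -
    have "polyfun X (\<lambda>x. F (\<lambda>v. (\<lambda>v x. graph x v) v x))"
      using that by (rule polyfun_compose) (auto simp: graph_def intro: \<phi> polyfun.var)
    then show ?thesis by simp
  qed
  have prime: "null F \<or> null G"
    if "polyfun (Inl ` Y \<union> Inr ` X) F" "polyfun (Inl ` Y \<union> Inr ` X) G" "null (\<lambda>z. F z * G z)" for F G
    using polyfun_mult_nonzero[OF graphpoly[OF that(1)] graphpoly[OF that(2)]] that(3)
    unfolding null_def by blast
  have lift: "polyfun (Inl ` Y) (\<lambda>z. F (\<lambda>y. z (Inl y)))" if "polyfun Y F" for F
    by (rule polyfun_compose[OF that, of _ "\<lambda>y z. z (Inl y)"]) (auto intro: polyfun.var)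
  \<comment> \<open>every polynomial in the \<open>x\<close> is algebraic over the \<open>\<phi> y\<close>\<close>
  have algebraic: "\<exists>u m. (\<forall>t\<le>m. polyfun Y (u t)) \<and> (\<exists>t\<le>m. \<exists>v. u t v \<noteq> 0) \<and>
      null (\<lambda>z. \<Sum>t\<le>m. u t (\<lambda>y. z (Inl y)) * G z ^ t)"
    if G: "polyfun (Inl ` Y \<union> Inr ` X) G" for G
  proof -
    let ?Z = "insert None (Some ` Y)"
    have c: "card X < card ?Z" using finY card by (simp add: card_image)
    obtain Q where Q: "polyfun ?Z Q" "\<exists>v. Q v \<noteq> 0"
      "\<And>x v. (1::complex) \<noteq> 0 \<Longrightarrow> (\<And>y. y \<in> ?Z \<Longrightarrow> 1 * v y = (case y of None \<Rightarrow> G (graph x) | Some y \<Rightarrow> \<phi> y x)) \<Longrightarrow> Q v = 0"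
      by (rule algebraic_dependence[OF finX _ c, of "\<lambda>y x. case y of None \<Rightarrow> G (graph x) | Some y \<Rightarrow> \<phi> y x" "\<lambda>_. 1"])
         (use finY \<phi> graphpoly[OF G] in \<open>auto intro: polyfun.const\<close>)
    obtain u m where u: "\<forall>t\<le>m. polyfun (Some ` Y) (u t)" "\<forall>z. Q z = (\<Sum>t\<le>m. u t z * z None ^ t)"
      using polyfun_insert_expand[OF Q(1)] by blast
    define u' where "u' t v = u t (case_option 0 v)" for t v
    have cong: "u t z = u' t (\<lambda>y. z (Some y))" if "t \<le> m" for t z
      unfolding u'_def by (rule polyfun_cong[of "Some ` Y"]) (use u(1) that in auto)
    have "polyfun Y (u' t)" if "t \<le> m" for t
      unfolding u'_def
    proof (rule polyfun_compose[of "Some ` Y" "u t" Y "\<lambda>a z. case_option 0 z a"])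
      show "polyfun (Some ` Y) (u t)" using u(1) that by blast
      show "polyfun Y (\<lambda>z. case_option 0 z v)" if "v \<in> Some ` Y" for v
        using that by (auto intro: polyfun.var)
    qed
    moreover have "\<exists>t\<le>m. \<exists>v. u' t v \<noteq> 0"
    proof (rule ccontr)
      assume "\<not> ?thesis"
      then have "Q z = 0" for z using u(2) cong by simp
      then show False using Q(2) by blast
    qed
    moreover have "null (\<lambda>z. \<Sum>t\<le>m. u' t (\<lambda>y. z (Inl y)) * G z ^ t)"
      unfolding null_def
    proof
      fix x
      have "Q (case_option (G (graph x)) (\<lambda>y. \<phi> y x)) = 0"
        by (rule Q(3)[of _ x]) (auto split: option.splits)
      then show "(\<Sum>t\<le>m. u' t (\<lambda>y. graph x (Inl y)) * G (graph x) ^ t) = 0"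
        using u(2) cong by (simp add: graph_def)
    qed
    ultimately show ?thesis by blast
  qed
  \<comment> \<open>the constant term of the shortest relation for \<open>G\<close> vanishes wherever \<open>G\<close> does\<close>
  have norm: "\<exists>c. polyfun Y c \<and> (\<exists>v. c v \<noteq> 0) \<and>
      (\<forall>V \<rho>. Inl ` Y \<subseteq> V \<longrightarrow> polyfun V G \<longrightarrow> good V \<rho> \<longrightarrow> G \<rho> = 0 \<longrightarrow> c (\<lambda>y. \<rho> (Inl y)) = 0)"
    if G: "polyfun (Inl ` Y \<union> Inr ` X) G" and nz: "\<not> null G" for G
  proof -
    define R where "R m u \<longleftrightarrow> (\<forall>t\<le>m. polyfun Y (u t)) \<and> (\<exists>t\<le>m. \<exists>v. u t v \<noteq> 0) \<and>
      null (\<lambda>z. \<Sum>t\<le>m. u t (\<lambda>y. z (Inl y)) * G z ^ t)" for m u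
    have ex: "\<exists>m. \<exists>u. R m u" using algebraic[OF G] unfolding R_def by blast
    obtain m where m: "\<exists>u. R m u" "\<And>m'. m' < m \<Longrightarrow> \<not> (\<exists>u. R m' u)"
      using ex[unfolded exists_least_iff[of "\<lambda>m. \<exists>u. R m u"]] by blast
    obtain u where u: "R m u" using m(1) by blast
    have u0: "\<exists>v. u 0 v \<noteq> 0"
    proof (rule ccontr)
      assume z: "\<not> ?thesis"
      have "m \<noteq> 0"
      proof
        assume "m = 0"
        then show False using u z by (auto simp: R_def)
      qed
      then obtain m' where m': "m = Suc m'" using not0_implies_Suc by blast
      define H where "H z = (\<Sum>t\<le>m'. u (Suc t) (\<lambda>y. z (Inl y)) * G z ^ t)" for z
      have poly: "\<forall>t\<le>m'. polyfun Y (u (Suc t))" using u by (auto simp: R_def m')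
      have "polyfun (Inl ` Y \<union> Inr ` X) H" unfolding H_def
        using poly by (intro polyfun_sum polyfun.mult polyfun_power G polyfun_mono[OF lift]) auto
      moreover have "(\<lambda>z. G z * H z) = (\<lambda>z. \<Sum>t\<le>m. u t (\<lambda>y. z (Inl y)) * G z ^ t)"
        using z by (simp add: m' H_def sum.atMost_Suc_shift sum_distrib_left mult_ac del: sum.atMost_Suc)
      ultimately have "null H" using prime[OF G, of H] nz u by (simp add: R_def)
      moreover have "\<exists>t\<le>m'. \<exists>v. u (Suc t) v \<noteq> 0"
      proof -
        obtain t v where "t \<le> m" "u t v \<noteq> 0" using u by (auto simp: R_def)
        then show ?thesis using z by (cases t) (auto simp: m')
      qed
      ultimately have "R m' (\<lambda>t. u (Suc t))" using poly by (simp add: R_def H_def[abs_def])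
      then show False using m(2)[of m'] m' by blast
    qed
    have "u 0 (\<lambda>y. \<rho> (Inl y)) = 0"
      if V: "Inl ` Y \<subseteq> V" and GV: "polyfun V G" and \<rho>: "good V \<rho>" "G \<rho> = 0" for V \<rho>
    proof -
      have "polyfun V (\<lambda>z. \<Sum>t\<le>m. u t (\<lambda>y. z (Inl y)) * G z ^ t)"
        using u V by (intro polyfun_sum polyfun.mult polyfun_power GV polyfun_mono[OF lift]) (auto simp: R_def)
      then have "(\<Sum>t\<le>m. u t (\<lambda>y. \<rho> (Inl y)) * G \<rho> ^ t) = 0"
        using \<rho>(1) u unfolding good_def R_def by blast
      moreover have "(\<Sum>t\<le>m. u t (\<lambda>y. \<rho> (Inl y)) * G \<rho> ^ t) = u 0 (\<lambda>y. \<rho> (Inl y))"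
        unfolding \<rho>(2) by (simp add: power_0_left if_distrib cong: if_cong)
      ultimately show ?thesis by simp
    qed
    moreover have "polyfun Y (u 0)" using u by (simp add: R_def)
    ultimately show ?thesis using u0 by (intro exI[of _ "u 0"]) blast
  qed
  have extend: "\<exists>P. polyfun Y P \<and> (\<exists>v. P v \<noteq> 0) \<and>
      (\<forall>v. P v \<noteq> 0 \<longrightarrow> (\<exists>\<rho>. (\<forall>y. \<rho> (Inl y) = v y) \<and> good (Inl ` Y \<union> Inr ` X') \<rho>))"
    if "X' \<subseteq> X" for X'
    using finite_subset[OF that finX] that
  proof (induction X' rule: finite_induct)
    case empty
    have "good (Inl ` Y) (case_sum v x)" for v x
      unfolding good_def
    proof (intro allI impI)
      fix F assume F: "polyfun (Inl ` Y) F" "null F"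
      define F' where "F' v = F (case_sum v x)" for v
      have "polyfun Y F'" unfolding F'_def
        by (rule polyfun_compose[OF F(1), of Y "\<lambda>a v. case_sum v x a"]) (auto intro: polyfun.var)
      moreover have "F' (\<lambda>y. \<phi> y x') = 0" for x'
      proof -
        have "F' (\<lambda>y. \<phi> y x') = F (graph x')" unfolding F'_def
          by (rule polyfun_cong[OF F(1)]) (auto simp: graph_def)
        then show ?thesis using F(2) by (simp add: null_def)
      qed
      ultimately have "F' v = 0" by (rule indep)
      then show "F (case_sum v x) = 0" by (simp add: F'_def)
    qed
    then show ?case
      by (intro exI[of _ "\<lambda>_. 1"]) (auto intro!: polyfun.const exI[of _ "case_sum _ undefined"])
  next
    case (insert w X')
    let ?V = "Inl ` Y \<union> Inr ` X'"
    have wX: "w \<in> X" and X': "X' \<subseteq> X" using insert.prems by auto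
    have Vsub: "?V \<subseteq> Inl ` Y \<union> Inr ` X" using X' by auto
    obtain P where P: "polyfun Y P" "\<exists>v. P v \<noteq> 0"
      "\<forall>v. P v \<noteq> 0 \<longrightarrow> (\<exists>\<rho>. (\<forall>y. \<rho> (Inl y) = v y) \<and> good ?V \<rho>)"
      using insert.IH X' by blast
    define R where "R m a \<longleftrightarrow> (\<forall>t\<le>m. polyfun ?V (a t)) \<and> \<not> null (a m) \<and>
      null (\<lambda>z. \<Sum>t\<le>m. a t z * z (Inr w) ^ t)" for m :: nat and a :: "nat \<Rightarrow> ('y + 'x \<Rightarrow> complex) \<Rightarrow> complex"
    \<comment> \<open>a relation remains a relation without leading terms that vanish on the graph\<close>
    have drop: "(\<forall>t\<le>m. null (a t)) \<or> (\<exists>m'\<le>m. R m' a)"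
      if "\<forall>t\<le>m. polyfun ?V (a t)" "null (\<lambda>z. \<Sum>t\<le>m. a t z * z (Inr w) ^ t)" for m a
      using that
    proof (induction m)
      case 0
      then show ?case by (auto simp: null_def)
    next
      case (Suc m)
      show ?case
      proof (cases "null (a (Suc m))")
        case True
        then have "null (\<lambda>z. \<Sum>t\<le>m. a t z * z (Inr w) ^ t)" using Suc.prems(2) by (simp add: null_def)
        then show ?thesis using Suc.IH Suc.prems(1) True by (metis le_Suc_eq)
      next
        case False
        then show ?thesis using Suc.prems unfolding R_def by blast
      qed
    qed
    have ex: "\<exists>m a. R m a"
    proof -
      have "polyfun (Inl ` Y \<union> Inr ` X) (\<lambda>z. z (Inr w))" using wX by (auto intro: polyfun.var)
      then obtain u m where u: "\<forall>t\<le>m. polyfun Y (u t)" "\<exists>t\<le>m. \<exists>v. u t v \<noteq> 0"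
        "null (\<lambda>z. \<Sum>t\<le>m. u t (\<lambda>y. z (Inl y)) * z (Inr w) ^ t)" using algebraic by blast
      define a where "a t z = u t (\<lambda>y. z (Inl y))" for t and z :: "'y + 'x \<Rightarrow> complex"
      have "\<forall>t\<le>m. polyfun ?V (a t)" unfolding a_def using u(1) by (auto intro: polyfun_mono[OF lift])
      moreover have "\<not> (\<forall>t\<le>m. null (a t))"
      proof
        assume n: "\<forall>t\<le>m. null (a t)"
        have "u t v = 0" if "t \<le> m" for t v
          by (rule indep) (use u(1) n that in \<open>auto simp: null_def a_def graph_def\<close>)
        then show False using u(2) by blast
      qed
      ultimately show ?thesis using drop[of m a] u(3) unfolding a_def by blast
    qed
    obtain m where m: "\<exists>a. R m a" "\<And>m'. m' < m \<Longrightarrow> \<not> (\<exists>a. R m' a)"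
      using ex[unfolded exists_least_iff[of "\<lambda>m. \<exists>a. R m a"]] by blast
    obtain a where a: "R m a" using m(1) by blast
    have apoly: "\<And>t. t \<le> m \<Longrightarrow> polyfun ?V (a t)" and am: "\<not> null (a m)"
      and anull: "null (\<lambda>z. \<Sum>t\<le>m. a t z * z (Inr w) ^ t)" using a by (auto simp: R_def)
    have m0: "m \<noteq> 0" using am anull by (intro notI) (simp add: null_def)
    obtain c where c: "polyfun Y c" "\<exists>v. c v \<noteq> 0"
      "\<And>\<rho>. good ?V \<rho> \<Longrightarrow> a m \<rho> = 0 \<Longrightarrow> c (\<lambda>y. \<rho> (Inl y)) = 0"
      using norm[OF polyfun_mono[OF apoly[OF order_refl] Vsub] am] apoly[OF order_refl] by blast
    have "\<exists>\<rho>. (\<forall>y. \<rho> (Inl y) = v y) \<and> good (Inl ` Y \<union> Inr ` insert w X') \<rho>"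
      if v: "P v * c v \<noteq> 0" for v
    proof -
      obtain \<rho> where \<rho>: "\<forall>y. \<rho> (Inl y) = v y" "good ?V \<rho>" using P(3) v by auto
      have lead: "a m \<rho> \<noteq> 0" using c(3)[OF \<rho>(2)] \<rho>(1) v by auto
      have "\<exists>\<xi>. (\<Sum>t\<le>m. a t \<rho> * \<xi> ^ t) = 0"
      proof -
        define p where "p = (\<Sum>t\<le>m. monom (a t \<rho>) t)"
        have cp: "coeff p t = (if t \<le> m then a t \<rho> else 0)" for t
          by (simp add: p_def coeff_sum if_distrib cong: if_cong)
        have "degree p = m" by (rule antisym) (auto simp: cp lead intro!: degree_le le_degree)
        then have "\<not> constant (poly p)" using m0 by (simp add: constant_degree)
        then obtain \<xi> where "poly p \<xi> = 0" using fundamental_theorem_of_algebra by blast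
        then show ?thesis by (auto simp: p_def poly_sum poly_monom)
      qed
      then obtain \<xi> where \<xi>: "(\<Sum>t\<le>m. a t \<rho> * \<xi> ^ t) = 0" by blast
      define \<rho>' where "\<rho>' = \<rho>(Inr w := \<xi>)"
      have old: "F \<rho>' = F \<rho>" if "polyfun ?V F" for F
        by (rule polyfun_cong[OF that]) (use insert.hyps in \<open>auto simp: \<rho>'_def\<close>)
      have root: "(\<Sum>t\<le>m. a t \<rho>' * \<xi> ^ t) = 0" using \<xi> old[OF apoly] by simp
      have vanish: "(\<Sum>t\<le>l. u t \<rho>' * \<xi> ^ t) = 0"
        if "\<forall>t\<le>l. polyfun ?V (u t)" "null (\<lambda>z. \<Sum>t\<le>l. u t z * z (Inr w) ^ t)" for l u
        using that
      proof (induction l arbitrary: u)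
        case 0
        then have "u 0 \<rho> = 0" using \<rho>(2) by (auto simp: good_def null_def)
        then show ?case using old[of "u 0"] 0 by simp
      next
        case (Suc l)
        show ?case
        proof (cases "Suc l < m")
          case True
          then have "\<forall>t\<le>Suc l. null (u t)" using drop[OF Suc.prems] m(2) by (metis le_less_trans)
          then have "u t \<rho>' = 0" if "t \<le> Suc l" for t
            using \<rho>(2) old[of "u t"] Suc.prems(1) that unfolding good_def by metis
          then show ?thesis by simp
        next
          case False
          \<comment> \<open>one step of the division with remainder by the relation \<open>a\<close>\<close>
          define s where "s = Suc l - m"
          define b where "b t = (\<lambda>z. if s \<le> t \<and> t \<le> Suc l then a (t - s) z else 0)" for t
          define u' where "u' t z = a m z * u t z - u (Suc l) z * b t z" for t z
          have shift: "(\<Sum>t\<le>Suc l. b t z * x ^ t) = x ^ s * (\<Sum>t\<le>m. a t z * x ^ t)" for z x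
          proof -
            have "(\<Sum>t\<le>Suc l. b t z * x ^ t) = (\<Sum>t\<in>{s..Suc l}. a (t - s) z * x ^ t)"
              by (rule sum.mono_neutral_cong_right) (auto simp: b_def)
            also have "\<dots> = (\<Sum>t\<le>m. a t z * x ^ (t + s))"
              by (rule sum.reindex_bij_witness[of _ "\<lambda>t. t + s" "\<lambda>t. t - s"]) (use False in \<open>auto simp: s_def\<close>)
            finally show ?thesis by (simp add: power_add sum_distrib_left mult_ac)
          qed
          have u'l: "u' (Suc l) z = 0" for z using False by (simp add: u'_def b_def s_def)
          have expand: "(\<Sum>t\<le>l. u' t z * x ^ t) = a m z * (\<Sum>t\<le>Suc l. u t z * x ^ t)
              - u (Suc l) z * (x ^ s * (\<Sum>t\<le>m. a t z * x ^ t))" for z x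
          proof -
            have "(\<Sum>t\<le>l. u' t z * x ^ t) = (\<Sum>t\<le>Suc l. u' t z * x ^ t)" by (simp add: u'l)
            also have "\<dots> = a m z * (\<Sum>t\<le>Suc l. u t z * x ^ t) - u (Suc l) z * (\<Sum>t\<le>Suc l. b t z * x ^ t)"
              unfolding u'_def by (simp add: left_diff_distrib sum_subtractf sum_distrib_left mult.assoc del: sum.atMost_Suc)
            finally show ?thesis by (simp only: shift)
          qed
          have "polyfun ?V (b t)" for t
            using apoly[of "t - s"] False by (cases "s \<le> t \<and> t \<le> Suc l") (auto simp: b_def s_def intro: polyfun.const)
          then have "\<forall>t\<le>l. polyfun ?V (u' t)"
            unfolding u'_def using Suc.prems(1) apoly by (intro allI impI polyfun_diff polyfun.mult) auto
          moreover have "null (\<lambda>z. \<Sum>t\<le>l. u' t z * z (Inr w) ^ t)"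
            unfolding expand using Suc.prems(2) anull by (simp add: null_def del: sum.atMost_Suc)
          ultimately have "(\<Sum>t\<le>l. u' t \<rho>' * \<xi> ^ t) = 0" by (rule Suc.IH)
          then have "a m \<rho>' * (\<Sum>t\<le>Suc l. u t \<rho>' * \<xi> ^ t) = 0"
            unfolding expand root by (simp del: sum.atMost_Suc)
          then show ?thesis using lead old[OF apoly[OF order_refl]] by simp
        qed
      qed
      have "good (Inl ` Y \<union> Inr ` insert w X') \<rho>'"
        unfolding good_def
      proof (intro allI impI)
        fix F assume F: "polyfun (Inl ` Y \<union> Inr ` insert w X') F" "null F"
        then have "polyfun (insert (Inr w) ?V) F" by simp
        from polyfun_insert_expand[OF this] obtain u l
          where u: "\<forall>t\<le>l. polyfun ?V (u t)" "\<And>z. F z = (\<Sum>t\<le>l. u t z * z (Inr w) ^ t)"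
          by (elim exE conjE) (rule that, assumption, erule spec)
        have "null (\<lambda>z. \<Sum>t\<le>l. u t z * z (Inr w) ^ t)" using F(2) u(2) by (simp add: null_def)
        from vanish[OF u(1) this] have "(\<Sum>t\<le>l. u t \<rho>' * \<rho>' (Inr w) ^ t) = 0" by (simp add: \<rho>'_def)
        then show "F \<rho>' = 0" by (simp add: u(2))
      qed
      moreover have "\<forall>y. \<rho>' (Inl y) = v y" using \<rho>(1) by (simp add: \<rho>'_def)
      ultimately show ?thesis by blast
    qed
    moreover have "polyfun Y (\<lambda>v. P v * c v)" by (rule polyfun.mult[OF P(1) c(1)])
    moreover have "\<exists>v. P v * c v \<noteq> 0" by (rule polyfun_mult_nonzero[OF P(1) c(1) P(2) c(2)])
    ultimately show ?case by (intro exI[of _ "\<lambda>v. P v * c v"] conjI allI impI)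
  qed
  obtain P where P: "polyfun Y P" "\<exists>v. P v \<noteq> 0"
    "\<And>v. P v \<noteq> 0 \<Longrightarrow> \<exists>\<rho>. (\<forall>y. \<rho> (Inl y) = v y) \<and> good (Inl ` Y \<union> Inr ` X) \<rho>"
    using extend[OF order_refl] by blast
  have "\<exists>x. \<forall>y\<in>Y. \<phi> y x = v y" if Pv: "P v \<noteq> 0" for v
  proof -
    obtain \<rho> where \<rho>: "\<forall>y. \<rho> (Inl y) = v y" "good (Inl ` Y \<union> Inr ` X) \<rho>" using P(3)[OF Pv] by blast
    have "\<phi> y (\<lambda>x. \<rho> (Inr x)) = v y" if y: "y \<in> Y" for y
    proof -
      have "polyfun (Inl ` Y \<union> Inr ` X) (\<lambda>z. \<phi> y (\<lambda>x. z (Inr x)))"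
        by (rule polyfun_compose[OF \<phi>[OF y], of _ "\<lambda>x z. z (Inr x)"]) (auto intro: polyfun.var)
      then have "polyfun (Inl ` Y \<union> Inr ` X) (\<lambda>z. \<phi> y (\<lambda>x. z (Inr x)) - z (Inl y))"
        using y by (intro polyfun_diff) (auto intro: polyfun.var)
      moreover have "null (\<lambda>z. \<phi> y (\<lambda>x. z (Inr x)) - z (Inl y))" by (simp add: null_def graph_def)
      ultimately show ?thesis using \<rho> unfolding good_def by fastforce
    qed
    then show ?thesis by blast
  qed
  then show ?thesis using that P(1,2) by blast
qed

lemma polyfun_taylor:
  assumes "polyfun V F"
  shows "\<exists>T m. (\<forall>e\<le>m. polyfun V (T e)) \<and>
     (\<forall>\<tau> z. F (\<lambda>v. c v + \<tau> * z v) = (\<Sum>e\<le>m. \<tau> ^ e * T e z))"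
proof -
  let ?F = "\<lambda>\<zeta>. F (\<lambda>v. c v + \<zeta> None * \<zeta> (Some v))"
  have "polyfun (insert None (Some ` V)) ?F"
    by (rule polyfun_compose[OF assms])
       (auto intro!: polyfun.add polyfun.mult polyfun.const polyfun.var)
  from polyfun_insert_expand[OF this] obtain u m
    where u: "\<forall>e\<le>m. polyfun (Some ` V) (u e)" "\<And>\<zeta>. ?F \<zeta> = (\<Sum>e\<le>m. u e \<zeta> * \<zeta> None ^ e)"
    by (elim exE conjE) (rule that, assumption, erule spec)
  define T where "T e z = u e (case_option 0 z)" for e z
  have "polyfun V (T e)" if "e \<le> m" for e
    unfolding T_def
  proof (rule polyfun_compose[of "Some ` V" "u e" V "\<lambda>a z. case_option 0 z a"])
    show "polyfun (Some ` V) (u e)" using u(1) that by blast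
    show "polyfun V (\<lambda>z. case_option 0 z v)" if "v \<in> Some ` V" for v
      using that by (auto intro: polyfun.var)
  qed
  moreover have "F (\<lambda>v. c v + \<tau> * z v) = (\<Sum>e\<le>m. \<tau> ^ e * T e z)" for \<tau> z
  proof -
    have "F (\<lambda>v. c v + \<tau> * z v) = (\<Sum>e\<le>m. u e (case_option \<tau> z) * \<tau> ^ e)"
      using u(2)[of "case_option \<tau> z"] by simp
    also have "\<dots> = (\<Sum>e\<le>m. \<tau> ^ e * T e z)"
    proof (rule sum.cong[OF refl])
      fix e assume "e \<in> {..m}"
      then have "polyfun (Some ` V) (u e)" using u(1) by simp
      then have "u e (case_option \<tau> z) = T e z"
        unfolding T_def by (rule polyfun_cong) auto
      then show "u e (case_option \<tau> z) * \<tau> ^ e = \<tau> ^ e * T e z" by simp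
    qed
    finally show ?thesis .
  qed
  ultimately show ?thesis by (intro exI[of _ T] exI[of _ m] conjI allI impI)
qed

text \<open>
  If \<open>F\<close> were nonzero, its term of least degree at the base point would vanish on the image of
  the linear part, which is everything.
\<close>

lemma algebraically_independent_if_linear_part_surjective:
  fixes \<phi> :: "'y \<Rightarrow> ('x \<Rightarrow> complex) \<Rightarrow> complex"
  assumes F: "polyfun Y F" "\<And>x. F (\<lambda>y. \<phi> y x) = 0"
    and expand: "\<And>x y. y \<in> Y \<Longrightarrow> \<exists>\<psi>. poly \<psi> 0 = L x y \<and> (\<forall>\<tau>. \<phi> y (\<lambda>i. \<tau> * x i) = c y + \<tau> * poly \<psi> \<tau>)"
    and surj: "\<And>w. \<exists>x. \<forall>y\<in>Y. L x y = w y"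
  shows "F v = 0"
proof -
  from polyfun_taylor[OF F(1), of c] obtain T m where "\<forall>e\<le>m. polyfun Y (T e)"
    "\<forall>\<tau> z. F (\<lambda>v. c v + \<tau> * z v) = (\<Sum>e\<le>m. \<tau> ^ e * T e z)"
    by (elim exE conjE)
  then have T: "\<And>e. e \<le> m \<Longrightarrow> polyfun Y (T e)"
    "\<And>\<tau> z. F (\<lambda>v. c v + \<tau> * z v) = (\<Sum>e\<le>m. \<tau> ^ e * T e z)"
    by simp_all
  have zero: "\<forall>z. T e z = 0" if "e \<le> m" for e
    using that
  proof (induction e rule: less_induct)
    case (less e0)
    show ?case
    proof
      fix z
      obtain x where x: "\<forall>y\<in>Y. L x y = z y" using surj by blast
      obtain \<psi> where \<psi>: "\<And>y. y \<in> Y \<Longrightarrow> poly (\<psi> y) 0 = L x y"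
        "\<And>y \<tau>. y \<in> Y \<Longrightarrow> \<phi> y (\<lambda>i. \<tau> * x i) = c y + \<tau> * poly (\<psi> y) \<tau>"
        using expand[of _ x] by metis
      have "\<forall>e\<in>{..m}. \<exists>r. \<forall>\<tau>. T e (\<lambda>y. poly (\<psi> y) \<tau>) = poly r \<tau>"
        using polyfun_univariate[OF T(1), of _ \<psi>] by simp
      then obtain r where r: "\<And>e \<tau>. e \<le> m \<Longrightarrow> T e (\<lambda>y. poly (\<psi> y) \<tau>) = poly (r e) \<tau>" by (metis atMost_iff)
      define p where "p = (\<Sum>e\<in>{e0..m}. monom 1 (e - e0) * r e)"
      have "poly (monom 1 e0 * p) \<tau> = 0" for \<tau>
      proof -
        have "poly (monom 1 e0 * p) \<tau> = (\<Sum>e\<in>{e0..m}. \<tau> ^ e * T e (\<lambda>y. poly (\<psi> y) \<tau>))"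
          unfolding p_def
          by (simp add: poly_sum poly_monom sum_distrib_left r mult.assoc[symmetric] power_add[symmetric])
        also have "\<dots> = (\<Sum>e\<le>m. \<tau> ^ e * T e (\<lambda>y. poly (\<psi> y) \<tau>))"
          using less.IH by (intro sum.mono_neutral_left) auto
        also have "\<dots> = F (\<lambda>y. c y + \<tau> * poly (\<psi> y) \<tau>)" by (simp add: T(2))
        also have "\<dots> = F (\<lambda>y. \<phi> y (\<lambda>i. \<tau> * x i))" by (rule polyfun_cong[OF F(1)]) (simp add: \<psi>(2))
        finally show ?thesis by (simp add: F(2))
      qed
      then have "monom 1 e0 * p = 0" using poly_all_0_iff_0 by blast
      then have "p = 0" by simp
      have "poly p 0 = (\<Sum>e\<in>{e0..m}. if e = e0 then T e0 (\<lambda>y. poly (\<psi> y) 0) else 0)"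
        unfolding p_def poly_sum by (rule sum.cong) (auto simp: poly_monom r)
      also have "\<dots> = T e0 (\<lambda>y. poly (\<psi> y) 0)" using less.prems by simp
      also have "\<dots> = T e0 z" by (rule polyfun_cong[OF T(1)[OF less.prems]]) (simp add: \<psi>(1) x)
      finally show "T e0 z = 0" using \<open>p = 0\<close> by simp
    qed
  qed
  have "F v = (\<Sum>e\<le>m. 1 ^ e * T e (\<lambda>y. v y - c y))" unfolding T(2)[symmetric] by simp
  then show ?thesis using zero by simp
qed


section \<open>Generic points of linear systems\<close>

definition homogeneous_part :: "nat \<Rightarrow> 'x mpoly \<Rightarrow> 'x mpoly" where
  "homogeneous_part e p =
     (\<Sum>m\<in>{m \<in> Poly_Mapping.keys p. total_degree m = e}. Poly_Mapping.single m (Poly_Mapping.lookup p m))"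

lemma homogeneous_homogeneous_part: "homogeneous e (homogeneous_part e p)"
proof -
  have "Poly_Mapping.keys (homogeneous_part e p) \<subseteq> {m \<in> Poly_Mapping.keys p. total_degree m = e}"
    unfolding homogeneous_part_def by (rule order_trans[OF keys_sum]) auto
  then show ?thesis by (auto simp: homogeneous_def)
qed

lemma poly_eval_sum: "poly_eval (\<Sum>a\<in>A. p a) x = (\<Sum>a\<in>A. poly_eval (p a) x)"
  by (induction A rule: infinite_finite_induct) (simp_all add: poly_eval_add)

lemma poly_eval_homogeneous_parts:
  "poly_eval p x = (\<Sum>e\<in>total_degree ` Poly_Mapping.keys p. poly_eval (homogeneous_part e p) x)"
  unfolding homogeneous_part_def poly_eval_sum poly_eval_single
  by (subst sum.group) (auto simp: poly_eval_def)

lemma homogeneous_part_eq_0: "e \<notin> total_degree ` Poly_Mapping.keys p \<Longrightarrow> homogeneous_part e p = 0"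
  unfolding homogeneous_part_def by (rule sum.neutral) auto

lemma line_of_scale:
  assumes "c \<noteq> 0"
  shows "line_of (\<lambda>i. c * x i) = line_of x"
proof -
  have "\<exists>b. (\<lambda>i. a * x i) = (\<lambda>i. b * (c * x i))" for a
    using assms by (intro exI[of _ "a / c"]) (simp add: fun_eq_iff)
  moreover have "\<exists>b. (\<lambda>i. a * (c * x i)) = (\<lambda>i. b * x i)" for a
    by (intro exI[of _ "a * c"]) (simp add: fun_eq_iff)
  ultimately show ?thesis unfolding line_of_def by blast
qed

text \<open>
  On a line through the origin \<open>Q\<close> vanishes identically iff all its homogeneous parts do, so these
  cut out the complement of the open set; density is the irreducibility of \<open>L\<close>.
\<close>

lemma generically_nonvanishing:
  assumes lin: "\<And>a b u v. u \<in> L \<Longrightarrow> v \<in> L \<Longrightarrow> (\<lambda>i. a * u i + b * v i) \<in> L"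
    and Q: "polyfun UNIV Q" "u0 \<in> L" "Q u0 \<noteq> 0"
  shows "generically (zariski L) (\<lambda>l. \<exists>x\<in>L. (\<exists>i. x i \<noteq> 0) \<and> l = line_of x \<and> Q x \<noteq> 0)"
proof -
  obtain p where p: "Q = poly_eval p" using polyfun_obtain_mpoly[OF Q(1)] by blast
  define h where "h e = homogeneous_part e p" for e
  have hom: "homogeneous e (h e)" for e by (simp add: h_def homogeneous_homogeneous_part)
  define U where "U = {l \<in> projectivization L. \<exists>e. \<not> vanishes_at (h e) l}"
  have "openin (zariski L) U"
    unfolding openin_zariski zariski_closed_def
  proof (intro conjI exI[of _ "range h"])
    show "\<forall>p\<in>range h. \<exists>e. homogeneous e p" using hom by blast
    show "projectivization L - U = {l \<in> projectivization L. \<forall>p\<in>range h. vanishes_at p l}"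
      unfolding U_def by blast
  qed (auto simp: U_def)
  moreover have "zariski L closure_of U = topspace (zariski L)"
  proof (intro subset_antisym closure_of_subset_topspace subsetI)
    fix l assume l: "l \<in> topspace (zariski L)"
    then obtain x i where x: "l = line_of x" "x \<in> L" "x i \<noteq> 0" by (auto simp: projectivization_def)
    show "l \<in> zariski L closure_of U"
      unfolding in_closure_of
    proof (intro conjI l allI impI)
      fix T assume T: "l \<in> T \<and> openin (zariski L) T"
      then obtain F where F: "\<forall>p\<in>F. \<exists>e. homogeneous e p"
        "projectivization L - T = {l \<in> projectivization L. \<forall>p\<in>F. vanishes_at p l}"
        unfolding openin_zariski zariski_closed_def by blast
      have "l \<in> projectivization L" "l \<in> T" using l T by auto
      then obtain f where f: "f \<in> F" "\<not> vanishes_at f l" using F(2) by blast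
      obtain e where e: "homogeneous e f" using F(1) f(1) by blast
      have fx: "poly_eval f x * x i \<noteq> 0" using f(2) x vanishes_at_line_of[OF e, of x] by auto
      have fpoly: "polyfun UNIV (\<lambda>z. poly_eval f z * z i)"
        by (intro polyfun.mult polyfun_poly_eval polyfun.var) simp
      obtain t where t: "poly_eval f (\<lambda>i. (1 - t) * x i + t * u0 i) * ((1 - t) * x i + t * u0 i) \<noteq> 0"
        "Q (\<lambda>i. (1 - t) * x i + t * u0 i) \<noteq> 0"
        by (rule polyfun_nonzero_on_line[OF fpoly Q(1), of x u0]) (use fx Q(3) in simp_all)
      define w where "w = (\<lambda>i. (1 - t) * x i + t * u0 i)"
      have w: "w \<in> L" "w i \<noteq> 0" "poly_eval f w \<noteq> 0" "Q w \<noteq> 0"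
        using t lin[OF x(2) Q(2), of "1 - t" t] by (auto simp: w_def)
      have wP: "line_of w \<in> projectivization L" using w(1,2) by (auto simp: projectivization_def)
      have "\<exists>e. poly_eval (h e) w \<noteq> 0"
      proof (rule ccontr)
        assume "\<not> ?thesis"
        then have "Q w = 0" unfolding p by (subst poly_eval_homogeneous_parts) (simp add: h_def)
        then show False using w(4) by simp
      qed
      then have "line_of w \<in> U" unfolding U_def using wP w(2) vanishes_at_line_of[OF hom, of w] by blast
      moreover have "line_of w \<in> T"
      proof (rule ccontr)
        assume "line_of w \<notin> T"
        then have "vanishes_at f (line_of w)" using F(2) wP f(1) by blast
        then show False using vanishes_at_line_of[OF e, of w] w by blast
      qed
      ultimately show "\<exists>y. y \<in> U \<and> y \<in> T" by blast
    qed
  qed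
  moreover have "\<exists>x\<in>L. (\<exists>i. x i \<noteq> 0) \<and> l = line_of x \<and> Q x \<noteq> 0" if "l \<in> U" for l
  proof -
    obtain e where e: "l \<in> projectivization L" "\<not> vanishes_at (h e) l" using \<open>l \<in> U\<close> by (auto simp: U_def)
    then obtain x i where x: "l = line_of x" "x \<in> L" "x i \<noteq> 0" by (auto simp: projectivization_def)
    have nz: "poly_eval (h e) x \<noteq> 0" using e(2) x vanishes_at_line_of[OF hom, of x] by auto
    define E where "E = total_degree ` Poly_Mapping.keys p"
    have eE: "e \<in> E"
    proof (rule ccontr)
      assume "e \<notin> E"
      then have "h e = 0" unfolding h_def E_def by (rule homogeneous_part_eq_0)
      then show False using nz by simp
    qed
    define q where "q = (\<Sum>e\<in>E. monom (poly_eval (h e) x) e)"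
    have "coeff q e = poly_eval (h e) x"
      using eE by (simp add: q_def coeff_sum E_def if_distrib cong: if_cong)
    then have "pCons 0 q \<noteq> 0" using nz by auto
    then have "finite {c. poly (pCons 0 q) c = 0}" by (rule poly_roots_finite)
    then obtain c where "poly (pCons 0 q) c \<noteq> 0" using ex_new_if_finite[OF infinite_UNIV_char_0] by blast
    then have c: "c \<noteq> 0" "poly q c \<noteq> 0" by auto
    have "Q (\<lambda>i. c * x i) = poly q c"
      unfolding p by (subst poly_eval_homogeneous_parts)
        (simp add: q_def poly_sum poly_monom E_def h_def poly_eval_scale[OF homogeneous_homogeneous_part] mult.commute)
    moreover have "(\<lambda>i. c * x i) \<in> L" using lin[OF x(2) x(2), of c 0] by simp
    ultimately show ?thesis using c x line_of_scale[OF c(1), of x]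
      by (intro bexI[of _ "\<lambda>i. c * x i"]) auto
  qed
  ultimately show ?thesis unfolding generically_def by blast
qed

section \<open>Counting monomials\<close>

definition monomials :: "'x set \<Rightarrow> nat \<Rightarrow> 'x monomial set" where
  "monomials A e = {\<mu>. Poly_Mapping.keys \<mu> \<subseteq> A \<and> total_degree \<mu> = e}"

lemma lookup_le_total_degree: "Poly_Mapping.lookup \<mu> i \<le> total_degree \<mu>"
proof (cases "i \<in> Poly_Mapping.keys \<mu>")
  case True
  then show ?thesis unfolding total_degree_def by (intro member_le_sum) auto
qed (simp add: in_keys_iff)

lemma finite_monomials: "finite A \<Longrightarrow> finite (monomials A e)"
  by (rule finite_subset[OF _ finite_exponent_box[of A e]])
     (auto simp: monomials_def exponent_box_def lookup_le_total_degree)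

lemma card_monomials:
  assumes "finite A"
  shows "card (monomials A e) = (e + card A - 1) choose e"
proof -
  obtain h where h: "bij_betw h {..<card A} A" using ex_bij_betw_nat_finite[OF assms] by (auto simp: lessThan_atLeast0)
  define g where "g \<mu> = map (\<lambda>i. Poly_Mapping.lookup \<mu> (h i)) [0..<card A]" for \<mu> :: "'a monomial"
  have "bij_betw g (monomials A e) {l. length l = card A \<and> sum_list l = e}"
  proof (rule bij_betw_imageI)
    show "inj_on g (monomials A e)"
    proof (rule inj_onI)
      fix \<mu> \<nu> assume *: "\<mu> \<in> monomials A e" "\<nu> \<in> monomials A e" "g \<mu> = g \<nu>"
      have "Poly_Mapping.lookup \<mu> x = Poly_Mapping.lookup \<nu> x" for x
      proof (cases "x \<in> A")
        case True
        then obtain i where "i < card A" "x = h i" using bij_betw_imp_surj_on[OF h] by auto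
        then show ?thesis using *(3) by (auto simp: g_def)
      next
        case False
        then have "x \<notin> Poly_Mapping.keys \<mu>" "x \<notin> Poly_Mapping.keys \<nu>" using * by (auto simp: monomials_def)
        then show ?thesis by (simp add: in_keys_iff)
      qed
      then show "\<mu> = \<nu>" by (rule poly_mapping_eqI)
    qed
    have deg: "total_degree \<mu> = sum_list (g \<mu>)" if "Poly_Mapping.keys \<mu> \<subseteq> A" for \<mu>
    proof -
      have "total_degree \<mu> = (\<Sum>x\<in>A. Poly_Mapping.lookup \<mu> x)" by (rule total_degree_superset[OF assms that])
      also have "\<dots> = (\<Sum>i<card A. Poly_Mapping.lookup \<mu> (h i))" by (rule sum.reindex_bij_betw[OF h, symmetric])
      also have "\<dots> = sum_list (g \<mu>)" by (simp add: g_def interv_sum_list_conv_sum_set_nat lessThan_atLeast0)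
      finally show ?thesis .
    qed
    show "g ` monomials A e = {l. length l = card A \<and> sum_list l = e}"
    proof (intro subset_antisym subsetI)
      fix l assume "l \<in> g ` monomials A e"
      then show "l \<in> {l. length l = card A \<and> sum_list l = e}" using deg by (auto simp: monomials_def g_def)
    next
      fix l assume l: "l \<in> {l. length l = card A \<and> sum_list l = e}"
      define \<mu> where "\<mu> = Abs_poly_mapping (\<lambda>x. if x \<in> A then l ! (inv_into {..<card A} h x) else 0)"
      have lk: "Poly_Mapping.lookup \<mu> x = (if x \<in> A then l ! (inv_into {..<card A} h x) else 0)" for x
        unfolding \<mu>_def by (subst lookup_Abs_poly_mapping) (auto intro: finite_subset[OF _ assms] split: if_splits)
      have k: "Poly_Mapping.keys \<mu> \<subseteq> A" by (auto simp: in_keys_iff lk split: if_splits)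
      have "g \<mu> = l"
      proof (rule nth_equalityI)
        show "length (g \<mu>) = length l" using l by (simp add: g_def)
        fix i assume "i < length (g \<mu>)"
        then have i: "i < card A" by (simp add: g_def)
        then have "h i \<in> A" using bij_betw_imp_surj_on[OF h] by auto
        moreover have "inv_into {..<card A} h (h i) = i"
          using i by (intro inv_into_f_f[OF bij_betw_imp_inj_on[OF h]]) auto
        ultimately show "g \<mu> ! i = l ! i" using i by (simp add: g_def lk)
      qed
      then show "l \<in> g ` monomials A e" using deg[OF k] k l by (force simp: monomials_def)
    qed
  qed
  then have "card (monomials A e) = card {l. length l = card A \<and> sum_list l = e}" by (rule bij_betw_same_card)
  then show ?thesis by (simp add: card_length_sum_list)
qed

text \<open>
  The coefficients of a tuple of forms of degrees \<open>d\<close> in the variables \<open>A\<close> are indexed by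
  \<open>coords d A\<close>.
\<close>

definition coords :: "nat list \<Rightarrow> 'x set \<Rightarrow> (nat \<times> 'x monomial) set" where
  "coords d A = (SIGMA a:{..<length d}. monomials A (d ! a))"

text \<open>
  For \<open>c = 0\<close> the subtraction is truncated, and \<open>e - 1\<close> choose \<open>e\<close> is 0 for \<open>e > 0\<close>, as it should be.
\<close>

definition coords_count :: "nat list \<Rightarrow> nat \<Rightarrow> nat" where
  "coords_count d c = (\<Sum>e\<leftarrow>d. (e + c - 1) choose e)"

lemma finite_coords: "finite A \<Longrightarrow> finite (coords d A)"
  by (auto simp: coords_def finite_monomials)

lemma card_coords: "finite A \<Longrightarrow> card (coords d A) = coords_count d (card A)"
  by (simp add: coords_def coords_count_def card_SigmaI finite_monomials card_monomials sum_list_sum_nth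
      lessThan_atLeast0)

lemma coords_mono: "A \<subseteq> B \<Longrightarrow> coords d A \<subseteq> coords d B"
  by (auto simp: coords_def monomials_def)

lemma coords_Int: "coords d A \<inter> coords d B = coords d (A \<inter> B)"
  by (auto simp: coords_def monomials_def)

text \<open>The slopes \<open>f r / r\<close> of the chords from the origin do not increase.\<close>

lemma concave_chord:
  fixes f :: "nat \<Rightarrow> int"
  assumes f0: "f 0 = 0" and conc: "\<And>r. f (Suc (Suc r)) + f r \<le> 2 * f (Suc r)" and "p \<le> c"
  shows "int p * f c \<le> int c * f p"
proof -
  have slope: "int r * f (Suc r) \<le> int (Suc r) * f r" for r
  proof (induction r)
    case 0
    then show ?case by (simp add: f0)
  next
    case (Suc r)
    have "int (Suc r) * (f (Suc (Suc r)) + f r) \<le> int (Suc r) * (2 * f (Suc r))"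
      by (intro mult_left_mono conc) simp
    then show ?case using Suc by (simp add: algebra_simps)
  qed
  show ?thesis
    using \<open>p \<le> c\<close>
  proof (induction c rule: dec_induct)
    case base
    show ?case by simp
  next
    case (step c)
    show ?case
    proof (cases "c = 0")
      case True
      then show ?thesis using step by (simp add: f0)
    next
      case False
      have "int c * (int p * f (Suc c)) = int p * (int c * f (Suc c))" by simp
      also have "\<dots> \<le> int p * (int (Suc c) * f c)" by (intro mult_left_mono slope) simp
      also have "\<dots> = int (Suc c) * (int p * f c)" by simp
      also have "\<dots> \<le> int (Suc c) * (int c * f p)" using step.IH by (intro mult_left_mono) simp_all
      also have "\<dots> = int c * (int (Suc c) * f p)" by simp
      finally show ?thesis using False by simp
    qed
  qed
qed

lemma second_difference_choose:
  "((e + 2) + (r + 2) - 1 choose (e + 2)) + ((e + 2) + r - 1 choose (e + 2)) =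
     2 * ((e + 2) + (r + 1) - 1 choose (e + 2)) + (e + r + 1 choose e)"
proof -
  have "(e + 2) + (r + 2) - 1 = Suc (Suc (e + r + 1))" "(e + 2) + (r + 1) - 1 = Suc (e + r + 1)"
    "(e + 2) + r - 1 = e + r + 1" "e + 2 = Suc (Suc e)" by simp_all
  then show ?thesis by (simp only: binomial_Suc_Suc mult_2 add_ac)
qed

text \<open>
  This is where \<open>d \<noteq> [2]\<close> enters. The second difference for a form of degree \<open>e\<close> is a binomial
  coefficient over \<open>e - 2\<close>; it is 1 for \<open>e = 2\<close> and at least 2 for \<open>e > 2\<close>.
\<close>

lemma coords_count_convex:
  assumes "\<forall>e\<in>set d. e \<ge> 2" "d \<noteq> []" "d \<noteq> [2]"
  shows "2 * int (coords_count d (r + 1)) + 2 \<le> int (coords_count d (r + 2)) + int (coords_count d r)"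
proof -
  define g where "g e = (e - 2 + r + 1) choose (e - 2)" for e
  have sd: "((e + (r + 2) - 1) choose e) + ((e + r - 1) choose e) = 2 * ((e + (r + 1) - 1) choose e) + g e"
    if "e \<ge> 2" for e
  proof -
    obtain e' where "e = e' + 2" using \<open>e \<ge> 2\<close> by (metis le_add_diff_inverse2)
    then show ?thesis using second_difference_choose[of e' r] by (simp only: g_def add_diff_cancel_right')
  qed
  have sum: "coords_count d (r + 2) + coords_count d r = 2 * coords_count d (r + 1) + (\<Sum>e\<leftarrow>d. g e)"
    using assms(1) unfolding coords_count_def by (induction d) (use sd in \<open>force simp: algebra_simps\<close>)+
  have g1: "g e \<ge> 1" for e unfolding g_def by (simp add: Suc_leI)
  have "(\<Sum>e\<leftarrow>d. g e) \<ge> 2"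
  proof (cases d)
    case (Cons e d')
    show ?thesis
    proof (cases d')
      case Nil
      then have "e \<ge> 3" using assms Cons by auto
      then have "e - 2 \<ge> 1" by simp
      then have "g e \<ge> (Suc (e - 2)) choose (e - 2)" unfolding g_def by (intro binomial_right_mono) simp
      moreover have "Suc (e - 2) choose (e - 2) = Suc (e - 2)" by (rule binomial_Suc_n)
      ultimately show ?thesis using \<open>e \<ge> 3\<close> Cons Nil by simp
    next
      case (Cons e' d'')
      then show ?thesis using \<open>d = e # d'\<close> g1[of e] g1[of e'] by simp
    qed
  qed (use assms in simp)
  then show ?thesis using sum by linarith
qed

lemma coords_count_0: "\<forall>e\<in>set d. e \<ge> 2 \<Longrightarrow> coords_count d 0 = 0"
  unfolding coords_count_def by (induction d) auto

text \<open>
  The excess of parameters over conditions, as a function of the number \<open>r\<close> of variables, is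
  concave and vanishes at 0, so it lies above its chord from 0 to \<open>c\<close>.
\<close>

lemma excess_chord:
  assumes "\<forall>e\<in>set d. e \<ge> 2" "d \<noteq> []" "d \<noteq> [2]" "p \<le> c"
  shows "int p * (int c * int N - int (coords_count d c)) \<le>
     int c * (int p * int N - int p * (int c - int p) - int (coords_count d p))"
proof -
  define f where "f r = int r * int N - int r * (int c - int r) - int (coords_count d r)" for r
  have "int p * f c \<le> int c * f p"
  proof (rule concave_chord)
    show "f 0 = 0" using coords_count_0[OF assms(1)] by (simp add: f_def)
    show "f (Suc (Suc r)) + f r \<le> 2 * f (Suc r)" for r
      using coords_count_convex[OF assms(1-3), of r] by (simp add: f_def algebra_simps)
  qed (rule assms(4))
  then show ?thesis by (simp add: f_def)
qed


section \<open>Forms in coordinates\<close>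

text \<open>A matrix is a function on pairs of indices, so that its entries can serve as variables.\<close>

definition lin_apply :: "('n \<times> 'n \<Rightarrow> complex) \<Rightarrow> ('n::finite \<Rightarrow> complex) \<Rightarrow> 'n \<Rightarrow> complex" where
  "lin_apply G v = (\<lambda>i. \<Sum>j\<in>UNIV. G (i, j) * v j)"

lemma monomial_induct [case_names zero add]:
  fixes P :: "'x monomial \<Rightarrow> bool"
  assumes "P 0" "\<And>\<mu> i. P \<mu> \<Longrightarrow> P (\<mu> + Poly_Mapping.single i 1)"
  shows "P \<mu>"
proof (induction "total_degree \<mu>" arbitrary: \<mu>)
  case 0
  have "Poly_Mapping.lookup \<mu> i = 0" for i using lookup_le_total_degree[of \<mu> i] 0 by simp
  then have "\<mu> = 0" by (intro poly_mapping_eqI) simp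
  then show ?case using assms(1) by simp
next
  case (Suc e)
  then obtain i where i: "i \<in> Poly_Mapping.keys \<mu>" by (fastforce simp: total_degree_def)
  let ?\<nu> = "\<mu> - Poly_Mapping.single i 1"
  have \<mu>: "\<mu> = ?\<nu> + Poly_Mapping.single i 1"
    using i by (intro poly_mapping_eqI) (auto simp: lookup_add lookup_minus lookup_single when_def in_keys_iff)
  have "total_degree \<mu> = total_degree ?\<nu> + total_degree (Poly_Mapping.single i 1 :: 'x monomial)"
    by (subst \<mu>) (rule total_degree_add)
  then have "e = total_degree ?\<nu>" using Suc(2) by (simp add: total_degree_def)
  then have "P ?\<nu>" by (rule Suc(1))
  then show ?case using assms(2)[of ?\<nu> i] \<mu> by simp
qed

lemma total_degree_single [simp]: "total_degree (Poly_Mapping.single i j) = j"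
  by (simp add: total_degree_def)

lemma mono_eval_lin_apply:
  fixes \<mu> :: "'n::finite monomial"
  shows "\<exists>K. (\<forall>\<mu>'. polyfun UNIV (K \<mu>')) \<and>
     (\<forall>G x. mono_eval \<mu> (lin_apply G x) = (\<Sum>\<mu>'\<in>monomials UNIV (total_degree \<mu>). K \<mu>' G * mono_eval \<mu>' x))"
proof (induction \<mu> rule: monomial_induct)
  case zero
  have "monomials (UNIV :: 'n set) (total_degree (0 :: 'n monomial)) = {0}"
  proof (intro subset_antisym subsetI)
    fix \<mu> :: "'n monomial" assume "\<mu> \<in> monomials UNIV (total_degree (0 :: 'n monomial))"
    then have "Poly_Mapping.lookup \<mu> i = 0" for i
      using lookup_le_total_degree[of \<mu> i] by (simp add: monomials_def total_degree_def)
    then show "\<mu> \<in> {0}" by (auto intro: poly_mapping_eqI)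
  qed (simp add: monomials_def)
  then show ?case by (intro exI[of _ "\<lambda>_ _. 1"]) (simp add: polyfun.const)
next
  case (add \<mu> i)
  then obtain K where K: "\<forall>\<mu>'. polyfun UNIV (K \<mu>')"
    "\<forall>G x. mono_eval \<mu> (lin_apply G x) = (\<Sum>\<mu>'\<in>monomials UNIV (total_degree \<mu>). K \<mu>' G * mono_eval \<mu>' x)"
    by (elim exE conjE)
  let ?s = "\<lambda>j. Poly_Mapping.single j (1::nat)"
  let ?A = "monomials (UNIV :: 'n set) (total_degree \<mu>) \<times> (UNIV :: 'n set)"
  define K' where "K' \<mu>'' G = (\<Sum>(\<mu>', j)\<in>{x \<in> ?A. (\<lambda>(\<mu>', j). \<mu>' + ?s j) x = \<mu>''}. K \<mu>' G * G (i, j))" for \<mu>'' G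
  have "polyfun UNIV (K' \<mu>'')" for \<mu>''
    unfolding K'_def case_prod_beta using K(1) by (intro polyfun_sum polyfun.mult polyfun.var) auto
  moreover have "mono_eval (\<mu> + ?s i) (lin_apply G x) =
      (\<Sum>\<mu>'\<in>monomials UNIV (total_degree (\<mu> + ?s i)). K' \<mu>' G * mono_eval \<mu>' x)" for G x
  proof -
    have "mono_eval (\<mu> + ?s i) (lin_apply G x) =
        (\<Sum>\<mu>'\<in>monomials UNIV (total_degree \<mu>). K \<mu>' G * mono_eval \<mu>' x) * (\<Sum>j\<in>UNIV. G (i, j) * x j)"
      by (simp add: mono_eval_add K(2)) (simp add: lin_apply_def)
    also have "\<dots> = (\<Sum>(\<mu>', j)\<in>?A. K \<mu>' G * G (i, j) * mono_eval (\<mu>' + ?s j) x)"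
      unfolding sum_product sum.cartesian_product by (intro sum.cong refl) (auto simp: mono_eval_add)
    also have "\<dots> = (\<Sum>\<mu>''\<in>monomials UNIV (total_degree (\<mu> + ?s i)).
        \<Sum>(\<mu>', j)\<in>{x \<in> ?A. (\<lambda>(\<mu>', j). \<mu>' + ?s j) x = \<mu>''}. K \<mu>' G * G (i, j) * mono_eval (\<mu>' + ?s j) x)"
    proof (rule sum.group[symmetric])
      show "finite ?A" by (intro finite_cartesian_product finite_monomials) simp_all
      show "finite (monomials (UNIV :: 'n set) (total_degree (\<mu> + ?s i)))" by (rule finite_monomials) simp
    qed (auto simp: monomials_def total_degree_add)
    also have "\<dots> = (\<Sum>\<mu>'\<in>monomials UNIV (total_degree (\<mu> + ?s i)). K' \<mu>' G * mono_eval \<mu>' x)"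
      unfolding K'_def sum_distrib_right by (intro sum.cong refl) auto
    finally show ?thesis .
  qed
  ultimately show ?case by (intro exI[of _ K'] conjI allI)
qed

text \<open>
  The coefficient of \<open>\<mu>'\<close> in the polynomial that arises from \<open>\<mu>\<close> when the matrix \<open>G\<close> is
  substituted for the variables; only its existence as a polynomial in \<open>G\<close> matters.
\<close>

definition subst_coeff :: "'n::finite monomial \<Rightarrow> 'n monomial \<Rightarrow> ('n \<times> 'n \<Rightarrow> complex) \<Rightarrow> complex" where
  "subst_coeff \<mu> = (SOME K. (\<forall>\<mu>'. polyfun UNIV (K \<mu>')) \<and>
     (\<forall>G x. mono_eval \<mu> (lin_apply G x) = (\<Sum>\<mu>'\<in>monomials UNIV (total_degree \<mu>). K \<mu>' G * mono_eval \<mu>' x)))"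

lemma polyfun_subst_coeff: "polyfun UNIV (subst_coeff \<mu> \<mu>')"
  and mono_eval_subst:
    "mono_eval \<mu> (lin_apply G x) = (\<Sum>\<mu>'\<in>monomials UNIV (total_degree \<mu>). subst_coeff \<mu> \<mu>' G * mono_eval \<mu>' x)"
  using someI_ex[OF mono_eval_lin_apply[of \<mu>]] unfolding subst_coeff_def[symmetric] by simp_all

definition form_eval :: "nat list \<Rightarrow> (nat \<times> 'n::finite monomial \<Rightarrow> complex) \<Rightarrow> nat \<Rightarrow> ('n \<Rightarrow> complex) \<Rightarrow> complex" where
  "form_eval d y a v = (\<Sum>\<mu>\<in>monomials UNIV (d ! a). y (a, \<mu>) * mono_eval \<mu> v)"

text \<open>The coefficients of the forms composed with \<open>G\<close>: linear in \<open>y\<close>, polynomial in \<open>G\<close>.\<close>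

definition pullback :: "nat list \<Rightarrow> ('n::finite \<times> 'n \<Rightarrow> complex) \<Rightarrow> (nat \<times> 'n monomial \<Rightarrow> complex)
    \<Rightarrow> nat \<times> 'n monomial \<Rightarrow> complex" where
  "pullback d G y = (\<lambda>(a, \<mu>'). \<Sum>\<mu>\<in>monomials UNIV (d ! a). y (a, \<mu>) * subst_coeff \<mu> \<mu>' G)"

lemma form_eval_pullback: "form_eval d (pullback d G y) a v = form_eval d y a (lin_apply G v)"
proof -
  have "form_eval d y a (lin_apply G v) =
      (\<Sum>\<mu>\<in>monomials UNIV (d ! a). \<Sum>\<mu>'\<in>monomials UNIV (d ! a). y (a, \<mu>) * subst_coeff \<mu> \<mu>' G * mono_eval \<mu>' v)"
    unfolding form_eval_def mono_eval_subst
    by (rule sum.cong) (auto simp: monomials_def sum_distrib_left mult.assoc)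
  also have "\<dots> = form_eval d (pullback d G y) a v"
    by (subst sum.swap) (simp add: form_eval_def pullback_def sum_distrib_right)
  finally show ?thesis by simp
qed

lemma polyfun_pullback:
  assumes "\<And>x. polyfun X (\<lambda>z. G z x)" "\<And>i. polyfun X (\<lambda>z. y z i)"
  shows "polyfun X (\<lambda>z. pullback d (G z) (y z) i)"
proof -
  have "polyfun X (\<lambda>z. subst_coeff \<mu> \<mu>' (G z))" for \<mu> \<mu>'
    using polyfun_compose[OF polyfun_subst_coeff, of X "\<lambda>x z. G z x"] assms(1) by simp
  then show ?thesis
    unfolding pullback_def case_prod_beta by (intro polyfun_sum polyfun.mult assms(2))
qed

lemma form_eval_linear:
  "form_eval d (\<lambda>i. a * y i + b * y' i) m v = a * form_eval d y m v + b * form_eval d y' m v"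
  by (simp add: form_eval_def algebra_simps sum.distrib sum_distrib_left)

lemma pullback_linear:
  "pullback d G (\<lambda>i. a * y i + b * y' i) = (\<lambda>i. a * pullback d G y i + b * pullback d G y' i)"
  by (simp add: pullback_def algebra_simps sum.distrib sum_distrib_left fun_eq_iff)

lemma pullback_cong:
  "i \<in> coords d UNIV \<Longrightarrow> (\<And>i. i \<in> coords d UNIV \<Longrightarrow> y i = y' i) \<Longrightarrow> pullback d G y i = pullback d G y' i"
  unfolding pullback_def case_prod_beta by (intro sum.cong) (auto simp: coords_def)

text \<open>
  On the coordinate subspace of \<open>A\<close> a monomial with a variable outside \<open>A\<close> is zero, and the other
  monomials stay linearly independent.
\<close>

lemma form_vanishes_on_coordinates_iff:
  fixes A :: "'n::finite set"
  shows "(\<forall>a<length d. \<forall>v. (\<forall>i. i \<notin> A \<longrightarrow> v i = 0) \<longrightarrow> form_eval d y a v = 0) \<longleftrightarrow> (\<forall>i\<in>coords d A. y i = 0)"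
  (is "?L \<longleftrightarrow> ?R")
proof -
  have restr: "form_eval d y a (\<lambda>i. if i \<in> A then z i else 0) = (\<Sum>\<mu>\<in>monomials A (d ! a). y (a, \<mu>) * mono_eval \<mu> z)" for a z
  proof -
    have "mono_eval \<mu> (\<lambda>i. if i \<in> A then z i else 0) = (if Poly_Mapping.keys \<mu> \<subseteq> A then mono_eval \<mu> z else 0)" for \<mu>
    proof (cases "Poly_Mapping.keys \<mu> \<subseteq> A")
      case True
      then show ?thesis unfolding mono_eval_def by (auto intro!: prod.cong)
    next
      case False
      then obtain i where "i \<in> Poly_Mapping.keys \<mu>" "i \<notin> A" by blast
      then show ?thesis using False unfolding mono_eval_def
        by (auto intro!: prod_zero bexI[of _ i] simp: in_keys_iff power_0_left)
    qed
    then have "form_eval d y a (\<lambda>i. if i \<in> A then z i else 0) =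
        (\<Sum>\<mu>\<in>monomials UNIV (d ! a). if Poly_Mapping.keys \<mu> \<subseteq> A then y (a, \<mu>) * mono_eval \<mu> z else 0)"
      unfolding form_eval_def by (intro sum.cong) auto
    also have "\<dots> = (\<Sum>\<mu>\<in>monomials A (d ! a). y (a, \<mu>) * mono_eval \<mu> z)"
    proof (rule sum.mono_neutral_cong_right)
      show "finite (monomials UNIV (d ! a) :: 'n monomial set)" by (rule finite_monomials) simp
    qed (auto simp: monomials_def)
    finally show ?thesis .
  qed
  show ?thesis
  proof
    assume L: ?L
    show ?R
    proof
      fix i assume "i \<in> coords d A"
      then obtain a \<mu> where i: "i = (a, \<mu>)" "a < length d" "\<mu> \<in> monomials A (d ! a)" by (auto simp: coords_def)
      have "(\<Sum>\<mu>\<in>monomials A (d ! a). y (a, \<mu>) * mono_eval \<mu> z) = 0" for z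
        using restr[of a z] L i(2) by simp
      then show "y i = 0" using monomials_independent[of "monomials A (d ! a)" "\<lambda>\<mu>. y (a, \<mu>)" \<mu>] i
        by (simp add: finite_monomials)
    qed
  next
    assume R: ?R
    show ?L
    proof (intro allI impI)
      fix a and v :: "'n \<Rightarrow> complex" assume a: "a < length d" and v: "\<forall>i. i \<notin> A \<longrightarrow> v i = 0"
      have "v = (\<lambda>i. if i \<in> A then v i else 0)" using v by auto
      then have "form_eval d y a v = (\<Sum>\<mu>\<in>monomials A (d ! a). y (a, \<mu>) * mono_eval \<mu> v)" using restr[of a v] by simp
      also have "\<dots> = 0" using R a by (intro sum.neutral) (auto simp: coords_def)
      finally show "form_eval d y a v = 0" .
    qed
  qed
qed

lemma form_eval_eq_iff:
  "(\<forall>a<length d. \<forall>v. form_eval d y a v = form_eval d y' a v) \<longleftrightarrow> (\<forall>i\<in>coords d UNIV. y i = y' i)"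
proof -
  have "form_eval d (\<lambda>i. 1 * y i + (-1) * y' i) a v = form_eval d y a v - form_eval d y' a v" for a v
    unfolding form_eval_linear by simp
  then show ?thesis
    using form_vanishes_on_coordinates_iff[of d UNIV "\<lambda>i. 1 * y i + (-1) * y' i"] by simp
qed


section \<open>Planes as graphs\<close>

abbreviation forms_vanish :: "nat list \<Rightarrow> (nat \<times> 'n::finite monomial \<Rightarrow> complex) \<Rightarrow> (complex ^ 'n) set \<Rightarrow> bool" where
  "forms_vanish d y W \<equiv> \<forall>a<length d. \<forall>v\<in>W. form_eval d y a (($) v) = 0"

definition graph_plane :: "'n set \<Rightarrow> ('n \<times> 'n \<Rightarrow> complex) \<Rightarrow> (complex ^ 'n::finite) set" where
  "graph_plane I T = {v. \<forall>r. r \<notin> I \<longrightarrow> v $ r = (\<Sum>i\<in>I. T (i, r) * v $ i)}"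

abbreviation coordinate_plane :: "'n::finite set \<Rightarrow> (complex ^ 'n) set" where
  "coordinate_plane I \<equiv> graph_plane I (\<lambda>_. 0)"

text \<open>
  Coordinates in \<open>K\<close> are given the greater weight, so a pivot in \<open>K\<close> is chosen only if its row has
  no nonzero entry outside \<open>K\<close> to exchange it for.
\<close>

lemma subspace_echelon_form:
  fixes W :: "(complex ^ 'n::finite) set"
  assumes W: "vec.subspace W"
  obtains I T where "W = graph_plane I T" "\<And>i r. i \<in> I \<Longrightarrow> i \<in> K \<Longrightarrow> r \<notin> I \<Longrightarrow> r \<notin> K \<Longrightarrow> T (i, r) = 0"
proof -
  let ?W = "(\<lambda>v i. v $ i) ` W"
  have lin: "(\<lambda>i. a * v i + b * w i) \<in> ?W" if v: "v \<in> ?W" and w: "w \<in> ?W" for a b v w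
  proof -
    obtain v' w' where *: "v' \<in> W" "v = ($) v'" "w' \<in> W" "w = ($) w'" using v w by blast
    have "a *s v' + b *s w' \<in> W" using W * by (intro vec.subspace_add vec.subspace_scale)
    then show ?thesis using * by (intro image_eqI[of _ _ "a *s v' + b *s w'"]) auto
  qed
  have zero: "(\<lambda>_. 0) \<in> ?W" using vec.subspace_0[OF W] by (intro image_eqI[of _ _ 0]) auto
  obtain I u where u: "\<And>i. i \<in> I \<Longrightarrow> u i \<in> ?W"
    "\<And>w r. w \<in> ?W \<Longrightarrow> w r = (\<Sum>i\<in>I. w i * u i r)"
    "\<And>i r. i \<in> I \<Longrightarrow> r \<notin> I \<Longrightarrow> (if r \<in> K then 1 else 0) < (if i \<in> K then 1 else (0::nat)) \<Longrightarrow> u i r = 0"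
    "\<And>i r. i \<in> I \<Longrightarrow> r \<in> I \<Longrightarrow> u i r = (if r = i then 1 else 0)"
    by (rule echelon_basis[of UNIV ?W "\<lambda>r. if r \<in> K then 1 else 0"]) (use lin zero in auto)
  define T where "T = (\<lambda>(i, r). u i r)"
  have "W = graph_plane I T"
  proof (intro subset_antisym subsetI)
    fix v assume "v \<in> W"
    then have "($) v \<in> ?W" by auto
    then have "v $ r = (\<Sum>i\<in>I. v $ i * u i r)" for r by (rule u(2))
    moreover have "(\<Sum>i\<in>I. v $ i * u i r) = (\<Sum>i\<in>I. T (i, r) * v $ i)" for r
      by (simp add: T_def mult.commute)
    ultimately have "v $ r = (\<Sum>i\<in>I. T (i, r) * v $ i)" for r by (rule trans)
    then show "v \<in> graph_plane I T" unfolding graph_plane_def mem_Collect_eq by (intro allI impI)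
  next
    fix v assume v: "v \<in> graph_plane I T"
    have "\<forall>i\<in>I. \<exists>U\<in>W. u i = ($) U" using u(1) by blast
    then obtain U where U: "\<And>i. i \<in> I \<Longrightarrow> U i \<in> W" "\<And>i. i \<in> I \<Longrightarrow> u i = ($) (U i)" by metis
    have eq: "v = (\<Sum>i\<in>I. v $ i *s U i)"
    proof (rule vec_eq_iff[THEN iffD2], rule allI)
      fix r
      have "(\<Sum>i\<in>I. v $ i *s U i) $ r = (\<Sum>i\<in>I. v $ i * u i r)" by (simp add: U(2))
      also have "\<dots> = v $ r"
      proof (cases "r \<in> I")
        case True
        then have "(\<Sum>i\<in>I. v $ i * u i r) = (\<Sum>i\<in>I. if i = r then v $ i else 0)"
          by (intro sum.cong) (auto simp: u(4))
        then show ?thesis using True by simp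
      next
        case False
        then show ?thesis using v by (simp add: graph_plane_def T_def mult.commute)
      qed
      finally show "v $ r = (\<Sum>i\<in>I. v $ i *s U i) $ r" by simp
    qed
    show "v \<in> W"
      by (rule ssubst[of v _ "\<lambda>x. x \<in> W", OF eq])
         (intro vec.subspace_sum[OF W] vec.subspace_scale[OF W] U(1))
  qed
  then show ?thesis using that[of I T] u(3) by (simp add: T_def)
qed

lemma subspace_graph_plane: "vec.subspace (graph_plane I T)"
  unfolding graph_plane_def vec.subspace_def
  by (auto simp: algebra_simps sum.distrib sum_distrib_left)

lemma dim_graph_plane: "vec.dim (graph_plane I T :: (complex ^ 'n::finite) set) = card I"
proof -
  define u where "u i = (\<chi> r. if r \<in> I then (if r = i then 1 else 0) else T (i, r))" for i
  have sum_u: "(\<Sum>i\<in>I. c i *s u i) $ r = (if r \<in> I then c r else (\<Sum>i\<in>I. T (i, r) * c i))" for c r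
  proof (cases "r \<in> I")
    case True
    then have "(\<Sum>i\<in>I. c i *s u i) $ r = (\<Sum>i\<in>I. if i = r then c i else 0)"
      unfolding sum_component by (intro sum.cong) (auto simp: u_def)
    then show ?thesis using True by simp
  next
    case False
    then show ?thesis by (simp add: u_def mult.commute)
  qed
  have inj: "inj_on u I"
  proof (rule inj_onI)
    fix i j assume "i \<in> I" "j \<in> I" "u i = u j"
    then have "u i $ i = u j $ i" by simp
    then show "i = j" using \<open>i \<in> I\<close> by (simp add: u_def split: if_splits)
  qed
  have sub: "u ` I \<subseteq> graph_plane I T"
  proof
    fix v assume "v \<in> u ` I"
    then obtain i where i: "i \<in> I" "v = u i" by blast
    have "(\<Sum>j\<in>I. T (j, r) * u i $ j) = T (i, r)" for r
    proof -
      have "(\<Sum>j\<in>I. T (j, r) * u i $ j) = (\<Sum>j\<in>I. if j = i then T (j, r) else 0)"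
        by (intro sum.cong) (auto simp: u_def)
      then show ?thesis using i by simp
    qed
    then show "v \<in> graph_plane I T" using i by (simp add: graph_plane_def u_def)
  qed
  have span: "v \<in> vec.span (u ` I)" if "v \<in> graph_plane I T" for v
  proof -
    have eq: "v = (\<Sum>i\<in>I. v $ i *s u i)"
      using that by (simp only: vec_eq_iff sum_u) (auto simp: graph_plane_def)
    show ?thesis
      by (rule ssubst[of v _ "\<lambda>x. x \<in> vec.span (u ` I)", OF eq])
         (intro vec.span_sum vec.span_scale vec.span_base imageI)
  qed
  have indep: "vec.independent (u ` I)"
  proof (rule vec.independent_if_scalars_zero)
    fix f x assume *: "(\<Sum>x\<in>u ` I. f x *s x) = 0" "x \<in> u ` I"
    have "(\<Sum>i\<in>I. f (u i) *s u i) = 0" using *(1) by (simp add: sum.reindex[OF inj])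
    moreover obtain i where "i \<in> I" "x = u i" using *(2) by blast
    ultimately show "f x = 0" using sum_u[of "\<lambda>i. f (u i)" i] by simp
  qed simp
  show ?thesis
    using vec.dim_unique[OF sub _ indep card_image[OF inj]] span by blast
qed

lemma planes_graph_plane: "graph_plane I T \<in> planes k \<longleftrightarrow> card I = k + 1"
  by (simp add: planes_def subspace_graph_plane dim_graph_plane)

text \<open>The unipotent map that moves the graph of \<open>T\<close> to the coordinate subspace of \<open>I\<close>.\<close>

definition shear :: "'n set \<Rightarrow> ('n \<times> 'n \<Rightarrow> complex) \<Rightarrow> 'n \<times> 'n \<Rightarrow> complex" where
  "shear I T = (\<lambda>(r, j). if r = j then 1 else if r \<notin> I \<and> j \<in> I then - T (j, r) else 0)"

lemma polyfun_shear:
  assumes "\<And>x. polyfun X (\<lambda>z. T z x)"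
  shows "polyfun X (\<lambda>z. shear I (T z) x)"
  unfolding shear_def case_prod_beta
  by (cases "fst x = snd x"; cases "fst x \<notin> I \<and> snd x \<in> I")
     (simp_all only: if_True if_False polyfun.const polyfun_minus assms simp_thms)

lemma lin_apply_shear:
  "lin_apply (shear I T) v r = (if r \<in> I then v r else v r - (\<Sum>i\<in>I. T (i, r) * v i))"
proof (cases "r \<in> I")
  case True
  then have "lin_apply (shear I T) v r = (\<Sum>j\<in>UNIV. if j = r then v j else 0)"
    unfolding lin_apply_def by (intro sum.cong) (auto simp: shear_def)
  then show ?thesis using True by simp
next
  case False
  then have "lin_apply (shear I T) v r =
      (\<Sum>j\<in>UNIV. (if j = r then v j else 0) - (if j \<in> I then T (j, r) * v j else 0))"
    unfolding lin_apply_def by (intro sum.cong) (auto simp: shear_def)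
  also have "\<dots> = v r - (\<Sum>j\<in>UNIV. if j \<in> I then T (j, r) * v j else 0)"
    by (simp add: sum_subtractf)
  finally show ?thesis using False by (simp add: sum.If_cases)
qed

lemma lin_apply_shear_inverse:
  "lin_apply (shear I (\<lambda>x. - T x)) (lin_apply (shear I T) v) = v"
  "lin_apply (shear I T) (lin_apply (shear I (\<lambda>x. - T x)) v) = v"
  by (simp_all add: fun_eq_iff lin_apply_shear sum_negf)

lemma graph_plane_iff_shear: "v \<in> graph_plane I T \<longleftrightarrow> (\<forall>r. r \<notin> I \<longrightarrow> lin_apply (shear I T) (($) v) r = 0)"
  by (auto simp: graph_plane_def lin_apply_shear)

lemma pullback_shear_inverse:
  assumes "i \<in> coords d UNIV"
  shows "pullback d (shear I T) (pullback d (shear I (\<lambda>x. - T x)) y) i = y i"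
    "pullback d (shear I (\<lambda>x. - T x)) (pullback d (shear I T) y) i = y i"
proof -
  have "\<forall>i\<in>coords d UNIV. pullback d (shear I T) (pullback d (shear I (\<lambda>x. - T x)) y) i = y i"
    "\<forall>i\<in>coords d UNIV. pullback d (shear I (\<lambda>x. - T x)) (pullback d (shear I T) y) i = y i"
    unfolding form_eval_eq_iff[symmetric] by (simp_all add: form_eval_pullback lin_apply_shear_inverse)
  then show "pullback d (shear I T) (pullback d (shear I (\<lambda>x. - T x)) y) i = y i"
    "pullback d (shear I (\<lambda>x. - T x)) (pullback d (shear I T) y) i = y i" using assms by simp_all
qed

text \<open>The shear by \<open>-T\<close> carries the coordinate subspace of \<open>I\<close> onto the graph of \<open>T\<close>.\<close>

lemma forms_vanish_on_graph_plane_iff: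
  "forms_vanish d y (graph_plane I T) \<longleftrightarrow>
     (\<forall>i\<in>coords d I. pullback d (shear I (\<lambda>x. - T x)) y i = 0)"
  unfolding form_vanishes_on_coordinates_iff[symmetric] form_eval_pullback
proof (intro iffI allI impI ballI)
  fix a and v :: "'a \<Rightarrow> complex"
  assume *: "forms_vanish d y (graph_plane I T)" "a < length d"
    "\<forall>i. i \<notin> I \<longrightarrow> v i = 0"
  let ?w = "\<chi> i. lin_apply (shear I (\<lambda>x. - T x)) v i"
  have w: "($) ?w = lin_apply (shear I (\<lambda>x. - T x)) v" by (simp add: fun_eq_iff)
  have "?w \<in> graph_plane I T" unfolding graph_plane_iff_shear w lin_apply_shear_inverse using *(3) by simp
  then have "form_eval d y a (($) ?w) = 0" using *(1,2) by (elim allE[of _ a] impE ballE[of _ _ ?w]) simp_all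
  then show "form_eval d y a (lin_apply (shear I (\<lambda>x. - T x)) v) = 0" by (simp only: w)
next
  fix a and v :: "complex ^ 'a"
  assume *: "\<forall>a<length d. \<forall>v. (\<forall>i. i \<notin> I \<longrightarrow> v i = 0) \<longrightarrow>
      form_eval d y a (lin_apply (shear I (\<lambda>x. - T x)) v) = 0" "a < length d" "v \<in> graph_plane I T"
  have "form_eval d y a (lin_apply (shear I (\<lambda>x. - T x)) (lin_apply (shear I T) (($) v))) = 0"
    by (rule *(1)[rule_format, OF *(2)]) (use *(3) in \<open>simp add: graph_plane_iff_shear\<close>)
  then show "form_eval d y a (($) v) = 0" by (simp only: lin_apply_shear_inverse)
qed

section \<open>Negative expected dimension\<close>

text \<open>
  With \<open>p = card (I \<inter> K)\<close> the left side counts the free entries of \<open>T\<close>, and the right side the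
  monomials in the variables \<open>I\<close> that are not in the variables \<open>K\<close>. The inequality says that the
  excess is smaller at \<open>c\<close> than at \<open>p\<close>: it is 0 at 0, negative at \<open>c\<close>, and above the chord in
  between.
\<close>

lemma plane_parameters_lt:
  assumes "\<forall>e\<in>set d. e \<ge> 2" "d \<noteq> []" "d \<noteq> [2]" "p < c" "c * N < coords_count d c"
  shows "int c * int N - int p * (int N - (int c - int p)) < int (coords_count d c) - int (coords_count d p)"
proof (rule ccontr)
  define f where "f r = int r * int N - int r * (int c - int r) - int (coords_count d r)" for r
  assume "\<not> ?thesis"
  then have le: "f p \<le> f c" by (simp add: f_def algebra_simps)
  have neg: "f c < 0" using assms(5) unfolding f_def by (simp flip: of_nat_mult)
  have "int p * f c \<le> int c * f p"
    using excess_chord[OF assms(1-3), of p c N] assms(4) by (simp add: f_def)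
  also have "\<dots> \<le> int c * f c" using le by (rule mult_left_mono) simp
  finally have "(int c - int p) * f c \<ge> 0" by (simp add: algebra_simps)
  then show False using neg assms(4) by (simp add: zero_le_mult_iff)
qed

text \<open>
  A form that vanishes on the graph of \<open>T\<close> over \<open>I\<close> and on the coordinate plane of \<open>K\<close> is the
  image under a shear of a form without monomials in the coordinates \<open>I\<close> or in the coordinates
  \<open>K\<close>. The entries of \<open>T\<close> that are zero because the graph is in echelon form make the shear
  preserve the plane of \<open>K\<close> and leave fewer parameters than there are coefficients.
\<close>

lemma forms_with_plane_in_chart_not_dense:
  fixes I K :: "'n::finite set"
  assumes deg: "\<forall>e\<in>set d. e \<ge> 2" "d \<noteq> []" "d \<noteq> [2]"
    and cards: "card K = c" "card I = c" "I \<noteq> K"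
    and neg: "c * (CARD('n) - c) < coords_count d c"
  obtains P where "polyfun (coords d UNIV - coords d K) P" "\<exists>y. P y \<noteq> 0"
    "\<And>y T. (\<And>i. i \<in> coords d K \<Longrightarrow> y i = 0) \<Longrightarrow>
       (\<And>i r. i \<in> I \<Longrightarrow> i \<in> K \<Longrightarrow> r \<notin> I \<Longrightarrow> r \<notin> K \<Longrightarrow> T (i, r) = 0) \<Longrightarrow>
       forms_vanish d y (graph_plane I T) \<Longrightarrow> P y = 0"
proof -
  define Y where "Y = coords d UNIV - coords d K"
  define Y0 where "Y0 = Y - coords d I"
  define entries where "entries = I \<times> (- I) - (I \<inter> K) \<times> (- (I \<union> K))"
  define X where "X = entries <+> Y0"
  define p where "p = card (I \<inter> K)"
  define G where "G z = shear I (\<lambda>x. if x \<in> entries then z (Inl x) else 0)" for z :: "('n \<times> 'n) + (nat \<times> 'n monomial) \<Rightarrow> complex"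
  define f0 where "f0 z i = (if i \<in> Y0 then z (Inr i) else 0)" for z :: "('n \<times> 'n) + (nat \<times> 'n monomial) \<Rightarrow> complex" and i
  have fin: "finite Y" "finite Y0" "finite X"
    by (simp_all add: Y_def Y0_def X_def finite_coords)
  have pc: "p < c"
  proof -
    have "I \<inter> K \<noteq> I"
    proof
      assume "I \<inter> K = I"
      then have "I \<subseteq> K" by blast
      then show False using card_subset_eq[of K I] cards by simp
    qed
    then show ?thesis unfolding p_def cards(2)[symmetric] by (intro psubset_card_mono) auto
  qed
  have cN: "c \<le> CARD('n)" using cards(1) card_mono[of UNIV K] by simp
  have "card X < card Y"
  proof -
    have "card (I \<union> K) + p = 2 * c" using card_Un_Int[of I K] cards by (simp add: p_def)
    moreover have "card (I \<union> K) \<le> CARD('n)" by (intro card_mono) auto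
    moreover have "card (- (I \<union> K)) = CARD('n) - card (I \<union> K)" by (simp add: Compl_eq_Diff_UNIV card_Diff_subset)
    ultimately have out: "int (card (- (I \<union> K))) = int (CARD('n) - c) - (int c - int p)" using cN pc by simp
    have "card (- I) = CARD('n) - c" using cards by (simp add: Compl_eq_Diff_UNIV card_Diff_subset)
    moreover have "(I \<inter> K) \<times> (- (I \<union> K)) \<subseteq> I \<times> (- I)" by auto
    then have "card entries + card ((I \<inter> K) \<times> (- (I \<union> K))) = card (I \<times> (- I))"
      unfolding entries_def by (metis card_Diff_subset card_mono finite finite_subset le_add_diff_inverse2)
    ultimately have card_entries: "int (card entries) = int c * int (CARD('n) - c) - int p * (int (CARD('n) - c) - (int c - int p))"
      using out cards(2) unfolding card_cartesian_product p_def[symmetric]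
      by (metis add_diff_cancel_right' of_nat_add of_nat_mult)
    have "Y = Y0 \<union> (coords d I - coords d K)" "Y0 \<inter> (coords d I - coords d K) = {}"
      using coords_mono[of I UNIV d] by (auto simp: Y_def Y0_def)
    then have "card Y = card Y0 + card (coords d I - coords d K)"
      using fin by (metis card_Un_disjoint finite_Un)
    moreover have "card (coords d I - coords d K) + coords_count d p = coords_count d c"
    proof -
      have "coords d I - coords d K = coords d I - coords d (I \<inter> K)" unfolding coords_Int[symmetric] by blast
      moreover have "coords d (I \<inter> K) \<subseteq> coords d I" by (rule coords_mono) simp
      ultimately have "card (coords d I - coords d K) + card (coords d (I \<inter> K)) = card (coords d I)"
        by (metis card_Diff_subset card_mono finite finite_coords finite_subset le_add_diff_inverse2)
      then show ?thesis by (simp add: card_coords cards p_def)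
    qed
    moreover have "card X = card entries + card Y0" unfolding X_def using fin by (simp add: card_Plus)
    ultimately show ?thesis using plane_parameters_lt[OF deg pc neg] card_entries by linarith
  qed
  moreover have "polyfun X (\<lambda>z. pullback d (G z) (f0 z) i)" for i
  proof (rule polyfun_pullback)
    show "polyfun X (\<lambda>z. G z x)" for x
      unfolding G_def
    proof (rule polyfun_shear)
      show "polyfun X (\<lambda>z. if x \<in> entries then z (Inl x) else 0)" for x
        by (cases "x \<in> entries") (auto simp: X_def intro: polyfun.intros)
    qed
    show "polyfun X (\<lambda>z. f0 z i)" for i
      unfolding f0_def by (cases "i \<in> Y0") (auto simp: X_def intro: polyfun.intros)
  qed
  ultimately obtain P where P: "polyfun Y P" "\<exists>y. P y \<noteq> 0"
    "\<And>z y. (1::complex) \<noteq> 0 \<Longrightarrow> (\<And>i. i \<in> Y \<Longrightarrow> 1 * y i = pullback d (G z) (f0 z) i) \<Longrightarrow> P y = 0"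
    by (rule algebraic_dependence[OF fin(3,1) _ _ polyfun.const, of "\<lambda>i z. pullback d (G z) (f0 z) i" 1])
       (rule that, assumption, assumption, blast)
  have "P y = 0"
    if y: "\<And>i. i \<in> coords d K \<Longrightarrow> y i = 0"
      and T: "\<And>i r. i \<in> I \<Longrightarrow> i \<in> K \<Longrightarrow> r \<notin> I \<Longrightarrow> r \<notin> K \<Longrightarrow> T (i, r) = 0"
      and van: "forms_vanish d y (graph_plane I T)" for y T
  proof -
    define y0 where "y0 = pullback d (shear I (\<lambda>x. - T x)) y"
    have y0I: "\<forall>i\<in>coords d I. y0 i = 0"
      using van unfolding forms_vanish_on_graph_plane_iff y0_def .
    have y0K: "\<forall>i\<in>coords d K. y0 i = 0"
      unfolding form_vanishes_on_coordinates_iff[symmetric] y0_def form_eval_pullback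
    proof (intro allI impI)
      fix a and v :: "'n \<Rightarrow> complex" assume a: "a < length d" and v: "\<forall>i. i \<notin> K \<longrightarrow> v i = 0"
      have "lin_apply (shear I (\<lambda>x. - T x)) v r = 0" if r: "r \<notin> K" for r
      proof (cases "r \<in> I")
        case False
        then have "(\<Sum>i\<in>I. - T (i, r) * v i) = 0" using T r v by (intro sum.neutral) (metis minus_zero mult_eq_0_iff)
        then show ?thesis using v r False by (simp add: lin_apply_shear)
      qed (use v r in \<open>simp add: lin_apply_shear\<close>)
      then show "form_eval d y a (lin_apply (shear I (\<lambda>x. - T x)) v) = 0"
        using y a form_vanishes_on_coordinates_iff[of d K y] by blast
    qed
    define z where "z = case_sum T y0"
    have Gz: "G z = shear I T"
      unfolding G_def shear_def z_def using T by (auto simp: fun_eq_iff entries_def)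
    have "pullback d (G z) (f0 z) i = y i" if i: "i \<in> Y" for i
    proof -
      have iU: "i \<in> coords d UNIV" using i by (simp add: Y_def)
      have "pullback d (G z) (f0 z) i = pullback d (shear I T) y0 i"
        unfolding Gz by (rule pullback_cong[OF iU]) (use y0I y0K in \<open>auto simp: f0_def z_def Y0_def Y_def\<close>)
      also have "\<dots> = y i" unfolding y0_def by (rule pullback_shear_inverse(1)[OF iU])
      finally show ?thesis .
    qed
    then show ?thesis using P(3)[of y z] by simp
  qed
  then show ?thesis using that[of P] P(1,2) unfolding Y_def by blast
qed

lemma generic_form_without_other_planes:
  fixes K :: "'n::finite set"
  assumes deg: "\<forall>e\<in>set d. e \<ge> 2" "d \<noteq> []" "d \<noteq> [2]"
    and K: "card K = c"
    and neg: "c * (CARD('n) - c) < coords_count d c"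
  obtains P where "polyfun (coords d UNIV - coords d K) P" "\<exists>y. P y \<noteq> 0"
    "\<And>y W. (\<And>i. i \<in> coords d K \<Longrightarrow> y i = 0) \<Longrightarrow> vec.subspace W \<Longrightarrow> vec.dim W = c \<Longrightarrow>
       forms_vanish d y W \<Longrightarrow> P y \<noteq> 0 \<Longrightarrow> W = coordinate_plane K"
proof -
  define Is where "Is = {I :: 'n set. card I = c \<and> I \<noteq> K}"
  define bad where "bad I P \<longleftrightarrow> (\<forall>y T. (\<forall>i\<in>coords d K. y i = 0) \<longrightarrow>
       (\<forall>i r. i \<in> I \<longrightarrow> i \<in> K \<longrightarrow> r \<notin> I \<longrightarrow> r \<notin> K \<longrightarrow> T (i, r) = 0) \<longrightarrow>
       forms_vanish d y (graph_plane I T) \<longrightarrow> P y = 0)"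
    for I :: "'n set" and P :: "(nat \<times> 'n monomial \<Rightarrow> complex) \<Rightarrow> complex"
  have "\<exists>P. polyfun (coords d UNIV - coords d K) P \<and> (\<exists>y. P y \<noteq> 0) \<and> bad I P" if "I \<in> Is" for I
  proof -
    have I: "card I = c" "I \<noteq> K" using that by (auto simp: Is_def)
    obtain P where P: "polyfun (coords d UNIV - coords d K) P" "\<exists>y. P y \<noteq> 0"
      "\<And>y T. (\<And>i. i \<in> coords d K \<Longrightarrow> y i = 0) \<Longrightarrow>
       (\<And>i r. i \<in> I \<Longrightarrow> i \<in> K \<Longrightarrow> r \<notin> I \<Longrightarrow> r \<notin> K \<Longrightarrow> T (i, r) = 0) \<Longrightarrow>
       forms_vanish d y (graph_plane I T) \<Longrightarrow> P y = 0"
      using forms_with_plane_in_chart_not_dense[OF deg K I neg] by blast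
    have "bad I P" unfolding bad_def
    proof (intro allI impI)
      fix y T
      assume *: "\<forall>i\<in>coords d K. y i = 0" "\<forall>i r. i \<in> I \<longrightarrow> i \<in> K \<longrightarrow> r \<notin> I \<longrightarrow> r \<notin> K \<longrightarrow> T (i, r) = 0"
        "forms_vanish d y (graph_plane I T)"
      show "P y = 0" by (rule P(3)[OF _ _ *(3)]) (use *(1,2) in blast)+
    qed
    then show ?thesis using P(1,2) by blast
  qed
  then obtain PI where PI: "\<And>I. I \<in> Is \<Longrightarrow> polyfun (coords d UNIV - coords d K) (PI I)"
    "\<And>I. I \<in> Is \<Longrightarrow> \<exists>y. PI I y \<noteq> 0" "\<And>I. I \<in> Is \<Longrightarrow> bad I (PI I)" by metis
  define P where "P y = (\<Prod>I\<in>Is. PI I y)" for y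
  have "polyfun (coords d UNIV - coords d K) P" unfolding P_def using PI(1) by (intro polyfun_prod)
  moreover have "\<exists>y. P y \<noteq> 0" unfolding P_def
    by (rule polyfun_prod_nonzero[OF _ PI(1) PI(2)]) simp
  moreover have "W = coordinate_plane K"
    if y: "\<And>i. i \<in> coords d K \<Longrightarrow> y i = 0" and W: "vec.subspace W" "vec.dim W = c"
      and van: "forms_vanish d y W" and Py: "P y \<noteq> 0" for y W
  proof -
    obtain I T where IT: "W = graph_plane I T"
      "\<And>i r. i \<in> I \<Longrightarrow> i \<in> K \<Longrightarrow> r \<notin> I \<Longrightarrow> r \<notin> K \<Longrightarrow> T (i, r) = 0"
      using subspace_echelon_form[OF W(1)] by blast
    have "card I = c" using W(2) unfolding IT(1) dim_graph_plane .
    show ?thesis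
    proof (cases "I = K")
      case True
      then show ?thesis using IT(2) unfolding IT(1) graph_plane_def by simp
    next
      case False
      then have I: "I \<in> Is" using \<open>card I = c\<close> by (simp add: Is_def)
      have "PI I y = 0"
        using PI(3)[OF I] y van IT(2) unfolding bad_def IT(1) by blast
      then show ?thesis using Py I by (auto simp: P_def)
    qed
  qed
  ultimately show ?thesis using that[of P] by blast
qed

section \<open>Generic multiplication by linear forms\<close>

text \<open>
  Multiplication by the variable \<open>i\<close> acts on the coefficients as a translation of the index; its
  arguments are tuples of forms of the lowered degrees.
\<close>

abbreviation lower :: "nat list \<Rightarrow> nat list" where
  "lower d \<equiv> map (\<lambda>e. e - 1) d"

abbreviation times_var :: "'x \<Rightarrow> nat \<times> 'x monomial \<Rightarrow> nat \<times> 'x monomial" where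
  "times_var i e \<equiv> (fst e, snd e + Poly_Mapping.single i 1)"

lemma times_var_coords:
  assumes "\<forall>e\<in>set d. e \<ge> 2" "e \<in> coords (lower d) A" "i \<in> A"
  shows "times_var i e \<in> coords d A"
proof -
  obtain a \<nu> where e: "e = (a, \<nu>)" "a < length d" "Poly_Mapping.keys \<nu> \<subseteq> A" "total_degree \<nu> = d ! a - 1"
    using assms(2) by (auto simp: coords_def monomials_def)
  have "d ! a \<ge> 2" using assms(1) e(2) by simp
  then show ?thesis using e assms(3) keys_add[of \<nu> "Poly_Mapping.single i (1::nat)"]
    by (auto simp: coords_def monomials_def total_degree_add)
qed

lemma coords_divide_var:
  assumes "x \<in> coords d A" "i \<in> Poly_Mapping.keys (snd x)"
  obtains e where "e \<in> coords (lower d) A" "x = times_var i e"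
proof -
  obtain a \<mu> where x: "x = (a, \<mu>)" "a < length d" "Poly_Mapping.keys \<mu> \<subseteq> A" "total_degree \<mu> = d ! a"
    using assms(1) by (auto simp: coords_def monomials_def)
  let ?\<nu> = "\<mu> - Poly_Mapping.single i 1"
  have \<mu>: "\<mu> = ?\<nu> + Poly_Mapping.single i 1"
    using assms(2) x(1)
    by (intro poly_mapping_eqI) (auto simp: lookup_add lookup_minus lookup_single when_def in_keys_iff)
  have "total_degree \<mu> = total_degree ?\<nu> + 1" by (subst \<mu>) (simp add: total_degree_add)
  moreover have "Poly_Mapping.keys ?\<nu> \<subseteq> Poly_Mapping.keys \<mu>"
    by (auto simp: in_keys_iff lookup_minus)
  ultimately have "(a, ?\<nu>) \<in> coords (lower d) A" using x by (auto simp: coords_def monomials_def)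
  then show ?thesis using that[of "(a, ?\<nu>)"] \<mu> x(1) by simp
qed

text \<open>
  To \<open>\<alpha>\<close> a factor \<open>x_i\<close> with \<open>i\<close> outside \<open>J\<close> looks like \<open>\<Sum>j\<in>J. T (i, j) x_j\<close>, so \<open>\<alpha>\<close> factors through
  the forms in the variables \<open>J\<close>.
\<close>

definition factors_through :: "nat list \<Rightarrow> 'x set \<Rightarrow> 'x set \<Rightarrow> ('x \<times> 'x \<Rightarrow> complex)
    \<Rightarrow> (nat \<times> 'x monomial \<Rightarrow> complex) \<Rightarrow> bool" where
  "factors_through d I J T \<alpha> \<longleftrightarrow>
     (\<forall>i\<in>I - J. \<forall>e\<in>coords (lower d) I. \<alpha> (times_var i e) = (\<Sum>j\<in>J. T (i, j) * \<alpha> (times_var j e)))"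

text \<open>
  \<open>Z\<close> computes \<open>\<alpha> x\<close> from \<open>T\<close> and the values of \<open>\<alpha>\<close> on the monomials in the variables \<open>J\<close>. The condition
  at zero ensures that these values are not all zero unless \<open>\<alpha>\<close> is.
\<close>

definition represents :: "nat list \<Rightarrow> 'x set \<Rightarrow> 'x set
    \<Rightarrow> (('x \<times> 'x + nat \<times> 'x monomial \<Rightarrow> complex) \<Rightarrow> complex) \<Rightarrow> nat \<times> 'x monomial \<Rightarrow> bool" where
  "represents d I J Z x \<longleftrightarrow> polyfun (((I - J) \<times> J) <+> coords d J) Z \<and> (\<forall>T. Z (case_sum T (\<lambda>_. 0)) = 0) \<and>
     (\<forall>\<alpha> T. factors_through d I J T \<alpha> \<longrightarrow> \<alpha> x = Z (case_sum T \<alpha>))"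

text \<open>
  The factors of a monomial outside \<open>J\<close> are replaced one at a time; the induction is on their
  number.
\<close>

lemma functional_from_few_variables:
  assumes "finite I" "J \<subseteq> I" "x \<in> coords d I"
  shows "\<exists>Z. represents d I J Z x"
  using assms(3)
proof (induction "\<Sum>i\<in>I - J. Poly_Mapping.lookup (snd x) i" arbitrary: x rule: less_induct)
  case less
  let ?V = "((I - J) \<times> J) <+> coords d J"
  show ?case
  proof (cases "x \<in> coords d J")
    case True
    then show ?thesis unfolding represents_def
      by (intro exI[of _ "\<lambda>z. z (Inr x)"]) (auto intro: polyfun.var)
  next
    case False
    then have "\<not> Poly_Mapping.keys (snd x) \<subseteq> J" "Poly_Mapping.keys (snd x) \<subseteq> I"
      using less.prems by (auto simp: coords_def monomials_def)
    then obtain i where i: "i \<in> Poly_Mapping.keys (snd x)" "i \<in> I - J" by blast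
    obtain e where e: "e \<in> coords (lower d) I" "x = times_var i e"
      using coords_divide_var[OF less.prems i(1)] by blast
    have "\<forall>j\<in>J. \<exists>Z. represents d I J Z (times_var j e)"
    proof
      fix j assume j: "j \<in> J"
      have "(\<Sum>i\<in>I - J. Poly_Mapping.lookup (snd (times_var j e)) i) = (\<Sum>i\<in>I - J. Poly_Mapping.lookup (snd e) i)"
        using j by (intro sum.cong) (auto simp: lookup_add lookup_single when_def)
      also have "\<dots> < (\<Sum>i\<in>I - J. Poly_Mapping.lookup (snd x) i)"
        using i(2) assms(1) by (intro sum_strict_mono_ex1) (auto simp: e(2) lookup_add lookup_single when_def)
      finally have lt: "(\<Sum>i\<in>I - J. Poly_Mapping.lookup (snd (times_var j e)) i) < (\<Sum>i\<in>I - J. Poly_Mapping.lookup (snd x) i)" .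
      have "times_var j e \<in> coords d I"
      proof -
        have "total_degree (snd x) = total_degree (snd (times_var j e))" unfolding e(2) by (simp add: total_degree_add)
        moreover have "Poly_Mapping.keys (snd (times_var j e)) \<subseteq> I"
        proof -
          have "Poly_Mapping.keys (snd e) \<subseteq> I" using e(1) by (auto simp: coords_def monomials_def)
          then show ?thesis using keys_add[of "snd e" "Poly_Mapping.single j (1::nat)"] j assms(2) by auto
        qed
        ultimately show ?thesis using less.prems e(2) by (auto simp: coords_def monomials_def)
      qed
      then show "\<exists>Z. represents d I J Z (times_var j e)"
        by (rule less.hyps[OF lt])
    qed
    then obtain Z where rep: "\<And>j. j \<in> J \<Longrightarrow> represents d I J (Z j) (times_var j e)" by metis
    then have Z: "\<And>j. j \<in> J \<Longrightarrow> polyfun ?V (Z j)" "\<And>j T. j \<in> J \<Longrightarrow> Z j (case_sum T (\<lambda>_. 0)) = 0"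
      "\<And>j \<alpha> T. j \<in> J \<Longrightarrow> factors_through d I J T \<alpha> \<Longrightarrow> \<alpha> (times_var j e) = Z j (case_sum T \<alpha>)"
      unfolding represents_def by simp_all
    show ?thesis
      unfolding represents_def
    proof (intro exI[of _ "\<lambda>z. \<Sum>j\<in>J. z (Inl (i, j)) * Z j z"] conjI allI impI)
      show "polyfun ?V (\<lambda>z. \<Sum>j\<in>J. z (Inl (i, j)) * Z j z)"
        using i(2) by (intro polyfun_sum polyfun.mult Z(1) polyfun.var) auto
      show "(\<Sum>j\<in>J. case_sum T (\<lambda>_. 0) (Inl (i, j)) * Z j (case_sum T (\<lambda>_. 0))) = 0" for T
        by (simp add: Z(2))
      fix \<alpha> T
      assume rel: "factors_through d I J T \<alpha>"
      have "\<alpha> x = (\<Sum>j\<in>J. T (i, j) * \<alpha> (times_var j e))" using rel i(2) e unfolding factors_through_def by simp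
      also have "\<dots> = (\<Sum>j\<in>J. T (i, j) * Z j (case_sum T \<alpha>))" by (intro sum.cong refl) (simp add: Z(3)[OF _ rel] del: One_nat_def)
      finally show "\<alpha> x = (\<Sum>j\<in>J. case_sum T \<alpha> (Inl (i, j)) * Z j (case_sum T \<alpha>))" by simp
    qed
  qed
qed

text \<open>
  The tuples \<open>g\<close> annihilated by some functional of rank \<open>card J\<close>: the parameters are the matrix
  \<open>T\<close>, the values of \<open>\<alpha>\<close> on the monomials in the variables \<open>J\<close>, one of them scaled to 1, and
  the coordinates of \<open>g\<close> outside \<open>B\<close>. The other coordinates of \<open>g\<close> are recovered by solving
  linear equations, with denominator \<open>q\<close>.
\<close>

lemma annihilated_tuples_not_dense:
  fixes I :: "'n set" and R :: "'r set"
  assumes fin: "finite I" "finite R" and deg: "\<forall>e\<in>set d. e \<ge> 2"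
    and J: "J \<subseteq> I" and x0: "x0 \<in> coords d J"
    and B: "B \<subseteq> coords (lower d) I" "card J \<le> card B"
    and num: "card J * (card I - card J) + coords_count d (card J) \<le> card R * card J"
    and q: "polyfun (J \<times> B) q" "\<And>b j. b \<in> B \<Longrightarrow> j \<in> J \<Longrightarrow> polyfun (J \<times> B) (p b j)"
      "\<And>M z b. b \<in> B \<Longrightarrow> q M * z b = (\<Sum>j\<in>J. p b j M * (\<Sum>b'\<in>B. M (j, b') * z b'))"
  obtains P where "polyfun (R \<times> coords (lower d) I) P" "\<exists>g. P g \<noteq> 0"
    "\<And>g \<alpha> T. \<alpha> x0 = 1 \<Longrightarrow>
       factors_through d I J T \<alpha> \<Longrightarrow>
       q (\<lambda>(j, b). \<alpha> (times_var j b)) \<noteq> 0 \<Longrightarrow>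
       (\<forall>i\<in>I. \<forall>r\<in>R. (\<Sum>e\<in>coords (lower d) I. \<alpha> (times_var i e) * g (r, e)) = 0) \<Longrightarrow> P g = 0"
proof -
  define E where "E = coords (lower d) I"
  define C where "C = ((I - J) \<times> J) <+> (coords d J - {x0})"
  define X where "X = C <+> R \<times> (E - B)"
  have finE: "finite E" unfolding E_def using fin(1) by (rule finite_coords)
  have finJ: "finite J" using J fin(1) finite_subset by blast
  have finB: "finite B" using B(1) finE finite_subset unfolding E_def by blast
  have finC: "finite C" unfolding C_def using fin(1) finJ by (auto simp: finite_coords)
  have finX: "finite X" unfolding X_def using finC fin(2) finE by auto
  have card: "card X < card (R \<times> E)"
  proof -
    have "card (I - J) = card I - card J" using J finJ by (rule card_Diff_subset[rotated])
    moreover have "card (coords d J - {x0}) = coords_count d (card J) - 1"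
      using x0 finJ by (simp add: card_coords finite_coords)
    ultimately have "card C = (card I - card J) * card J + (coords_count d (card J) - 1)"
      unfolding C_def using fin(1) finJ by (simp add: card_Plus finite_coords card_cartesian_product)
    moreover have "coords_count d (card J) > 0"
      using x0 finJ by (metis card_coords card_gt_0_iff empty_iff finite_coords)
    ultimately have "card C < card R * card J" using num by (simp add: mult.commute)
    also have "\<dots> \<le> card R * card B" using B(2) by simp
    finally have "card C < card R * card B" .
    moreover have "card (E - B) + card B = card E"
      using B(1) finB finE by (metis E_def card_Diff_subset card_mono le_add_diff_inverse2)
    then have "card R * card (E - B) + card R * card B = card R * card E" by (metis distrib_left)
    moreover have "card X = card C + card R * card (E - B)"
      unfolding X_def using finC fin(2) finE by (simp add: card_Plus card_cartesian_product)
    ultimately show ?thesis by (simp add: card_cartesian_product)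
  qed
  have "\<forall>x\<in>coords d I. \<exists>Z. represents d I J Z x"
    using functional_from_few_variables[OF fin(1) J] by blast
  then obtain Z where rep: "\<And>x. x \<in> coords d I \<Longrightarrow> represents d I J (Z x) x" by metis
  then have Z: "\<And>x. x \<in> coords d I \<Longrightarrow> polyfun (((I - J) \<times> J) <+> coords d J) (Z x)"
    "\<And>x \<alpha> T. x \<in> coords d I \<Longrightarrow> factors_through d I J T \<alpha> \<Longrightarrow> \<alpha> x = Z x (case_sum T \<alpha>)"
    unfolding represents_def by simp_all
  \<comment> \<open>\<open>A x\<close> is the value of \<open>\<alpha>\<close> at \<open>x\<close> in terms of the parameters, \<open>M\<close> the matrix of the functionals
    \<open>\<alpha>(x_j \<cdot>)\<close> at the coordinates \<open>B\<close>, and \<open>h\<close> is \<open>q\<close> times the tuple \<open>g\<close>\<close>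
  define A where "A x z = Z x (\<lambda>v. if v = Inr x0 then 1 else z (Inl v))"
    for x and z :: "('n \<times> 'n + nat \<times> 'n monomial) + 'r \<times> (nat \<times> 'n monomial) \<Rightarrow> complex"
  define M where "M z = (\<lambda>(j, b). A (times_var j b) z)" for z
  define h where "h y z = (if snd y \<in> B then - (\<Sum>j\<in>J. p (snd y) j (M z) * (\<Sum>e\<in>E - B. A (times_var j e) z * z (Inr (fst y, e))))
      else q (M z) * z (Inr y))" for y z
  have Apoly: "polyfun X (A x)" if "x \<in> coords d I" for x
    unfolding A_def
  proof (rule polyfun_compose[OF Z(1)[OF that], of _ "\<lambda>v z. if v = Inr x0 then 1 else z (Inl v)"])
    show "polyfun X (\<lambda>z. if v = Inr x0 then 1 else z (Inl v))" if "v \<in> ((I - J) \<times> J) <+> coords d J" for v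
      using that by (cases "v = Inr x0") (auto simp: X_def C_def intro: polyfun.intros)
  qed
  have tv: "times_var j e \<in> coords d I" if "j \<in> J" "e \<in> E" for j e
    using times_var_coords[OF deg, of e I j] subsetD[OF J that(1)] that(2) unfolding E_def by simp
  have Mpoly: "polyfun X (\<lambda>z. f (M z))" if "polyfun (J \<times> B) f" for f
  proof -
    have "polyfun X (\<lambda>z. f (\<lambda>v. M z v))"
    proof (rule polyfun_compose[OF that])
      fix v assume "v \<in> J \<times> B"
      then show "polyfun X (\<lambda>z. M z v)" using B(1) unfolding M_def case_prod_beta
        by (intro Apoly tv) (auto simp: E_def)
    qed
    then show ?thesis by simp
  qed
  have hpoly: "polyfun X (h y)" if y: "y \<in> R \<times> E" for y
  proof (cases "snd y \<in> B")
    case True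
    have *: "polyfun X (\<lambda>z. p (snd y) j (M z))" if "j \<in> J" for j
      by (rule Mpoly[OF q(2)[OF True that]])
    have **: "polyfun X (\<lambda>z. A (times_var j e) z * z (Inr (fst y, e)))" if "j \<in> J" "e \<in> E - B" for j e
    proof (intro polyfun.mult polyfun.var)
      show "polyfun X (A (times_var j e))" using that by (intro Apoly tv) auto
      show "Inr (fst y, e) \<in> X" using y that(2) by (auto simp: X_def)
    qed
    have "polyfun X (\<lambda>z. - (\<Sum>j\<in>J. p (snd y) j (M z) *
        (\<Sum>e\<in>E - B. A (times_var j e) z * z (Inr (fst y, e)))))"
      by (rule polyfun_minus, rule polyfun_sum, rule polyfun.mult, erule *, rule polyfun_sum, rule **)
    then show ?thesis using True by (simp only: h_def[abs_def] if_True)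
  next
    case False
    have "polyfun X (\<lambda>z. q (M z) * z (Inr y))"
      by (rule polyfun.mult[OF Mpoly[OF q(1)] polyfun.var]) (use y False in \<open>auto simp: X_def\<close>)
    then show ?thesis using False by (simp only: h_def[abs_def] if_False)
  qed
  have finRE: "finite (R \<times> E)" using fin(2) finE by simp
  obtain P where P: "polyfun (R \<times> E) P" "\<exists>g. P g \<noteq> 0"
    "\<And>z g. q (M z) \<noteq> 0 \<Longrightarrow> (\<And>y. y \<in> R \<times> E \<Longrightarrow> q (M z) * g y = h y z) \<Longrightarrow> P g = 0"
    by (rule algebraic_dependence[of X "R \<times> E" h "\<lambda>z. q (M z)", OF finX finRE card hpoly Mpoly[OF q(1)]])
       (assumption, rule that, assumption, assumption, blast)
  have "P g = 0"
    if \<alpha>0: "\<alpha> x0 = 1"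
      and rel: "factors_through d I J T \<alpha>"
      and qM: "q (\<lambda>(j, b). \<alpha> (times_var j b)) \<noteq> 0"
      and ann: "\<forall>i\<in>I. \<forall>r\<in>R. (\<Sum>e\<in>coords (lower d) I. \<alpha> (times_var i e) * g (r, e)) = 0" for g \<alpha> T
  proof -
    define z where "z = case_sum (case_sum T \<alpha>) g"
    have A: "A x z = \<alpha> x" if x: "x \<in> coords d I" for x
    proof -
      have "(\<lambda>v. if v = Inr x0 then 1 else z (Inl v)) = case_sum T \<alpha>"
        using \<alpha>0 by (auto simp: z_def fun_eq_iff split: sum.splits)
      then show ?thesis using Z(2)[OF x rel] by (simp add: A_def)
    qed
    have M: "M z (j, b) = \<alpha> (times_var j b)" if "j \<in> J" "b \<in> B" for j b
      using A tv that B(1) by (auto simp: M_def E_def)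
    have "q (M z) = q (\<lambda>(j, b). \<alpha> (times_var j b))"
      by (rule polyfun_cong[OF q(1)]) (use M in auto)
    then have nz: "q (M z) \<noteq> 0" using qM by simp
    have "q (M z) * g y = h y z" if y: "y \<in> R \<times> E" for y
    proof (cases "snd y \<in> B")
      case False
      then show ?thesis by (simp add: h_def z_def)
    next
      case True
      obtain r b where rb: "y = (r, b)" "r \<in> R" "b \<in> B" using y True by auto
      have "(\<Sum>b'\<in>B. M z (j, b') * g (r, b')) = - (\<Sum>e\<in>E - B. A (times_var j e) z * g (r, e))" if j: "j \<in> J" for j
      proof -
        have "(\<Sum>e\<in>E. \<alpha> (times_var j e) * g (r, e)) = 0" using ann rb(2) j J by (auto simp: E_def)
        moreover have "(\<Sum>e\<in>E. \<alpha> (times_var j e) * g (r, e)) =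
            (\<Sum>e\<in>E - B. \<alpha> (times_var j e) * g (r, e)) + (\<Sum>e\<in>B. \<alpha> (times_var j e) * g (r, e))"
          using B(1) finE by (intro sum.subset_diff) (auto simp: E_def)
        moreover have "(\<Sum>e\<in>E - B. \<alpha> (times_var j e) * g (r, e)) = (\<Sum>e\<in>E - B. A (times_var j e) z * g (r, e))"
          using j by (intro sum.cong refl) (simp add: A[OF tv] del: One_nat_def)
        moreover have "(\<Sum>e\<in>B. \<alpha> (times_var j e) * g (r, e)) = (\<Sum>e\<in>B. M z (j, e) * g (r, e))"
          using j by (intro sum.cong refl) (simp add: M del: One_nat_def)
        ultimately show ?thesis by (simp add: eq_neg_iff_add_eq_0 add.commute)
      qed
      then show ?thesis unfolding rb(1) q(3)[OF rb(3), of "M z" "\<lambda>b. g (r, b)"]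
        using rb(3) by (simp add: h_def z_def sum_negf)
    qed
    then show ?thesis using P(3)[OF nz] by blast
  qed
  then show ?thesis using that[of P] P(1,2) unfolding E_def by blast
qed

text \<open>
  Counting annihilators by rank: if \<open>g\<close> does not generate all forms, it is annihilated by a
  functional \<open>\<alpha>\<close>. The functionals \<open>\<alpha>(x_i \<cdot>)\<close> span a space of some dimension \<open>r\<close>, and \<open>J\<close>, \<open>B\<close> are
  the pivot rows and columns of their matrix.
\<close>

lemma generic_multiplication_spans:
  fixes I :: "'n set" and R :: "'r set"
  assumes fin: "finite I" "finite R" and deg: "\<forall>e\<in>set d. e \<ge> 2"
    and num: "\<And>r. 1 \<le> r \<Longrightarrow> r \<le> card I \<Longrightarrow> r * (card I - r) + coords_count d r \<le> card R * r"
  obtains g :: "'r \<times> nat \<times> 'n monomial \<Rightarrow> complex"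
  where "\<And>\<alpha>. (\<forall>i\<in>I. \<forall>r\<in>R. (\<Sum>e\<in>coords (lower d) I. \<alpha> (times_var i e) * g (r, e)) = 0) \<Longrightarrow>
     (\<forall>x\<in>coords d I. \<alpha> x = 0)"
proof -
  define E where "E = coords (lower d) I"
  have finE: "finite E" unfolding E_def using fin(1) by (rule finite_coords)
  define ann where "ann \<alpha> g \<longleftrightarrow> (\<forall>i\<in>I. \<forall>r\<in>R. (\<Sum>e\<in>E. \<alpha> (times_var i e) * g (r, e)) = 0)"
    for \<alpha> :: "nat \<times> 'n monomial \<Rightarrow> complex" and g :: "'r \<times> nat \<times> 'n monomial \<Rightarrow> complex"
  have "\<exists>F. left_inverse_family J B F" if "finite B" "finite J"
    for J :: "'n set" and B :: "(nat \<times> 'n monomial) set"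
    using polynomial_left_inverses[OF that] .
  then obtain \<F> where \<F>: "\<And>(B :: (nat \<times> 'n monomial) set) (J :: 'n set). finite B \<Longrightarrow> finite J \<Longrightarrow>
      left_inverse_family J B (\<F> B J)" by metis
  define S where "S = {(J, B, x0). J \<subseteq> I \<and> J \<noteq> {} \<and> B \<subseteq> E \<and> card J \<le> card B \<and> x0 \<in> coords d J}"
  define kills where "kills J x0 q P \<longleftrightarrow> (\<forall>g \<alpha> T. \<alpha> x0 = 1 \<longrightarrow> factors_through d I J T \<alpha> \<longrightarrow>
      q (\<lambda>(j, b). \<alpha> (times_var j b)) \<noteq> 0 \<longrightarrow> ann \<alpha> g \<longrightarrow> P g = 0)"
    for J x0 and q :: "('n \<times> nat \<times> 'n monomial \<Rightarrow> complex) \<Rightarrow> complex"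
      and P :: "('r \<times> nat \<times> 'n monomial \<Rightarrow> complex) \<Rightarrow> complex"
  have finJB: "finite J" "finite B" if "(J, B, x0) \<in> S" for J B x0
    using that fin(1) finE by (auto simp: S_def intro: finite_subset)
  have finS: "finite S"
  proof (rule finite_subset)
    show "S \<subseteq> Pow I \<times> Pow E \<times> coords d I" using coords_mono[of _ I d] by (auto simp: S_def)
    show "finite (Pow I \<times> Pow E \<times> coords d I)" using fin(1) finE by (simp add: finite_coords)
  qed
  define S' where "S' = (SIGMA s:S. (case s of (J, B, x0) \<Rightarrow> fst ` \<F> B J))"
  have finS': "finite S'"
    unfolding S'_def using finS finJB \<F> by (intro finite_SigmaI) (auto simp: left_inverse_family_def)
  define relation where "relation s P \<longleftrightarrow> polyfun (R \<times> E) P \<and> (\<exists>g. P g \<noteq> 0) \<and>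
      (case s of ((J, B :: (nat \<times> 'n monomial) set, x0), q) \<Rightarrow> kills J x0 q P)" for s P
  have "\<exists>P. relation s P" if s: "s \<in> S'" for s
  proof -
    obtain J B x0 q p where JB: "s = ((J, B, x0), q)" "(J, B, x0) \<in> S" "(q, p) \<in> \<F> B J"
      using s by (auto simp: S'_def)
    have inv: "left_inverse_family J B (\<F> B J)" using \<F> finJB[OF JB(2)] by blast
    have *: "polyfun (J \<times> B) q \<and> (\<forall>b\<in>B. \<forall>j\<in>J. polyfun (J \<times> B) (p b j)) \<and>
        (\<forall>M z. \<forall>b\<in>B. q M * z b = (\<Sum>j\<in>J. p b j M * (\<Sum>b'\<in>B. M (j, b') * z b')))"
      using bspec[OF conjunct1[OF conjunct2[OF inv[unfolded left_inverse_family_def]]] JB(3)] unfolding prod.case .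
    have q: "polyfun (J \<times> B) q" "\<And>b j. b \<in> B \<Longrightarrow> j \<in> J \<Longrightarrow> polyfun (J \<times> B) (p b j)"
      "\<And>M z b. b \<in> B \<Longrightarrow> q M * z b = (\<Sum>j\<in>J. p b j M * (\<Sum>b'\<in>B. M (j, b') * z b'))"
      using conjunct1[OF *] conjunct1[OF conjunct2[OF *]] apply -
      subgoal by assumption
      subgoal by blast
      subgoal for M z b by (rule bspec[OF spec[OF spec[OF conjunct2[OF conjunct2[OF *]], of M], of z]])
      done
    have J: "J \<subseteq> I" "J \<noteq> {}" "B \<subseteq> coords (lower d) I" "card J \<le> card B" "x0 \<in> coords d J"
      using JB(2) by (auto simp: S_def E_def)
    have "1 \<le> card J" "card J \<le> card I"
      using J finJB[OF JB(2)] fin(1) by (auto simp: Suc_le_eq card_gt_0_iff intro: card_mono)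
    then have n: "card J * (card I - card J) + coords_count d (card J) \<le> card R * card J" by (rule num)
    obtain P where P: "polyfun (R \<times> coords (lower d) I) P" "\<exists>g. P g \<noteq> 0"
      "\<And>g \<alpha> T. \<alpha> x0 = 1 \<Longrightarrow> factors_through d I J T \<alpha> \<Longrightarrow>
       q (\<lambda>(j, b). \<alpha> (times_var j b)) \<noteq> 0 \<Longrightarrow>
       (\<forall>i\<in>I. \<forall>r\<in>R. (\<Sum>e\<in>coords (lower d) I. \<alpha> (times_var i e) * g (r, e)) = 0) \<Longrightarrow> P g = 0"
      by (rule annihilated_tuples_not_dense[OF fin deg J(1,5,3,4) n q]) (assumption | rule that)+
    have "kills J x0 q P"
      unfolding kills_def ann_def E_def by (intro allI impI) (rule P(3))
    then have "relation s P" using P(1,2) unfolding relation_def JB(1) E_def by simp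
    then show ?thesis by blast
  qed
  then obtain PS where "\<And>s. s \<in> S' \<Longrightarrow> relation s (PS s)" by metis
  then have PS: "\<And>s. s \<in> S' \<Longrightarrow> polyfun (R \<times> E) (PS s)" "\<And>s. s \<in> S' \<Longrightarrow> \<exists>g. PS s g \<noteq> 0"
    "\<And>s. s \<in> S' \<Longrightarrow> (case s of ((J, B, x0), q) \<Rightarrow> kills J x0 q (PS s))"
    unfolding relation_def by simp_all
  have "\<exists>g. (\<Prod>s\<in>S'. PS s g) \<noteq> 0"
    by (rule polyfun_prod_nonzero[of S' "R \<times> E" PS, OF finS']) (erule PS)+
  then obtain g where g: "(\<Prod>s\<in>S'. PS s g) \<noteq> 0" by (elim exE)
  have "\<forall>x\<in>coords d I. \<alpha> x = 0" if \<alpha>: "ann \<alpha> g" for \<alpha>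
  proof (rule ccontr)
    assume "\<not> ?thesis"
    then obtain x1 where x1: "x1 \<in> coords d I" "\<alpha> x1 \<noteq> 0" by blast
    define \<beta> where "\<beta> i e = \<alpha> (times_var i e)" for i e
    \<comment> \<open>\<open>J\<close> indexes a basis of the functionals \<open>\<alpha>(x_i \<cdot>)\<close>, so its size is the rank of \<open>\<alpha>\<close>\<close>
    obtain J u where J: "J \<subseteq> I"
      "\<And>e i. e \<in> E \<Longrightarrow> i \<in> I \<Longrightarrow> \<beta> i e = (\<Sum>j\<in>J. \<beta> j e * u j i)"
      "\<And>c. \<forall>e\<in>E. (\<Sum>j\<in>J. c j * \<beta> j e) = 0 \<Longrightarrow> \<forall>j\<in>J. c j = 0"
      by (rule pivot_columns[OF finE fin(1), of "\<lambda>e i. \<beta> i e"]) (assumption | rule that)+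
    have finJ: "finite J" using J(1) fin(1) finite_subset by blast
    define T where "T = (\<lambda>(i, j). u j i)"
    have fac: "factors_through d I J T \<alpha>"
      unfolding factors_through_def E_def[symmetric]
    proof (intro ballI)
      fix i e assume i: "i \<in> I - J" and e: "e \<in> E"
      have "\<beta> i e = (\<Sum>j\<in>J. \<beta> j e * u j i)" using J(2)[OF e, of i] i by simp
      then show "\<alpha> (times_var i e) = (\<Sum>j\<in>J. T (i, j) * \<alpha> (times_var j e))"
        by (simp add: \<beta>_def T_def mult.commute)
    qed
    have "\<exists>x0\<in>coords d J. \<alpha> x0 \<noteq> 0"
    proof (rule ccontr)
      assume "\<not> ?thesis"
      then have z: "\<And>x. x \<in> coords d J \<Longrightarrow> \<alpha> x = 0" by blast
      obtain Z where Z: "represents d I J Z x1"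
        using functional_from_few_variables[OF fin(1) J(1) x1(1)] by blast
      have "\<alpha> x1 = Z (case_sum T \<alpha>)" using Z fac by (simp add: represents_def)
      also have "\<dots> = Z (case_sum T (\<lambda>_. 0))"
        by (rule polyfun_cong[of "((I - J) \<times> J) <+> coords d J"]) (use Z z in \<open>auto simp: represents_def\<close>)
      also have "\<dots> = 0" using Z by (simp add: represents_def)
      finally show False using x1(2) by simp
    qed
    then obtain x0 where x0: "x0 \<in> coords d J" "\<alpha> x0 \<noteq> 0" by blast
    have "J \<noteq> {}"
    proof
      assume "J = {}"
      then have "\<beta> i e = 0" if "i \<in> I" "e \<in> E" for i e using J(2)[OF that(2,1)] by simp
      moreover obtain a \<mu> where "x1 = (a, \<mu>)" "a < length d" "Poly_Mapping.keys \<mu> \<subseteq> I" "total_degree \<mu> = d ! a"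
        using x1(1) by (auto simp: coords_def monomials_def)
      moreover have "d ! a \<ge> 2" using deg \<open>a < length d\<close> by simp
      ultimately have "Poly_Mapping.keys \<mu> \<noteq> {}" by (auto simp: total_degree_def)
      then obtain i where "i \<in> Poly_Mapping.keys \<mu>" by blast
      then have i: "i \<in> Poly_Mapping.keys (snd x1)" "i \<in> I"
        using \<open>x1 = (a, \<mu>)\<close> \<open>Poly_Mapping.keys \<mu> \<subseteq> I\<close> by auto
      obtain e where "e \<in> E" "x1 = times_var i e" using coords_divide_var[OF x1(1) i(1)] unfolding E_def by blast
      then show False using x1(2) i(2) \<open>\<And>i e. i \<in> I \<Longrightarrow> e \<in> E \<Longrightarrow> \<beta> i e = 0\<close> unfolding \<beta>_def by metis
    qed
    \<comment> \<open>on the coordinates \<open>B\<close> these functionals form an injective matrix\<close>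
    obtain B u2 where B: "B \<subseteq> E"
      "\<And>j e. j \<in> J \<Longrightarrow> e \<in> E \<Longrightarrow> \<beta> j e = (\<Sum>b\<in>B. \<beta> j b * u2 b e)"
      "\<And>t. \<forall>b\<in>B. (\<Sum>j\<in>J. t j * \<beta> j b) = 0 \<Longrightarrow> \<forall>e\<in>E. (\<Sum>j\<in>J. t j * \<beta> j e) = 0"
      "\<And>c. \<forall>j\<in>J. (\<Sum>b\<in>B. c b * \<beta> j b) = 0 \<Longrightarrow> \<forall>b\<in>B. c b = 0"
      by (rule pivot_columns[OF finJ finE, of \<beta>]) (assumption | rule that)+
    have finB: "finite B" using B(1) finE finite_subset by blast
    have "card J \<le> card B"
    proof (rule ccontr)
      assume "\<not> ?thesis"
      then obtain v where v: "\<exists>j\<in>J. v j \<noteq> 0" "\<forall>b\<in>B. (\<Sum>j\<in>J. v j * \<beta> j b) = 0"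
        using homogeneous_system_solution[OF finB finJ, of \<beta>] by auto
      then show False using J(3)[OF B(3)[OF v(2)]] by blast
    qed
    define \<gamma> where "\<gamma> x = \<alpha> x / \<alpha> x0" for x
    define M where "M = (\<lambda>(j, b). \<gamma> (times_var j b))"
    have "\<forall>z. (\<forall>j\<in>J. (\<Sum>b\<in>B. M (j, b) * z b) = 0) \<longrightarrow> (\<forall>b\<in>B. z b = 0)"
    proof (intro allI impI ballI)
      fix z b' assume z: "\<forall>j\<in>J. (\<Sum>b\<in>B. M (j, b) * z b) = 0" and b': "b' \<in> B"
      have "(\<Sum>b\<in>B. z b * \<beta> j b) = 0" if "j \<in> J" for j
      proof -
        have "(\<Sum>b\<in>B. M (j, b) * z b) = (\<Sum>b\<in>B. z b * \<beta> j b) / \<alpha> x0"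
          by (simp add: M_def \<gamma>_def \<beta>_def sum_divide_distrib mult.commute)
        then show ?thesis using z that x0(2) by simp
      qed
      then show "z b' = 0" using B(4)[of z] b' by blast
    qed
    moreover have "\<forall>M. (\<forall>z. (\<forall>j\<in>J. (\<Sum>b\<in>B. M (j, b) * z b) = 0) \<longrightarrow> (\<forall>b\<in>B. z b = 0)) \<longrightarrow>
        (\<exists>(q, p)\<in>\<F> B J. q M \<noteq> 0)"
      using \<F>[OF finB finJ] unfolding left_inverse_family_def by (elim conjE)
    ultimately have "\<exists>(q, p)\<in>\<F> B J. q M \<noteq> 0" by blast
    then obtain q where q: "q \<in> fst ` \<F> B J" "q M \<noteq> 0" by force
    have "(J, B, x0) \<in> S" using J(1) \<open>J \<noteq> {}\<close> B(1) \<open>card J \<le> card B\<close> x0(1) by (simp add: S_def)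
    then have s: "((J, B, x0), q) \<in> S'" using q(1) by (auto simp: S'_def)
    have "kills J x0 q (PS ((J, B, x0), q))" using PS(3)[OF s] by simp
    moreover have "\<gamma> x0 = 1" using x0(2) by (simp add: \<gamma>_def)
    moreover have "factors_through d I J T \<gamma>"
      using fac unfolding factors_through_def \<gamma>_def by (simp add: sum_divide_distrib)
    moreover have "ann \<gamma> g"
    proof -
      have "(\<Sum>e\<in>E. \<gamma> (times_var i e) * g (r, e)) = (\<Sum>e\<in>E. \<alpha> (times_var i e) * g (r, e)) / \<alpha> x0" for i r
        by (simp add: \<gamma>_def sum_divide_distrib)
      then show ?thesis using \<alpha> by (simp add: ann_def)
    qed
    ultimately have "PS ((J, B, x0), q) g = 0" using q(2) unfolding kills_def M_def by blast
    then show False using g s finS' by (metis prod_zero)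
  qed
  then show ?thesis using that[of g] unfolding ann_def E_def by blast
qed

section \<open>Nonnegative expected dimension\<close>

text \<open>
  The coefficients of \<open>\<Sum>j\<in>A. x_j c_j\<close>, where \<open>c_j\<close> is a tuple of forms of the lowered degrees in
  the variables \<open>I\<close>.
\<close>

definition mult_forms :: "nat list \<Rightarrow> 'x set \<Rightarrow> 'x set \<Rightarrow> ('x \<times> nat \<times> 'x monomial \<Rightarrow> complex)
    \<Rightarrow> nat \<times> 'x monomial \<Rightarrow> complex" where
  "mult_forms d I A c x = (\<Sum>(j, e)\<in>{(j, e) \<in> A \<times> coords (lower d) I. times_var j e = x}. c (j, e))"

lemma mult_forms_nonzero:
  "mult_forms d I A c x \<noteq> 0 \<Longrightarrow> \<exists>j\<in>A. \<exists>e\<in>coords (lower d) I. x = times_var j e"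
  unfolding mult_forms_def by (erule sum.not_neutral_contains_not_neutral) auto

lemma form_eval_mult_forms:
  fixes I A :: "'n::finite set"
  assumes "\<forall>e\<in>set d. e \<ge> 2" "a < length d"
  shows "form_eval d (mult_forms d I A c) a v =
     (\<Sum>j\<in>A. v j * (\<Sum>\<nu>\<in>monomials I (d ! a - 1). c (j, a, \<nu>) * mono_eval \<nu> v))"
proof -
  let ?s = "\<lambda>j. Poly_Mapping.single j (1::nat)"
  let ?S = "A \<times> monomials I (d ! a - 1)"
  have d2: "d ! a \<ge> 2" using assms by simp
  have fin: "finite (monomials B e :: 'n monomial set)" for B e by (rule finite_monomials) simp
  have coeff: "mult_forms d I A c (a, \<mu>) = (\<Sum>(j, \<nu>)\<in>{x \<in> ?S. (\<lambda>(j, \<nu>). \<nu> + ?s j) x = \<mu>}. c (j, a, \<nu>))" for \<mu>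
    unfolding mult_forms_def
    by (rule sum.reindex_bij_witness[of _ "\<lambda>(j, \<nu>). (j, a, \<nu>)" "\<lambda>(j, e). (j, snd e)"])
       (use assms(2) in \<open>auto simp: coords_def\<close>)
  have "form_eval d (mult_forms d I A c) a v =
      (\<Sum>\<mu>\<in>monomials UNIV (d ! a). \<Sum>(j, \<nu>)\<in>{x \<in> ?S. (\<lambda>(j, \<nu>). \<nu> + ?s j) x = \<mu>}. c (j, a, \<nu>) * mono_eval (\<nu> + ?s j) v)"
    unfolding form_eval_def coeff sum_distrib_right by (intro sum.cong refl) auto
  also have "\<dots> = (\<Sum>(j, \<nu>)\<in>?S. c (j, a, \<nu>) * mono_eval (\<nu> + ?s j) v)"
  proof (rule sum.group)
    show "(\<lambda>(j, \<nu>). \<nu> + ?s j) ` ?S \<subseteq> monomials UNIV (d ! a)"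
      using d2 by (auto simp: monomials_def total_degree_add)
  qed (use fin in auto)
  also have "\<dots> = (\<Sum>j\<in>A. v j * (\<Sum>\<nu>\<in>monomials I (d ! a - 1). c (j, a, \<nu>) * mono_eval \<nu> v))"
    by (simp add: sum.cartesian_product[symmetric] sum_distrib_left mono_eval_add mult_ac)
  finally show ?thesis .
qed

text \<open>The excess is at least 0 at \<open>c\<close>, hence on the whole chord from 0 to \<open>c\<close>.\<close>

lemma excess_nonneg:
  assumes "\<forall>e\<in>set d. e \<ge> 2" "d \<noteq> []" "d \<noteq> [2]"
    and "coords_count d c \<le> c * N" "1 \<le> r" "r \<le> c"
  shows "r * (c - r) + coords_count d r \<le> N * r"
proof -
  have "0 \<le> int r * (int c * int N - int (coords_count d c))"
    using assms(4) by (intro mult_nonneg_nonneg) (simp_all flip: of_nat_mult)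
  also have "\<dots> \<le> int c * (int r * int N - int r * (int c - int r) - int (coords_count d r))"
    by (rule excess_chord[OF assms(1-3,6)])
  finally have "int r * int N - int r * (int c - int r) - int (coords_count d r) \<ge> 0"
    using assms(5,6) by (simp add: zero_le_mult_iff)
  then have "int (r * (c - r) + coords_count d r) \<le> int (N * r)"
    using assms(6) by (simp add: of_nat_diff mult.commute)
  then show ?thesis by (simp only: of_nat_le_iff)
qed

text \<open>
  The form \<open>u = \<Sum>r. x_r g_r\<close> with \<open>g_r\<close> in the variables \<open>I\<close> vanishes on the coordinate plane of
  \<open>I\<close> and, since all degrees are at least 2, on that of \<open>K\<close>. A shear by \<open>T\<close> changes it exactly by
  the linear combination of the products \<open>x_i g_r\<close> with coefficients \<open>T\<close>. For generic \<open>g\<close> these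
  span all forms in the variables \<open>I\<close>, so the linear part at \<open>u\<close> of the map that takes \<open>T\<close> and a
  form to the sheared form is onto.
\<close>

lemma generic_form_with_another_plane:
  fixes K :: "'n::finite set"
  assumes deg: "\<forall>e\<in>set d. e \<ge> 2" "d \<noteq> []" "d \<noteq> [2]"
    and K: "card K = c" "c \<ge> 1"
    and pos: "coords_count d c \<le> c * (CARD('n) - c)"
  obtains P where "polyfun (coords d UNIV - coords d K) P" "\<exists>y. P y \<noteq> 0"
    "\<And>y. (\<And>i. i \<in> coords d K \<Longrightarrow> y i = 0) \<Longrightarrow> P y \<noteq> 0 \<Longrightarrow>
       \<exists>I T. card I = c \<and> I \<inter> K = {} \<and> forms_vanish d y (graph_plane I T)"
proof -
  define N where "N = CARD('n) - c"
  have num: "r * (c - r) + coords_count d r \<le> N * r" if "1 \<le> r" "r \<le> c" for r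
    by (rule excess_nonneg[OF deg pos[folded N_def] that])
  have "coords_count d 1 \<ge> 1" using deg(2) unfolding coords_count_def by (cases d) simp_all
  then have "c \<le> N" using num[of 1] K(2) by simp
  moreover have cKN: "card (- K) = N" using K by (simp add: N_def Compl_eq_Diff_UNIV card_Diff_subset)
  ultimately obtain I where I: "I \<subseteq> - K" "card I = c" using obtain_subset_with_card_n[of c "- K"] by metis
  define R where "R = - I"
  define E where "E = coords (lower d) I"
  have finE: "finite E" unfolding E_def by (rule finite_coords) simp
  have cR: "card R = N" using I by (simp add: R_def N_def Compl_eq_Diff_UNIV card_Diff_subset)
  obtain g :: "'n \<times> nat \<times> 'n monomial \<Rightarrow> complex" where
    g: "\<And>\<alpha>. (\<forall>i\<in>I. \<forall>r\<in>R. (\<Sum>e\<in>E. \<alpha> (times_var i e) * g (r, e)) = 0) \<Longrightarrow> (\<forall>x\<in>coords d I. \<alpha> x = 0)"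
    unfolding E_def
    by (rule generic_multiplication_spans[of I R d]) (use deg num I cR in auto)
  define Y where "Y = coords d UNIV - coords d K"
  define Y0 where "Y0 = Y - coords d I"
  define D where "D = coords d I"
  have finY: "finite Y" "finite Y0" "finite D" by (simp_all add: Y_def Y0_def D_def finite_coords)
  have IK: "coords d I \<inter> coords d K = {}"
  proof -
    have "coords d {} = ({} :: (nat \<times> 'n monomial) set)"
      using card_coords[of "{} :: 'n set" d] coords_count_0[OF deg(1)] finite_coords[of "{} :: 'n set" d] by simp
    moreover have "I \<inter> K = {}" using I(1) by blast
    ultimately show ?thesis unfolding coords_Int by simp
  qed
  have YD: "Y = D \<union> Y0" "D \<inter> Y0 = {}" using IK coords_mono[of I UNIV d] by (auto simp: Y_def Y0_def D_def)
  have cD: "card D = coords_count d c" by (simp add: D_def card_coords I(2))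
  have tvI: "times_var i e \<in> D" if "i \<in> I" "e \<in> E" for i e
    using times_var_coords[OF deg(1), of e I i] that by (simp add: D_def E_def)
  \<comment> \<open>the products \<open>x_i g_r\<close>, and their pairing with functionals\<close>
  define w where "w = (\<lambda>(i, r) x. \<Sum>e\<in>{e \<in> E. times_var i e = x}. g (r, e))"
  have pairing: "(\<Sum>e\<in>E. \<alpha> (times_var i e) * g (r, e)) = (\<Sum>x\<in>D. \<alpha> x * w (i, r) x)" if i: "i \<in> I" for \<alpha> i r
  proof -
    have "(\<Sum>x\<in>D. \<alpha> x * w (i, r) x) = (\<Sum>x\<in>D. \<Sum>e\<in>{e \<in> E. times_var i e = x}. \<alpha> (times_var i e) * g (r, e))"
      unfolding w_def prod.case sum_distrib_left by (intro sum.cong refl) auto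
    also have "\<dots> = (\<Sum>e\<in>E. \<alpha> (times_var i e) * g (r, e))"
      by (rule sum.group) (use finE finY tvI i in auto)
    finally show ?thesis by simp
  qed
  have finIR: "finite (I \<times> R)" by simp
  \<comment> \<open>\<open>C\<close> selects products that form a basis of the tuples in the variables \<open>I\<close>\<close>
  obtain C U where C: "C \<subseteq> I \<times> R"
    "\<And>x ir. x \<in> D \<Longrightarrow> ir \<in> I \<times> R \<Longrightarrow> w ir x = (\<Sum>b\<in>C. w b x * U b ir)"
    "\<And>t. \<forall>b\<in>C. (\<Sum>x\<in>D. t x * w b x) = 0 \<Longrightarrow> \<forall>ir\<in>I \<times> R. (\<Sum>x\<in>D. t x * w ir x) = 0"
    "\<And>v. \<forall>x\<in>D. (\<Sum>b\<in>C. v b * w b x) = 0 \<Longrightarrow> \<forall>b\<in>C. v b = 0"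
    by (rule pivot_columns[OF finY(3) finIR, of "\<lambda>x ir. w ir x"]) (assumption | rule that)+
  have finC: "finite C" using C(1) by (rule finite_subset) simp
  have separated: "\<forall>x\<in>D. \<alpha> x = 0" if \<alpha>: "\<forall>ir\<in>C. (\<Sum>x\<in>D. \<alpha> x * w ir x) = 0" for \<alpha>
    unfolding D_def
  proof (rule g, intro ballI)
    fix i r assume ir: "i \<in> I" "r \<in> R"
    then have "(\<Sum>x\<in>D. \<alpha> x * w (i, r) x) = 0" using C(3)[OF \<alpha>] by blast
    then show "(\<Sum>e\<in>E. \<alpha> (times_var i e) * g (r, e)) = 0" using pairing ir by simp
  qed
  have cC: "card C = card D"
  proof (rule antisym; rule ccontr)
    assume "\<not> card C \<le> card D"
    then obtain v where v: "\<exists>a\<in>C. v a \<noteq> 0" "\<forall>b\<in>D. (\<Sum>a\<in>C. v a * w a b) = 0"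
      using homogeneous_system_solution[OF finY(3) finC, of w] by auto
    have "\<forall>b\<in>C. v b = 0" by (rule C(4)) (use v(2) in simp)
    then show False using v(1) by simp
  next
    assume "\<not> card D \<le> card C"
    then obtain v where v: "\<exists>a\<in>D. v a \<noteq> 0" "\<forall>b\<in>C. (\<Sum>a\<in>D. v a * w b a) = 0"
      using homogeneous_system_solution[OF finC finY(3), of "\<lambda>a b. w b a"] by auto
    have "\<forall>x\<in>D. v x = 0" by (rule separated) (use v(2) in simp)
    then show False using v(1) by simp
  qed
  have spanning: "\<exists>T. \<forall>x\<in>D. (\<Sum>ir\<in>C. T ir * w ir x) = t x" for t
  proof -
    let ?c = "\<lambda>a x. case a of None \<Rightarrow> t x | Some ir \<Rightarrow> w ir x"
    have "card D < card (insert None (Some ` C))" using finC cC by (simp add: card_image)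
    then obtain v where v: "\<exists>a\<in>insert None (Some ` C). v a \<noteq> 0"
      "\<forall>x\<in>D. (\<Sum>a\<in>insert None (Some ` C). v a * ?c a x) = 0"
      using homogeneous_system_solution[OF finY(3), of "insert None (Some ` C)" ?c] finC by auto
    have eq: "v None * t x + (\<Sum>ir\<in>C. v (Some ir) * w ir x) = 0" if "x \<in> D" for x
      using v(2) that finC by (simp add: sum.reindex)
    have "v None \<noteq> 0"
    proof
      assume n: "v None = 0"
      have "\<forall>b\<in>C. v (Some b) = 0" by (rule C(4)) (use eq n in simp)
      then show False using v(1) n by auto
    qed
    have "(\<Sum>ir\<in>C. (- v (Some ir) / v None) * w ir x) = t x" if "x \<in> D" for x
    proof -
      have "(\<Sum>ir\<in>C. (- v (Some ir) / v None) * w ir x) = - (\<Sum>ir\<in>C. v (Some ir) * w ir x) / v None"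
        by (simp add: sum_divide_distrib sum_negf)
      also have "- (\<Sum>ir\<in>C. v (Some ir) * w ir x) = v None * t x"
        using eq[OF that] by (simp add: neg_eq_iff_add_eq_0 add.commute)
      also have "v None * t x / v None = t x" using \<open>v None \<noteq> 0\<close> by simp
      finally show ?thesis .
    qed
    then show ?thesis by (intro exI[of _ "\<lambda>ir. - v (Some ir) / v None"] ballI)
  qed
  \<comment> \<open>the base point, and the change that the shear by \<open>T\<close> makes to it\<close>
  define u where "u = mult_forms d I R g"
  define pert where "pert T = mult_forms d I I (\<lambda>(i, e). \<Sum>r\<in>R. T (i, r) * g (r, e))" for T :: "'n \<times> 'n \<Rightarrow> complex"
  have usupp: "u x = 0" if x: "x \<notin> Y0" for x
  proof (rule ccontr)
    assume "u x \<noteq> 0"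
    then obtain r e where re: "r \<in> R" "e \<in> E" "x = times_var r e"
      using mult_forms_nonzero unfolding u_def E_def by blast
    obtain a \<nu> where e: "e = (a, \<nu>)" "a < length d" "Poly_Mapping.keys \<nu> \<subseteq> I" "total_degree \<nu> = d ! a - 1"
      using re(2) by (auto simp: E_def coords_def monomials_def)
    have "d ! a \<ge> 2" using deg(1) e(2) by simp
    then have "\<nu> \<noteq> 0" using e(4) by (auto simp: total_degree_def)
    then obtain i where i: "i \<in> Poly_Mapping.keys \<nu>" by (metis all_not_in_conv keys_eq_empty)
    have "x \<in> coords d UNIV" unfolding re(3)
      by (rule times_var_coords[OF deg(1)]) (use re(2) coords_mono[of I UNIV "lower d"] in \<open>auto simp: E_def\<close>)
    moreover have "r \<in> Poly_Mapping.keys (snd x)" "i \<in> Poly_Mapping.keys (snd x)"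
      using i by (simp_all add: re(3) e(1) in_keys_iff lookup_add)
    moreover have "i \<notin> K" "r \<notin> I" using i e(3) I(1) re(1) by (auto simp: R_def)
    ultimately have "x \<notin> coords d K" "x \<notin> coords d I" "x \<in> coords d UNIV"
      by (auto simp: coords_def monomials_def)
    then show False using x by (simp add: Y0_def Y_def)
  qed
  have pert_supp: "pert T x = 0" if x: "x \<notin> D" for T x
  proof (rule ccontr)
    assume "pert T x \<noteq> 0"
    from mult_forms_nonzero[OF this[unfolded pert_def]] obtain i e
      where "i \<in> I" "e \<in> E" "x = times_var i e" unfolding E_def by blast
    then show False using tvI x by simp
  qed
  have pert_w: "pert T x = (\<Sum>ir\<in>C. T ir * w ir x)" if T: "\<And>ir. ir \<notin> C \<Longrightarrow> T ir = 0" for T x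
  proof -
    have "pert T x = (\<Sum>i\<in>I. \<Sum>e\<in>{e \<in> E. times_var i e = x}. \<Sum>r\<in>R. T (i, r) * g (r, e))"
    proof -
      have eq: "{(j, e) \<in> I \<times> coords (lower d) I. times_var j e = x} = (SIGMA i:I. {e \<in> E. times_var i e = x})"
        by (auto simp: E_def)
      show ?thesis unfolding pert_def mult_forms_def eq prod.case
        by (rule sum.Sigma[symmetric]) (use finE in auto)
    qed
    also have "\<dots> = (\<Sum>i\<in>I. \<Sum>r\<in>R. T (i, r) * w (i, r) x)"
    proof (rule sum.cong[OF refl])
      fix i
      show "(\<Sum>e\<in>{e \<in> E. times_var i e = x}. \<Sum>r\<in>R. T (i, r) * g (r, e)) = (\<Sum>r\<in>R. T (i, r) * w (i, r) x)"
        by (subst sum.swap) (simp add: w_def sum_distrib_left)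
    qed
    also have "\<dots> = (\<Sum>ir\<in>I \<times> R. T ir * w ir x)" by (simp add: sum.cartesian_product case_prod_beta)
    also have "\<dots> = (\<Sum>ir\<in>C. T ir * w ir x)"
      using C(1) T by (intro sum.mono_neutral_right) auto
    finally show ?thesis .
  qed
  have shear_u: "pullback d (shear I T) u x = u x - pert T x" if x: "x \<in> coords d UNIV" for T x
  proof -
    have "\<forall>a<length d. \<forall>v. form_eval d (pullback d (shear I T) u) a v = form_eval d (\<lambda>x. 1 * u x + (-1) * pert T x) a v"
    proof (intro allI impI)
      fix a and v :: "'n \<Rightarrow> complex" assume a: "a < length d"
      let ?M = "monomials I (d ! a - 1)"
      have inv: "mono_eval \<nu> (lin_apply (shear I T) v) = mono_eval \<nu> v" if "\<nu> \<in> ?M" for \<nu>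
        by (rule polyfun_cong[OF polyfun_mono_eval[of \<nu> I]]) (use that in \<open>auto simp: monomials_def lin_apply_shear\<close>)
      have "form_eval d (pullback d (shear I T) u) a v =
          (\<Sum>r\<in>R. lin_apply (shear I T) v r * (\<Sum>\<nu>\<in>?M. g (r, a, \<nu>) * mono_eval \<nu> v))"
        unfolding form_eval_pullback u_def form_eval_mult_forms[OF deg(1) a]
        by (intro sum.cong refl arg_cong2[of _ _ _ _ "(*)"]) (simp add: inv)
      also have "\<dots> = (\<Sum>r\<in>R. v r * (\<Sum>\<nu>\<in>?M. g (r, a, \<nu>) * mono_eval \<nu> v))
          - (\<Sum>r\<in>R. \<Sum>i\<in>I. T (i, r) * v i * (\<Sum>\<nu>\<in>?M. g (r, a, \<nu>) * mono_eval \<nu> v))"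
        by (simp add: lin_apply_shear R_def left_diff_distrib sum_subtractf sum_distrib_right)
      also have "(\<Sum>r\<in>R. \<Sum>i\<in>I. T (i, r) * v i * (\<Sum>\<nu>\<in>?M. g (r, a, \<nu>) * mono_eval \<nu> v)) =
          (\<Sum>i\<in>I. v i * (\<Sum>\<nu>\<in>?M. (\<Sum>r\<in>R. T (i, r) * g (r, a, \<nu>)) * mono_eval \<nu> v))"
      proof (subst sum.swap, rule sum.cong[OF refl])
        fix i
        have "(\<Sum>r\<in>R. T (i, r) * v i * (\<Sum>\<nu>\<in>?M. g (r, a, \<nu>) * mono_eval \<nu> v)) =
            (\<Sum>r\<in>R. \<Sum>\<nu>\<in>?M. v i * (T (i, r) * g (r, a, \<nu>) * mono_eval \<nu> v))"
          by (simp add: sum_distrib_left mult_ac)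
        also have "\<dots> = v i * (\<Sum>\<nu>\<in>?M. (\<Sum>r\<in>R. T (i, r) * g (r, a, \<nu>)) * mono_eval \<nu> v)"
          by (subst sum.swap) (simp add: sum_distrib_left sum_distrib_right)
        finally show "(\<Sum>r\<in>R. T (i, r) * v i * (\<Sum>\<nu>\<in>?M. g (r, a, \<nu>) * mono_eval \<nu> v)) = \<dots>" .
      qed
      finally show "form_eval d (pullback d (shear I T) u) a v = form_eval d (\<lambda>x. 1 * u x + (-1) * pert T x) a v"
        unfolding form_eval_linear unfolding u_def pert_def form_eval_mult_forms[OF deg(1) a] by simp
    qed
    then show ?thesis using x unfolding form_eval_eq_iff by simp
  qed
  have identity: "pullback d (shear I (\<lambda>_. 0)) y x = y x" if "x \<in> coords d UNIV" for y x
  proof -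
    have "lin_apply (shear I (\<lambda>_. 0)) v = v" for v by (simp add: fun_eq_iff lin_apply_shear)
    then have "\<forall>x\<in>coords d UNIV. pullback d (shear I (\<lambda>_. 0)) y x = y x"
      unfolding form_eval_eq_iff[symmetric] by (simp add: form_eval_pullback)
    then show ?thesis using that by blast
  qed
  define X where "X = C <+> Y0"
  define Tz where "Tz z ir = (if ir \<in> C then z (Inl ir) else 0)" for z :: "('n \<times> 'n) + (nat \<times> 'n monomial) \<Rightarrow> complex" and ir
  define vz where "vz z i = (if i \<in> Y0 then z (Inr i) else 0)" for z :: "('n \<times> 'n) + (nat \<times> 'n monomial) \<Rightarrow> complex" and i
  define \<phi> where "\<phi> y z = pullback d (shear I (Tz z)) (\<lambda>i. u i + vz z i) y" for y z
  define L where "L z y = vz z y - pert (Tz z) y" for z y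
  have shear_poly: "polyfun X (\<lambda>z. shear I (Tz z) x)" for x
  proof (rule polyfun_shear)
    show "polyfun X (\<lambda>z. Tz z ir)" for ir
      unfolding Tz_def by (cases "ir \<in> C") (auto simp: X_def intro: polyfun.intros)
  qed
  have vz_poly: "polyfun X (\<lambda>z. vz z i)" for i
    unfolding vz_def by (cases "i \<in> Y0") (auto simp: X_def intro: polyfun.intros)
  have \<phi>poly: "polyfun X (\<phi> y)" for y
    unfolding \<phi>_def[abs_def]
    by (intro polyfun_pullback shear_poly polyfun.add polyfun.const vz_poly)
  have expand: "\<exists>\<psi>. poly \<psi> 0 = L z y \<and> (\<forall>\<tau>. \<phi> y (\<lambda>i. \<tau> * z i) = u y + \<tau> * poly \<psi> \<tau>)" if y: "y \<in> Y" for z y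
  proof -
    have yU: "y \<in> coords d UNIV" using y by (simp add: Y_def)
    have "polyfun X (\<lambda>z'. pullback d (shear I (Tz z')) (vz z) y)"
      by (intro polyfun_pullback shear_poly polyfun.const)
    from polyfun_univariate[OF this, of "\<lambda>i. [:0, z i:]"] obtain p
      where p: "\<And>\<tau>. pullback d (shear I (Tz (\<lambda>i. \<tau> * z i))) (vz z) y = poly p \<tau>" by auto
    have T\<tau>: "Tz (\<lambda>i. \<tau> * z i) = (\<lambda>ir. \<tau> * Tz z ir)" "vz (\<lambda>i. \<tau> * z i) = (\<lambda>i. \<tau> * vz z i)" for \<tau>
      by (auto simp: Tz_def vz_def fun_eq_iff)
    have pert_scale: "pert (\<lambda>ir. \<tau> * Tz z ir) y = \<tau> * pert (Tz z) y" for \<tau>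
      by (simp add: pert_w Tz_def sum_distrib_left mult.assoc)
    have "\<phi> y (\<lambda>i. \<tau> * z i) = u y + \<tau> * poly (p - [:pert (Tz z) y:]) \<tau>" for \<tau>
    proof -
      have "\<phi> y (\<lambda>i. \<tau> * z i) = pullback d (shear I (\<lambda>ir. \<tau> * Tz z ir)) (\<lambda>i. 1 * u i + \<tau> * vz z i) y"
        by (simp add: \<phi>_def T\<tau>)
      also have "\<dots> = pullback d (shear I (\<lambda>ir. \<tau> * Tz z ir)) u y + \<tau> * poly p \<tau>"
        unfolding pullback_linear p[symmetric] T\<tau> by simp
      finally show ?thesis by (simp add: shear_u[OF yU] pert_scale algebra_simps)
    qed
    moreover have "Tz (\<lambda>_. 0) = (\<lambda>_. 0)" by (simp add: Tz_def fun_eq_iff)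
    then have "poly (p - [:pert (Tz z) y:]) 0 = L z y"
      using p[of 0] identity[OF yU, of "vz z"] by (simp add: L_def T\<tau>)
    ultimately show ?thesis by blast
  qed
  have surj: "\<exists>z. \<forall>y\<in>Y. L z y = t y" for t
  proof -
    obtain T where T: "\<forall>x\<in>D. (\<Sum>ir\<in>C. T ir * w ir x) = - t x" using spanning[of "\<lambda>x. - t x"] by blast
    define z where "z = case_sum T t"
    have "(\<Sum>ir\<in>C. Tz z ir * w ir x) = (\<Sum>ir\<in>C. T ir * w ir x)" for x
      by (intro sum.cong) (auto simp: Tz_def z_def)
    then have pz: "pert (Tz z) x = (\<Sum>ir\<in>C. T ir * w ir x)" for x by (simp add: pert_w Tz_def)
    have "L z y = t y" if "y \<in> Y" for y
    proof (cases "y \<in> D")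
      case True
      then have "y \<notin> Y0" using YD(2) by blast
      then show ?thesis using T True by (simp add: L_def vz_def pz)
    next
      case False
      then have "y \<in> Y0" using that YD(1) by blast
      then show ?thesis using pert_supp[OF False] by (simp add: L_def vz_def z_def)
    qed
    then show ?thesis by blast
  qed
  have "card X = card Y"
    unfolding X_def YD(1) using finC finY cC YD(2) by (simp add: card_Plus card_Un_disjoint)
  moreover have "finite X" unfolding X_def using finC finY by simp
  moreover have "F v = 0" if "polyfun Y F" "\<And>z. F (\<lambda>y. \<phi> y z) = 0" for F v
    by (rule algebraically_independent_if_linear_part_surjective[of Y F \<phi> L u, OF that expand surj])
  ultimately obtain P where P: "polyfun Y P" "\<exists>v. P v \<noteq> 0" "\<And>v. P v \<noteq> 0 \<Longrightarrow> \<exists>z. \<forall>y\<in>Y. \<phi> y z = v y"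
    using algebraically_independent_generically_surjective[of X Y \<phi>] finY(1) \<phi>poly by metis
  have "\<exists>I T. card I = c \<and> I \<inter> K = {} \<and> forms_vanish d y (graph_plane I T)"
    if y: "\<And>i. i \<in> coords d K \<Longrightarrow> y i = 0" and Py: "P y \<noteq> 0" for y
  proof -
    obtain z where z: "\<forall>i\<in>Y. \<phi> i z = y i" using P(3)[OF Py] by blast
    define f where "f i = u i + vz z i" for i
    have f0: "f i = 0" if "i \<notin> Y0" for i using usupp[OF that] that by (simp add: f_def vz_def)
    have fK: "\<forall>i\<in>coords d K. pullback d (shear I (Tz z)) f i = 0"
      unfolding form_vanishes_on_coordinates_iff[symmetric] form_eval_pullback
    proof (intro allI impI)
      fix a and v :: "'n \<Rightarrow> complex" assume a: "a < length d" and v: "\<forall>i. i \<notin> K \<longrightarrow> v i = 0"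
      have vI: "v i = 0" if "i \<in> I" for i using v I(1) that by blast
      have "lin_apply (shear I (Tz z)) v r = 0" if "r \<notin> K" for r
        using v that by (simp add: lin_apply_shear vI)
      moreover have "\<forall>i\<in>coords d K. f i = 0" using f0 by (simp add: Y0_def Y_def)
      ultimately show "form_eval d f a (lin_apply (shear I (Tz z)) v) = 0"
        using a form_vanishes_on_coordinates_iff[of d K f] by blast
    qed
    have eq: "pullback d (shear I (Tz z)) f i = y i" if "i \<in> coords d UNIV" for i
    proof (cases "i \<in> coords d K")
      case True
      then show ?thesis using fK y by simp
    next
      case False
      then have "\<phi> i z = y i" using z that by (simp add: Y_def)
      then show ?thesis by (simp add: \<phi>_def f_def[abs_def])
    qed
    have "\<forall>i\<in>coords d I. pullback d (shear I (\<lambda>x. - Tz z x)) y i = 0"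
    proof
      fix i assume i: "i \<in> coords d I"
      then have iU: "i \<in> coords d UNIV" using coords_mono[of I UNIV d] by blast
      have "pullback d (shear I (\<lambda>x. - Tz z x)) y i =
          pullback d (shear I (\<lambda>x. - Tz z x)) (pullback d (shear I (Tz z)) f) i"
        by (rule pullback_cong[OF iU]) (simp add: eq)
      also have "\<dots> = f i" by (rule pullback_shear_inverse(2)[OF iU])
      also have "\<dots> = 0" using i by (intro f0) (simp add: Y0_def)
      finally show "pullback d (shear I (\<lambda>x. - Tz z x)) y i = 0" .
    qed
    then have "forms_vanish d y (graph_plane I (Tz z))"
      unfolding forms_vanish_on_graph_plane_iff .
    then show ?thesis using I by blast
  qed
  then show ?thesis using that[of P] P(1,2) unfolding Y_def by blast
qed

section \<open>Fano schemes of generic forms\<close>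

lemma poly_eval_form:
  assumes "f \<in> forms d" "a < length d"
  shows "poly_eval (f ! a) v = form_eval d (coeff_vector f) a v"
proof -
  have f: "length f = length d" "homogeneous (d ! a) (f ! a)" using assms by (auto simp: forms_def)
  have "poly_eval (f ! a) v = (\<Sum>\<mu>\<in>monomials UNIV (d ! a). Poly_Mapping.lookup (f ! a) \<mu> * mono_eval \<mu> v)"
    by (rule poly_eval_superset) (use f(2) in \<open>auto simp: homogeneous_def monomials_def intro: finite_monomials[unfolded monomials_def, of UNIV, simplified]\<close>)
  then show ?thesis using assms(2) f(1) by (simp add: form_eval_def coeff_vector_def)
qed

lemma coeff_vector_surj:
  fixes y :: "nat \<times> 'n::finite monomial \<Rightarrow> complex"
  assumes "\<And>i. i \<notin> coords d UNIV \<Longrightarrow> y i = 0"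
  obtains f where "f \<in> forms d" "coeff_vector f = y"
proof -
  define f where "f = map (\<lambda>a. Abs_poly_mapping (\<lambda>\<mu>. y (a, \<mu>))) [0..<length d]"
  have lk: "Poly_Mapping.lookup (f ! a) \<mu> = y (a, \<mu>)" if a: "a < length d" for a \<mu>
  proof -
    have "{\<mu>. y (a, \<mu>) \<noteq> 0} \<subseteq> monomials UNIV (d ! a)"
      using assms a by (auto simp: coords_def)
    then have "finite {\<mu>. y (a, \<mu>) \<noteq> 0}" by (rule finite_subset) (simp add: finite_monomials)
    then show ?thesis using a by (simp add: f_def)
  qed
  have "homogeneous (d ! a) (f ! a)" if a: "a < length d" for a
    unfolding homogeneous_def
  proof
    fix \<mu> assume "\<mu> \<in> Poly_Mapping.keys (f ! a)"
    then have "(a, \<mu>) \<in> coords d UNIV" using assms[of "(a, \<mu>)"] lk[OF a] by (auto simp: in_keys_iff)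
    then show "total_degree \<mu> = d ! a" by (simp add: coords_def monomials_def)
  qed
  then have "f \<in> forms d" by (simp add: forms_def f_def)
  moreover have "coeff_vector f = y"
  proof
    fix i :: "nat \<times> 'n monomial"
    obtain a \<mu> where i: "i = (a, \<mu>)" by (cases i)
    show "coeff_vector f i = y i"
    proof (cases "a < length d")
      case True
      then show ?thesis using lk by (simp add: i coeff_vector_def f_def)
    next
      case False
      then show ?thesis using assms[of i] by (simp add: i coeff_vector_def coords_def f_def)
    qed
  qed
  ultimately show ?thesis using that by blast
qed

lemma coeff_vector_support:
  assumes "f \<in> forms d" "i \<notin> coords d UNIV"
  shows "coeff_vector f i = 0"
proof -
  obtain a \<mu> where i: "i = (a, \<mu>)" by (cases i)
  have f: "length f = length d" "\<And>a. a < length d \<Longrightarrow> homogeneous (d ! a) (f ! a)" using assms(1) by (auto simp: forms_def)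
  show ?thesis
  proof (cases "a < length d")
    case True
    then have "total_degree \<mu> \<noteq> d ! a" using assms(2) by (simp add: i coords_def monomials_def)
    then have "\<mu> \<notin> Poly_Mapping.keys (f ! a)" using f(2)[OF True] by (auto simp: homogeneous_def)
    then show ?thesis by (simp add: i coeff_vector_def in_keys_iff)
  qed (simp add: i coeff_vector_def f(1))
qed

text \<open>
  Every nonzero vector spans a point, and at the zero vector the forms vanish because their
  degrees are positive.
\<close>

lemma points_of_subset_zero_locus_iff:
  assumes "\<forall>e\<in>set d. e \<ge> 2" "f \<in> forms d" "vec.subspace W"
  shows "points_of W \<subseteq> zero_locus f \<longleftrightarrow>
     forms_vanish d (coeff_vector f) W"
proof -
  have len: "length f = length d" using assms(2) by (simp add: forms_def)
  have zero: "poly_eval (f ! a) (\<lambda>i. (0 :: complex ^ 'a) $ i) = 0" if a: "a < length d" for a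
  proof -
    have h: "homogeneous (d ! a) (f ! a)" using assms(2) a by (simp add: forms_def)
    have "d ! a \<ge> 2" using assms(1) a by simp
    then have z: "(0 :: complex) ^ (d ! a) = 0" by simp
    have "poly_eval (f ! a) (\<lambda>_. 0) = 0"
      using poly_eval_scale[OF h, of 0 "\<lambda>_. 0"] unfolding z mult_zero_left .
    then show ?thesis by simp
  qed
  have "points_of W \<subseteq> zero_locus f \<longleftrightarrow> (\<forall>g\<in>set f. \<forall>v\<in>W. v \<noteq> 0 \<longrightarrow> poly_eval g (\<lambda>i. v $ i) = 0)"
  proof
    assume L: "points_of W \<subseteq> zero_locus f"
    show "\<forall>g\<in>set f. \<forall>v\<in>W. v \<noteq> 0 \<longrightarrow> poly_eval g (\<lambda>i. v $ i) = 0"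
    proof (intro ballI impI)
      fix g v assume g: "g \<in> set f" and v: "v \<in> W" "v \<noteq> 0"
      have "vec.dim (vec.span {v}) = 1"
        using v(2) by (simp add: vec.dim_span vec.dim_eq_card_independent)
      then have "vec.span {v} \<in> planes 0" by (simp add: planes_def vec.subspace_span)
      moreover have "vec.span {v} \<subseteq> W" using v(1) assms(3) by (intro vec.span_minimal) auto
      ultimately have "vec.span {v} \<in> zero_locus f" using L by (auto simp: points_of_def)
      then show "poly_eval g (\<lambda>i. v $ i) = 0"
        using g v(2) vec.span_base[of v "{v}"] by (auto simp: zero_locus_def)
    qed
  next
    assume R: "\<forall>g\<in>set f. \<forall>v\<in>W. v \<noteq> 0 \<longrightarrow> poly_eval g (\<lambda>i. v $ i) = 0"
    then show "points_of W \<subseteq> zero_locus f" by (auto simp: points_of_def zero_locus_def)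
  qed
  also have "\<dots> \<longleftrightarrow> (\<forall>a<length d. \<forall>v\<in>W. poly_eval (f ! a) (\<lambda>i. v $ i) = 0)"
    unfolding all_set_conv_all_nth len using zero by metis
  also have "\<dots> \<longleftrightarrow> forms_vanish d (coeff_vector f) W"
    using poly_eval_form[OF assms(2)] by simp
  finally show ?thesis .
qed

lemma delta_eq: "k \<le> n \<Longrightarrow> delta n d k = int ((k + 1) * (n - k)) - int (coords_count d (k + 1))"
proof -
  assume kn: "k \<le> n"
  have "(\<Sum>e\<leftarrow>d. int ((e + k) choose k)) = int (coords_count d (k + 1))"
    unfolding coords_count_def
  proof (induction d)
    case (Cons e d)
    then show ?case using binomial_symmetric[of k "e + k"] by simp
  qed simp
  moreover have "int ((k + 1) * (n - k)) = (int k + 1) * (int n - int k)"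
    by (simp only: of_nat_mult of_nat_add of_nat_1 of_nat_diff[OF kn])
  ultimately show ?thesis by (simp only: delta_def)
qed

definition shear_image :: "'n set \<Rightarrow> ('n \<times> 'n \<Rightarrow> complex) \<Rightarrow> (complex ^ 'n::finite) set \<Rightarrow> (complex ^ 'n) set" where
  "shear_image I T W = (\<lambda>v. \<chi> r. lin_apply (shear I T) (($) v) r) ` W"

lemma lin_apply_vec: "lin_apply G (($) (\<chi> r. lin_apply H v r)) = lin_apply G (lin_apply H v)"
  by (rule arg_cong[of _ _ "lin_apply G"]) (simp add: fun_eq_iff)

lemma shear_image_inverse:
  "shear_image I T (shear_image I (\<lambda>x. - T x) W) = W"
  "shear_image I (\<lambda>x. - T x) (shear_image I T W) = W"
  unfolding shear_image_def image_image lin_apply_vec lin_apply_shear_inverse by simp_all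

lemma shear_image_plane:
  assumes "vec.subspace W"
  shows "vec.subspace (shear_image I T W)" "vec.dim (shear_image I T W) = vec.dim W"
proof -
  let ?A = "\<chi> i j. shear I T (i, j)"
  have eq: "shear_image I T W = (*v) ?A ` W"
    unfolding shear_image_def by (rule image_cong) (simp_all add: matrix_vector_mult_def lin_apply_def)
  have inj: "inj ((*v) ?A)"
  proof (rule injI)
    fix v w assume "?A *v v = ?A *v w"
    then have "lin_apply (shear I T) (($) v) = lin_apply (shear I T) (($) w)"
      by (simp add: matrix_vector_mult_def lin_apply_def vec_eq_iff fun_eq_iff)
    then have "($) v = ($) w" using lin_apply_shear_inverse(1)[of I T] by metis
    then show "v = w" by (simp add: vec_nth_inject)
  qed
  show "vec.subspace (shear_image I T W)" unfolding eq by (rule vec.subspace_image[OF assms])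
  show "vec.dim (shear_image I T W) = vec.dim W" unfolding eq
    by (rule vec.dim_image_eq[OF matrix_vector_mul_linear_gen]) (use inj in \<open>auto intro: inj_on_subset\<close>)
qed

lemma forms_vanish_on_shear_image:
  "(\<forall>v\<in>shear_image I T W. form_eval d y a (($) v) = 0) \<longleftrightarrow>
     (\<forall>v\<in>W. form_eval d (pullback d (shear I T) y) a (($) v) = 0)"
proof -
  have "($) (\<chi> r. lin_apply (shear I T) (($) v) r) = lin_apply (shear I T) (($) v)" for v :: "complex ^ 'a"
    by (simp add: fun_eq_iff)
  then show ?thesis unfolding shear_image_def form_eval_pullback by simp
qed

lemma shear_image_graph_plane: "shear_image I (\<lambda>x. - T x) (coordinate_plane I) = graph_plane I T"
proof -
  have *: "shear_image I T (graph_plane I T) \<subseteq> coordinate_plane I" for T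
    unfolding shear_image_def
    by (auto simp: graph_plane_iff_shear[of _ I T] graph_plane_def[of I "\<lambda>_. 0"])
  have "shear_image I (\<lambda>x. - T x) (coordinate_plane I) \<subseteq> graph_plane I T"
    unfolding shear_image_def
    by (auto simp: graph_plane_iff_shear[of _ I T] lin_apply_vec lin_apply_shear_inverse graph_plane_def[of I "\<lambda>_. 0"])
  moreover have "graph_plane I T = shear_image I (\<lambda>x. - T x) (shear_image I T (graph_plane I T))"
    by (simp add: shear_image_inverse)
  then have "graph_plane I T \<subseteq> shear_image I (\<lambda>x. - T x) (coordinate_plane I)"
    using * unfolding shear_image_def by blast
  ultimately show ?thesis by blast
qed

lemma coordinate_planes_distinct:
  assumes "I \<inter> K = {}" "I \<noteq> {}"
  shows "graph_plane I T \<noteq> coordinate_plane K"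
proof
  assume eq: "graph_plane I T = coordinate_plane K"
  define v where "v = (\<chi> r. if r \<in> I then 1 else (\<Sum>i\<in>I. T (i, r)))"
  have "v \<in> graph_plane I T" by (simp add: graph_plane_def v_def)
  then have "v \<in> coordinate_plane K" unfolding eq .
  moreover obtain i where i: "i \<in> I" using assms(2) by blast
  ultimately have "v $ i = 0" using assms(1) by (auto simp: graph_plane_def)
  then show False using i by (simp add: v_def)
qed

lemma generic_forms_on_coordinate_plane:
  fixes K :: "'n::finite set"
  assumes deg: "\<forall>e\<in>set d. e \<ge> 2" "d \<noteq> []" "d \<noteq> [2]"
    and K: "card K = k + 1" and n: "CARD('n) = n + 1" "k \<le> n"
  obtains P where "polyfun (coords d UNIV - coords d K) P" "\<exists>y. P y \<noteq> 0"
    "\<And>y. (\<And>i. i \<in> coords d K \<Longrightarrow> y i = 0) \<Longrightarrow> P y \<noteq> 0 \<Longrightarrow>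
       (\<forall>W\<in>planes k. forms_vanish d y W \<longrightarrow> W = coordinate_plane K)
         \<longleftrightarrow> delta n d k < 0"
proof (cases "delta n d k < 0")
  case True
  then have "(k + 1) * (CARD('n) - (k + 1)) < coords_count d (k + 1)"
    unfolding delta_eq[OF n(2)] n(1) by (simp flip: of_nat_add of_nat_mult)
  then obtain P where P: "polyfun (coords d UNIV - coords d K) P" "\<exists>y. P y \<noteq> 0"
    "\<And>y W. (\<And>i. i \<in> coords d K \<Longrightarrow> y i = 0) \<Longrightarrow> vec.subspace W \<Longrightarrow> vec.dim W = k + 1 \<Longrightarrow>
       forms_vanish d y W \<Longrightarrow> P y \<noteq> 0 \<Longrightarrow> W = coordinate_plane K"
    using generic_form_without_other_planes[OF deg K] by blast
  show ?thesis
  proof (rule that[OF P(1,2)])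
    fix y assume y: "\<And>i. i \<in> coords d K \<Longrightarrow> y i = 0" and Py: "P y \<noteq> 0"
    have "W = coordinate_plane K"
      if "W \<in> planes k" "forms_vanish d y W" for W
      using P(3)[OF y _ _ that(2) Py] that(1) by (simp add: planes_def)
    then show "(\<forall>W\<in>planes k. forms_vanish d y W \<longrightarrow> W = coordinate_plane K)
         \<longleftrightarrow> delta n d k < 0" using True by blast
  qed
next
  case False
  then have "coords_count d (k + 1) \<le> (k + 1) * (CARD('n) - (k + 1))"
    unfolding delta_eq[OF n(2)] n(1) by (simp flip: of_nat_add of_nat_mult)
  then obtain P where P: "polyfun (coords d UNIV - coords d K) P" "\<exists>y. P y \<noteq> 0"
    "\<And>y. (\<And>i. i \<in> coords d K \<Longrightarrow> y i = 0) \<Longrightarrow> P y \<noteq> 0 \<Longrightarrow>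
       \<exists>I T. card I = k + 1 \<and> I \<inter> K = {} \<and> forms_vanish d y (graph_plane I T)"
    using generic_form_with_another_plane[OF deg K] by (metis (no_types, lifting) le_add2)
  show ?thesis
  proof (rule that[OF P(1,2)])
    fix y assume y: "\<And>i. i \<in> coords d K \<Longrightarrow> y i = 0" and Py: "P y \<noteq> 0"
    obtain I T where IT: "card I = k + 1" "I \<inter> K = {}"
      "forms_vanish d y (graph_plane I T)" using P(3)[OF y Py] by blast
    have "I \<noteq> {}" using IT(1) by auto
    have "graph_plane I T \<in> planes k" "graph_plane I T \<noteq> coordinate_plane K"
      using IT(1) coordinate_planes_distinct[OF IT(2) \<open>I \<noteq> {}\<close>] by (simp_all add: planes_graph_plane)
    then show "(\<forall>W\<in>planes k. forms_vanish d y W \<longrightarrow> W = coordinate_plane K)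
         \<longleftrightarrow> delta n d k < 0" using False IT(3) by blast
  qed
qed

text \<open>
  The polynomial for the coordinate plane, composed with the transformation of coefficients under
  the shear that moves \<open>\<Lambda>\<close> there, is a polynomial in the coefficients of the forms on \<open>\<Lambda>\<close>.
\<close>

lemma generic_forms_on_plane:
  fixes \<Lambda> :: "(complex ^ 'n::finite) set"
  assumes deg: "\<forall>e\<in>set d. e \<ge> 2" "d \<noteq> []" "d \<noteq> [2]"
    and n: "CARD('n) = n + 1" "k \<le> n" and \<Lambda>: "\<Lambda> \<in> planes k"
  shows "generically (zariski (coeff_vector ` forms_vanishing_on d \<Lambda>)) (\<lambda>l.
           \<forall>f\<in>forms_vanishing_on d \<Lambda>. line_of (coeff_vector f) = l \<longrightarrow>
             (fano k f = {\<Lambda>} \<longleftrightarrow> delta n d k < 0))"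
proof -
  let ?L = "coeff_vector ` forms_vanishing_on d \<Lambda>"
  have sub: "vec.subspace \<Lambda>" "vec.dim \<Lambda> = k + 1" using \<Lambda> by (auto simp: planes_def)
  obtain K T where KT: "\<Lambda> = graph_plane K T" using subspace_echelon_form[OF sub(1)] by blast
  have cK: "card K = k + 1" using sub(2) unfolding KT dim_graph_plane .
  define G where "G = shear K (\<lambda>x. - T x)"
  obtain P where P: "polyfun (coords d UNIV - coords d K) P" "\<exists>y. P y \<noteq> 0"
    "\<And>y. (\<And>i. i \<in> coords d K \<Longrightarrow> y i = 0) \<Longrightarrow> P y \<noteq> 0 \<Longrightarrow>
       (\<forall>W\<in>planes k. forms_vanish d y W \<longrightarrow> W = coordinate_plane K)
         \<longleftrightarrow> delta n d k < 0"
    using generic_forms_on_coordinate_plane[OF deg cK n] by blast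
  have vanishing_iff: "f \<in> forms_vanishing_on d \<Lambda> \<longleftrightarrow>
      f \<in> forms d \<and> (\<forall>i\<in>coords d K. pullback d G (coeff_vector f) i = 0)" for f :: "'n mpoly list"
    unfolding forms_vanishing_on_def G_def
    using points_of_subset_zero_locus_iff[OF deg(1) _ sub(1), of f]
      forms_vanish_on_graph_plane_iff[of d K T "coeff_vector f"] KT by auto
  have L_iff: "y \<in> ?L \<longleftrightarrow> (\<forall>i. i \<notin> coords d UNIV \<longrightarrow> y i = 0) \<and> (\<forall>i\<in>coords d K. pullback d G y i = 0)"
    (is "_ \<longleftrightarrow> ?S y") for y
  proof
    assume "y \<in> ?L"
    then obtain f where "f \<in> forms d" "y = coeff_vector f" "\<forall>i\<in>coords d K. pullback d G y i = 0"
      using vanishing_iff by auto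
    then show "?S y" using coeff_vector_support by auto
  next
    assume S: "?S y"
    then obtain f :: "'n mpoly list" where "f \<in> forms d" "coeff_vector f = y"
      using coeff_vector_surj[of d y] by blast
    then show "y \<in> ?L" using S vanishing_iff[of f] by auto
  qed
  have lin: "(\<lambda>i. a * u i + b * v i) \<in> ?L" if "u \<in> ?L" "v \<in> ?L" for a b u v
    using that unfolding L_iff pullback_linear by simp
  define Q where "Q y = P (pullback d G y)" for y
  have Qpoly: "polyfun UNIV Q"
  proof -
    have "polyfun UNIV (\<lambda>y. P (\<lambda>i. pullback d G y i))"
      by (rule polyfun_compose[OF P(1)]) (intro polyfun_pullback polyfun.const polyfun.var UNIV_I)
    then show ?thesis by (simp add: Q_def[abs_def])
  qed
  obtain u0 where u0: "u0 \<in> ?L" "Q u0 \<noteq> 0"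
  proof -
    obtain y where y: "P y \<noteq> 0" using P(2) by blast
    define y' where "y' i = (if i \<in> coords d UNIV - coords d K then y i else 0)" for i
    define u0 where "u0 i = (if i \<in> coords d UNIV then pullback d (shear K T) y' i else 0)" for i
    have undo: "pullback d G u0 i = y' i" if i: "i \<in> coords d UNIV" for i
    proof -
      have "pullback d G u0 i = pullback d G (pullback d (shear K T) y') i"
        by (rule pullback_cong[OF i]) (simp add: u0_def)
      then show ?thesis using pullback_shear_inverse(2)[OF i] by (simp add: G_def)
    qed
    have "Q u0 = P y" unfolding Q_def
      by (rule polyfun_cong[OF P(1)]) (simp add: undo y'_def)
    moreover have "u0 \<in> ?L"
      unfolding L_iff using undo coords_mono[of K UNIV d] by (auto simp: u0_def y'_def)
    ultimately show ?thesis using that y by simp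
  qed
  have fano_iff: "W \<in> fano k f \<longleftrightarrow> W \<in> planes k \<and> forms_vanish d (coeff_vector f) W"
    if "f \<in> forms d" for W f
    using points_of_subset_zero_locus_iff[OF deg(1) that, of W] unfolding fano_def planes_def by auto
  have generic: "fano k f = {\<Lambda>} \<longleftrightarrow> delta n d k < 0"
    if f: "f \<in> forms_vanishing_on d \<Lambda>" and x: "x \<in> ?L" "\<exists>i. x i \<noteq> 0" "Q x \<noteq> 0"
      and l: "line_of (coeff_vector f) = line_of x" for f x
  proof -
    have fd: "f \<in> forms d" using f by (simp add: forms_vanishing_on_def)
    \<comment> \<open>\<open>f\<close> is a multiple of the generic point \<open>x\<close>, and conversely\<close>
    have "y \<in> line_of y" for y :: "nat \<times> 'n monomial \<Rightarrow> complex"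
      by (auto simp: line_of_def intro!: exI[of _ 1])
    then have "coeff_vector f \<in> line_of x" "x \<in> line_of (coeff_vector f)" using l by blast+
    then obtain b c where bc: "coeff_vector f = (\<lambda>i. b * x i)" "x = (\<lambda>i. c * coeff_vector f i)"
      by (auto simp: line_of_def)
    have same: "form_eval d (coeff_vector f) a v = 0 \<longleftrightarrow> form_eval d x a v = 0" for a v
    proof -
      have "form_eval d (coeff_vector f) a v = b * form_eval d x a v"
        using form_eval_linear[of d b x 0 x a v] bc(1) by simp
      moreover have "form_eval d x a v = c * form_eval d (coeff_vector f) a v"
        using form_eval_linear[of d c "coeff_vector f" 0 "coeff_vector f" a v] bc(2) by simp
      ultimately show ?thesis by (metis mult_zero_right)
    qed
    define y where "y = pullback d G x"
    have y0: "\<And>i. i \<in> coords d K \<Longrightarrow> y i = 0" using x(1) unfolding L_iff y_def by blast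
    have Py: "P y \<noteq> 0" using x(3) by (simp add: Q_def y_def)
    have \<Lambda>G: "\<Lambda> = shear_image K (\<lambda>x. - T x) (coordinate_plane K)"
      by (simp add: KT shear_image_graph_plane)
    have van: "(\<forall>v\<in>shear_image K (\<lambda>x. - T x) W. form_eval d x a (($) v) = 0) \<longleftrightarrow>
        (\<forall>v\<in>W. form_eval d y a (($) v) = 0)" for W a
      unfolding y_def G_def by (rule forms_vanish_on_shear_image)
    have planes: "shear_image K S W \<in> planes k \<longleftrightarrow> W \<in> planes k" if "W = shear_image K (\<lambda>x. - S x) (shear_image K S W)" for S W
      using shear_image_plane[of W K S] shear_image_plane[of "shear_image K S W" K "\<lambda>x. - S x"] that
      by (auto simp: planes_def)
    have "\<Lambda> \<in> fano k f"
      using f \<Lambda> by (simp add: fano_def forms_vanishing_on_def)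
    then have "fano k f = {\<Lambda>} \<longleftrightarrow> (\<forall>W\<in>fano k f. W = \<Lambda>)" by blast
    also have "\<dots> \<longleftrightarrow> (\<forall>W\<in>planes k. forms_vanish d x W \<longrightarrow> W = \<Lambda>)"
      unfolding Ball_def fano_iff[OF fd] same by (simp only: imp_conjL)
    also have "\<dots> \<longleftrightarrow> (\<forall>W\<in>planes k. forms_vanish d y W \<longrightarrow> W = coordinate_plane K)"
    proof (intro iffI ballI impI)
      fix W assume *: "\<forall>W\<in>planes k. forms_vanish d x W \<longrightarrow> W = \<Lambda>"
        and W: "W \<in> planes k" "forms_vanish d y W"
      have "shear_image K (\<lambda>x. - T x) W \<in> planes k"
        using planes[of W "\<lambda>x. - T x"] shear_image_inverse(1)[of K T W] W(1) by simp
      moreover have "forms_vanish d x (shear_image K (\<lambda>x. - T x) W)"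
        using W(2) by (simp add: van)
      ultimately have "shear_image K (\<lambda>x. - T x) W = shear_image K (\<lambda>x. - T x) (coordinate_plane K)"
        using * \<Lambda>G by blast
      then show "W = coordinate_plane K" using shear_image_inverse(1)[of K T] by metis
    next
      fix W assume *: "\<forall>W\<in>planes k. forms_vanish d y W \<longrightarrow> W = coordinate_plane K"
        and W: "W \<in> planes k" "forms_vanish d x W"
      have WW: "W = shear_image K (\<lambda>x. - T x) (shear_image K T W)" by (simp add: shear_image_inverse)
      have "shear_image K T W \<in> planes k" using planes[OF WW] W(1) by simp
      moreover have "forms_vanish d y (shear_image K T W)"
        using W(2) unfolding van[symmetric] shear_image_inverse(2) .
      ultimately have "shear_image K T W = coordinate_plane K" using * by blast
      then show "W = \<Lambda>" using WW \<Lambda>G by simp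
    qed
    also have "\<dots> \<longleftrightarrow> delta n d k < 0" by (rule P(3)[OF y0 Py])
    finally show ?thesis .
  qed
  obtain U where U: "openin (zariski ?L) U" "zariski ?L closure_of U = topspace (zariski ?L)"
    "\<forall>l\<in>U. \<exists>x\<in>?L. (\<exists>i. x i \<noteq> 0) \<and> l = line_of x \<and> Q x \<noteq> 0"
    using generically_nonvanishing[OF lin Qpoly u0] unfolding generically_def by blast
  show ?thesis
    unfolding generically_def
  proof (intro exI[of _ U] conjI U(1,2) ballI impI)
    fix l f assume l: "l \<in> U" and f: "f \<in> forms_vanishing_on d \<Lambda>" and fl: "line_of (coeff_vector f) = l"
    obtain x where x: "x \<in> ?L" "\<exists>i. x i \<noteq> 0" "l = line_of x" "Q x \<noteq> 0" using U(3) l by blast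
    show "fano k f = {\<Lambda>} \<longleftrightarrow> delta n d k < 0"
      by (rule generic[OF f x(1,2,4)]) (use fl x(3) in simp)
  qed
qed

theorem corollary2p5:
  fixes n k s :: nat and d :: "nat list"
  assumes "CARD('n::finite) = n + 1"
    and "k \<le> n"
    and "length d = s" and "s \<ge> 1"
    and "\<forall>e\<in>set d. e \<ge> 2"
    and "d \<noteq> [2]"
  shows "generically (grassmannian k :: (complex ^ 'n) set topology) (\<lambda>\<Lambda>'.
           generically (zariski (coeff_vector ` forms_vanishing_on d \<Lambda>')) (\<lambda>l.
             \<forall>f\<in>forms_vanishing_on d \<Lambda>'. line_of (coeff_vector f) = l \<longrightarrow>
               (fano k f = {\<Lambda>'} \<longleftrightarrow> delta n d k < 0)))"
proof -
  let ?G = "grassmannian k :: (complex ^ 'n) set topology"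
  have "d \<noteq> []" using assms(3,4) by auto
  then have "generically (zariski (coeff_vector ` forms_vanishing_on d \<Lambda>')) (\<lambda>l.
             \<forall>f\<in>forms_vanishing_on d \<Lambda>'. line_of (coeff_vector f) = l \<longrightarrow>
               (fano k f = {\<Lambda>'} \<longleftrightarrow> delta n d k < 0))" if "\<Lambda>' \<in> topspace ?G" for \<Lambda>'
    using that assms by (intro generic_forms_on_plane) (auto simp: grassmannian_def topspace_pullback_topology)
  then show ?thesis
    unfolding generically_def[of ?G] by (intro exI[of _ "topspace ?G"]) simp
qed

end
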